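(* Let $0<p<1$. Suppose that $X=(X_t)_{t\ge 0}$ is an adapted supermartingale with only nonnegative jumps (i.e. $\Delta X_t\ge 0$ for all $t$), satisfying $X_0=0$ almost surely. Then $$\|M^+\|_p\le c_p\,\|M^-\|_p ,\qquad c_p=\left(\left(\frac1p-1\right)^p+\int_{p^{-1}-1}^\infty \frac{s^{p-1}}{s+1}\,\mathrm ds\right)^{1/p},$$ and the constant $c_p$ is the best possible (it cannot be replaced by any smaller constant valid for all such $X$). It is already the best possible if $X$ is assumed to be a stopped Brownian motion, i.e. $X=(B_{\eta\wedge t})_{t\ge 0}$ for a standard one-dimensional Brownian motion $B$ started at $0$ and a stopping time $\eta$ of $B$.
   Context: Setting: $(\Omega,\mathcal F,\mathbb P)$ is a complete probability space with a filtration $(\mathcal F_t)_{t\ge 0}$ (a nondecreasing family of sub-$\sigma$-algebras of $\mathcal F$) such that $\mathcal F_0$ contains all events of probability $0$. All processes $X$ considered are adapted to this filtration and have right-continuous trajectories with left limits. $\Delta X_t=X_t-X_{t-}$ is the jump of $X$ at time $t$, with the convention $X_{0-}=0$. Supremum and infimum processes: $M^+_t=\left(\sup_{0\le s\le t}X_s\right)\vee 0$ and $M^-_t=\left(\inf_{0\le s\le t}X_s\right)\wedge 0$, where $a\vee b=\max\{a,b\}$ and $a\wedge b=\min\{a,b\}$. For a process $Y=(Y_t)_{t\ge0}$, $\|Y\|_p=\sup_{t\ge 0}\left(\mathbb E|Y_t|^p\right)^{1/p}$. *)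

theory Defs
  imports "HOL-Probability.Probability"
begin

text \<open>
  Time is the half-line \<open>[0, \<infinity>)\<close>, represented by the nonnegative reals: values of a
  filtration or a process at negative times are never looked at.
\<close>

locale complete_filtered_prob_space = prob_space M + complete_measure M
  for M :: "'a measure" +
  fixes F :: "real \<Rightarrow> 'a measure"
  assumes subalg: "\<And>t. 0 \<le> t \<Longrightarrow> subalgebra M (F t)"
    and mono: "\<And>s t. 0 \<le> s \<Longrightarrow> s \<le> t \<Longrightarrow> sets (F s) \<subseteq> sets (F t)"
    and null_sets_0: "null_sets M \<subseteq> sets (F 0)"

definition adapted :: "(real \<Rightarrow> 'a measure) \<Rightarrow> (real \<Rightarrow> 'a \<Rightarrow> real) \<Rightarrow> bool" where
  "adapted F X \<longleftrightarrow> (\<forall>t\<ge>0. X t \<in> borel_measurable (F t))"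

definition cadlag :: "'a measure \<Rightarrow> (real \<Rightarrow> 'a \<Rightarrow> real) \<Rightarrow> bool" where
  "cadlag M X \<longleftrightarrow> (\<forall>\<omega>\<in>space M.
     (\<forall>t\<ge>0. continuous (at_right t) (\<lambda>s. X s \<omega>)) \<and>
     (\<forall>t>0. \<exists>l. ((\<lambda>s. X s \<omega>) \<longlongrightarrow> l) (at_left t)))"

definition supermartingale ::
    "'a measure \<Rightarrow> (real \<Rightarrow> 'a measure) \<Rightarrow> (real \<Rightarrow> 'a \<Rightarrow> real) \<Rightarrow> bool" where
  "supermartingale M F X \<longleftrightarrow>
     adapted F X \<and>
     (\<forall>t\<ge>0. integrable M (X t)) \<and>
     (\<forall>s\<ge>0. \<forall>t\<ge>s. AE \<omega> in M. real_cond_exp M (F s) (X t) \<omega> \<le> X s \<omega>)"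

text \<open>\<open>X\<^sub>t\<^sub>-\<close>, with the convention \<open>X\<^sub>0\<^sub>- = 0\<close>.\<close>

definition left_lim :: "(real \<Rightarrow> 'a \<Rightarrow> real) \<Rightarrow> real \<Rightarrow> 'a \<Rightarrow> real" where
  "left_lim X t \<omega> = (if t = 0 then 0 else Lim (at_left t) (\<lambda>s. X s \<omega>))"

definition jump :: "(real \<Rightarrow> 'a \<Rightarrow> real) \<Rightarrow> real \<Rightarrow> 'a \<Rightarrow> real" where
  "jump X t \<omega> = X t \<omega> - left_lim X t \<omega>"

definition nonneg_jump_supermartingale ::
    "'a measure \<Rightarrow> (real \<Rightarrow> 'a measure) \<Rightarrow> (real \<Rightarrow> 'a \<Rightarrow> real) \<Rightarrow> bool" where
  "nonneg_jump_supermartingale M F X \<longleftrightarrow>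
     supermartingale M F X \<and> cadlag M X \<and>
     (AE \<omega> in M. \<forall>t\<ge>0. 0 \<le> jump X t \<omega>) \<and>
     (AE \<omega> in M. X 0 \<omega> = 0)"

text \<open>
  The paths of a cadlag process are bounded on \<open>[0, t]\<close>, so the real-valued supremum and
  infimum below are the genuine ones.
\<close>

definition sup_process :: "(real \<Rightarrow> 'a \<Rightarrow> real) \<Rightarrow> real \<Rightarrow> 'a \<Rightarrow> real" where
  "sup_process X t \<omega> = max (SUP s\<in>{0..t}. X s \<omega>) 0"

definition inf_process :: "(real \<Rightarrow> 'a \<Rightarrow> real) \<Rightarrow> real \<Rightarrow> 'a \<Rightarrow> real" where
  "inf_process X t \<omega> = min (INF s\<in>{0..t}. X s \<omega>) 0"

text \<open>Real powers on \<open>[0, \<infinity>]\<close>; meant for exponents \<open>a > 0\<close>.\<close>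

definition ennreal_powr :: "ennreal \<Rightarrow> real \<Rightarrow> ennreal" where
  "ennreal_powr x a = (if x = \<infinity> then \<infinity> else ennreal (enn2real x powr a))"

definition process_norm :: "'a measure \<Rightarrow> real \<Rightarrow> (real \<Rightarrow> 'a \<Rightarrow> real) \<Rightarrow> ennreal" where
  "process_norm M p Y =
     (SUP t\<in>{0..}. ennreal_powr (\<integral>\<^sup>+ \<omega>. ennreal (\<bar>Y t \<omega>\<bar> powr p) \<partial>M) (1 / p))"

definition c_const :: "real \<Rightarrow> real" where
  "c_const p =
     ((1 / p - 1) powr p + (LBINT s:{1 / p - 1..}. s powr (p - 1) / (s + 1))) powr (1 / p)"

definition brownian_motion :: "'a measure \<Rightarrow> (real \<Rightarrow> 'a \<Rightarrow> real) \<Rightarrow> bool" where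
  "brownian_motion M B \<longleftrightarrow>
     prob_space M \<and>
     (\<forall>t\<ge>0. B t \<in> borel_measurable M) \<and>
     (AE \<omega> in M. B 0 \<omega> = 0) \<and>
     (\<forall>\<omega>\<in>space M. continuous_on {0..} (\<lambda>t. B t \<omega>)) \<and>
     (\<forall>s\<ge>0. \<forall>t>s. distributed M lborel (\<lambda>\<omega>. B t \<omega> - B s \<omega>) (normal_density 0 (sqrt (t - s)))) \<and>
     (\<forall>(n::nat) u. 0 \<le> u 0 \<and> (\<forall>i<n. u i \<le> u (Suc i)) \<longrightarrow>
        prob_space.indep_vars M (\<lambda>_. borel) (\<lambda>i \<omega>. B (u (Suc i)) \<omega> - B (u i) \<omega>) {..<n})"

text \<open>The filtration generated by \<open>B\<close>, augmented by the null sets of \<open>M\<close>.\<close>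

definition augmented_filtration ::
    "'a measure \<Rightarrow> (real \<Rightarrow> 'a \<Rightarrow> real) \<Rightarrow> real \<Rightarrow> 'a measure" where
  "augmented_filtration M B t =
     sigma (space M)
       ({B s -` A \<inter> space M | s A. 0 \<le> s \<and> s \<le> t \<and> A \<in> sets borel} \<union> null_sets M)"

text \<open>
  Stopping times may take the value \<open>\<infinity>\<close>, so the library's notion is used with time index
  \<^typ>\<open>ennreal\<close>. At index \<open>\<infinity>\<close>, where \<^const>\<open>enn2real\<close> returns \<open>0\<close>, its condition is trivial.
\<close>

definition stopping_time_ext :: "(real \<Rightarrow> 'a measure) \<Rightarrow> ('a \<Rightarrow> ennreal) \<Rightarrow> bool" where
  "stopping_time_ext F \<eta> \<longleftrightarrow> stopping_time (\<lambda>t. F (enn2real t)) \<eta>"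

definition stopped :: "(real \<Rightarrow> 'a \<Rightarrow> real) \<Rightarrow> ('a \<Rightarrow> ennreal) \<Rightarrow> real \<Rightarrow> 'a \<Rightarrow> real" where
  "stopped B \<eta> t \<omega> = B (enn2real (min (\<eta> \<omega>) (ennreal t))) \<omega>"

end

theory Submission
  imports Defs
begin

text \<open>
  Write \<open>m\<close> for the negative of the running infimum, \<open>M\<close> for the running supremum,
  \<open>g r = \<integral>\<^sub>r s powr (p - 1) / (s + 1) ds\<close> (over \<open>[r, \<infinity>)\<close>), \<open>\<gamma> = 1/p - 1\<close> and \<open>C = c\<^sub>p powr p\<close>.
  With \<open>r = max (M/m) \<gamma>\<close>, the potential \<open>m powr p * (r powr p - C) + (x + m) * p * m powr (p - 1) * g r\<close>
  dominates \<open>M powr p - C * m powr p\<close>, is nonpositive at the start, and along a discretised path it grows at most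
  like a nonnegative multiple of the increment of \<open>x\<close>, up to an error proportional to the largest
  downward step. Since a cadlag path without negative jumps has no large downward steps on fine grids,
  refining the grid gives the inequality.

  For the sharpness, take \<open>\<theta> < \<gamma>\<close> close to \<open>\<gamma>\<close> and let a Brownian motion run as long as
  \<open>M < \<theta> * m\<close>; once \<open>M \<ge> \<theta> * m\<close>, stop it at its return to the current minimum.
  A discretised version of the corresponding value function is a submartingale up to errors of the order
  of the fourth moments of the increments, which vanish as the grid is refined. The Brownian
  motion itself comes from Levy's dyadic construction; its increments are identified through
  characteristic functions, conditionally on events of the past.
\<close>

section \<open>The upper bound\<close>

text \<open>Any threshold c > 0 could play the role of \<gamma>: the same potential built with c
  proves the inequality with constant c^p + \<open>tail p c\<close>. The derivative of this
  expression in c is c^(p-1) * (p - 1/(c+1)), so c = 1/p - 1 is its minimiser; this is the origin of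
  the constant. From the other side, switching at ratio \<theta> is worth \<theta>^p + (1 +
  \<theta>) * p * \<open>tail p \<theta>\<close> per unit of m^p. This increases in \<theta> and
  meets C at \<theta> = \<gamma>, because (1 + \<gamma>) * p = 1. The free phase gets down to -m
  without switching with probability of order m^(-1/(1+\<theta>)), so the expected loss at a forced
  exit at m = N is of order N^(p - 1/(1+\<theta>)). It vanishes for large N exactly when \<theta> <
  \<gamma>, which is why \<gamma> is approached from below. Two obstacles shape the upper bound. The
  factor m^(p-1) is unbounded near m = 0, so m starts from a floor e > 0 that is removed last. The
  largest downward step on a grid need not be integrable uniformly in the grid; freezing the path
  after a fall of more than one leaves a bounded error and a single large fall.\<close>

definition tail :: "real \<Rightarrow> real \<Rightarrow> real" where
  "tail p r = (LBINT s:{r..}. s powr (p - 1) / (s + 1))"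

section \<open>Integral estimates for \<open>tail\<close> and for powers\<close>

lemma powr_minus_two_integral:
  fixes p r :: real
  assumes "p < 1" "0 < r"
  shows "(\<integral>\<^sup>+ s. ennreal (s powr (p - 2)) * indicator {r..} s \<partial>lborel) = ennreal (r powr (p - 1) / (1 - p))"
proof -
  have "(\<integral>\<^sup>+ s. ennreal (s powr (p - 2)) * indicator {r..} s \<partial>lborel) = ennreal (0 - r powr (p - 1) / (p - 1))"
  proof (rule nn_integral_FTC_atLeast)
    show "((\<lambda>s. s powr (p - 1) / (p - 1)) \<longlongrightarrow> 0) at_top"
      using tendsto_divide_zero[OF tendsto_neg_powr[OF _ filterlim_ident], of "p - 1"] assms by simp
    show "((\<lambda>s. s powr (p - 1) / (p - 1)) has_real_derivative s powr (p - 2)) (at s)" if "r \<le> s" for s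
      using DERIV_cdivide[OF has_real_derivative_powr[of s "p - 1"], of "p - 1"] assms that by simp
  qed auto
  also have "0 - r powr (p - 1) / (p - 1) = r powr (p - 1) / (1 - p)"
    using assms by (simp add: field_simps)
  finally show ?thesis .
qed

lemma powr_minus_one_div_le:
  fixes p s :: real
  assumes "0 < s"
  shows "s powr (p - 1) / (s + 1) \<le> s powr (p - 2)"
proof -
  have "s powr (p - 2) = s powr (p - 1) / s"
    using assms by (simp add: powr_diff power2_eq_square)
  then show ?thesis
    using assms by (simp add: frac_le)
qed

lemma set_integrable_powr_minus_two:
  fixes p r :: real
  assumes "p < 1" "0 < r"
  shows "set_integrable lborel {r..} (\<lambda>s. s powr (p - 2))"
  unfolding set_integrable_def
proof (rule integrableI_nonneg)
  have "(\<integral>\<^sup>+ s. ennreal (indicator {r..} s *\<^sub>R s powr (p - 2)) \<partial>lborel)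
      = (\<integral>\<^sup>+ s. ennreal (s powr (p - 2)) * indicator {r..} s \<partial>lborel)"
    by (intro nn_integral_cong) (auto simp: indicator_def)
  then show "(\<integral>\<^sup>+ s. ennreal (indicator {r..} s *\<^sub>R s powr (p - 2)) \<partial>lborel) < \<infinity>"
    using powr_minus_two_integral[OF assms] by simp
qed auto

lemma tail_integrable:
  fixes p r :: real
  assumes "p < 1" "0 < r"
  shows "set_integrable lborel {r..} (\<lambda>s. s powr (p - 1) / (s + 1))"
proof (rule set_integrable_bound[OF set_integrable_powr_minus_two[OF assms]])
  show "set_borel_measurable lborel {r..} (\<lambda>s. s powr (p - 1) / (s + 1))"
    unfolding set_borel_measurable_def by measurable
  show "AE s in lborel. s \<in> {r..} \<longrightarrow> norm (s powr (p - 1) / (s + 1)) \<le> norm (s powr (p - 2))"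
    using powr_minus_one_div_le[of _ p] assms by (intro AE_I2) auto
qed

lemma tail_nonneg: "0 < r \<Longrightarrow> 0 \<le> tail p r"
  unfolding tail_def set_lebesgue_integral_def
  by (intro integral_nonneg_AE AE_I2) (auto simp: indicator_def)

lemma tail_le:
  assumes "p < 1" "0 < r"
  shows "tail p r \<le> r powr (p - 1) / (1 - p)"
proof -
  have "tail p r \<le> (LBINT s:{r..}. s powr (p - 2))"
    unfolding tail_def
    by (intro set_integral_mono tail_integrable set_integrable_powr_minus_two assms powr_minus_one_div_le)
      (use assms in auto)
  also have "\<dots> = r powr (p - 1) / (1 - p)"
  proof -
    have "(\<integral>\<^sup>+ s. ennreal (indicator {r..} s *\<^sub>R s powr (p - 2)) \<partial>lborel)
        = (\<integral>\<^sup>+ s. ennreal (s powr (p - 2)) * indicator {r..} s \<partial>lborel)"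
      by (intro nn_integral_cong) (auto simp: indicator_def)
    then show ?thesis
      unfolding set_lebesgue_integral_def
      by (subst integral_eq_nn_integral) (use powr_minus_two_integral[OF assms] assms in auto)
  qed
  finally show ?thesis .
qed

text \<open>Lets the sharpness part truncate the ratio M/m at a finite \<rho> at an arbitrarily
  small cost.\<close>

lemma tail_tendsto_0:
  assumes "p < 1"
  shows "(tail p \<longlongrightarrow> 0) at_top"
proof (rule tendsto_sandwich[of "\<lambda>_. 0"])
  show "((\<lambda>r. r powr (p - 1) / (1 - p)) \<longlongrightarrow> 0) at_top"
    using tendsto_divide_zero[OF tendsto_neg_powr[OF _ filterlim_ident], of "p - 1"] assms by simp
  show "\<forall>\<^sub>F r in at_top. 0 \<le> tail p r" "\<forall>\<^sub>F r in at_top. tail p r \<le> r powr (p - 1) / (1 - p)"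
    using eventually_gt_at_top[of 0] by (eventually_elim, use tail_nonneg tail_le assms in auto)+
qed auto

lemma
  fixes p a b :: real
  assumes "0 < p" "0 < a" "a \<le> b"
  shows powr_integral: "(LBINT s:{a..b}. p * s powr (p - 1)) = b powr p - a powr p"
    and powr_set_integrable: "set_integrable lborel {a..b} (\<lambda>s. p * s powr (p - 1))"
proof -
  have "has_bochner_integral lborel (\<lambda>s. (p * s powr (p - 1)) * indicator {a..b} s) (b powr p - a powr p)"
    using assms
    by (intro has_bochner_integral_FTC_Icc_nonneg) (auto intro!: derivative_eq_intros)
  then show "(LBINT s:{a..b}. p * s powr (p - 1)) = b powr p - a powr p"
    "set_integrable lborel {a..b} (\<lambda>s. p * s powr (p - 1))"
    unfolding set_integrable_def set_lebesgue_integral_def has_bochner_integral_iff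
    by (simp_all only: mult.commute real_scaleR_def)
qed

lemma tail_diff:
  assumes "p < 1" "0 < a" "a \<le> b"
  shows "tail p a - tail p b = (LBINT s:{a..b}. s powr (p - 1) / (s + 1))"
proof -
  let ?f = "\<lambda>s. s powr (p - 1) / (s + 1)"
  have i: "set_integrable lborel {a..} ?f"
    using assms by (intro tail_integrable) auto
  have "tail p a = (LBINT s:{a..b} \<union> {b<..}. ?f s)"
    using assms unfolding tail_def by (intro arg_cong[where f="\<lambda>A. set_lebesgue_integral lborel A ?f"]) auto
  also have "\<dots> = (LBINT s:{a..b}. ?f s) + (LBINT s:{b<..}. ?f s)"
    using assms by (intro set_integral_Un set_integrable_subset[OF i]) auto
  also have "(LBINT s:{b<..}. ?f s) = tail p b"
    unfolding tail_def set_lebesgue_integral_def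
  proof (rule integral_cong_AE)
    show "AE s in lborel. indicator {b<..} s *\<^sub>R ?f s = indicator {b..} s *\<^sub>R ?f s"
      using AE_lborel_singleton[of b] by eventually_elim (auto simp: indicator_def)
  qed measurable
  finally show ?thesis by simp
qed

lemma tail_antimono:
  assumes "p < 1" "0 < a" "a \<le> b"
  shows "tail p b \<le> tail p a"
proof -
  have "0 \<le> (LBINT s:{a..b}. s powr (p - 1) / (s + 1))"
    unfolding set_lebesgue_integral_def
    using assms by (intro integral_nonneg_AE AE_I2) (auto simp: indicator_def)
  then show ?thesis using tail_diff[OF assms] by simp
qed

lemma tail_diff_integrable:
  fixes p a b :: real
  assumes "p < 1" "0 < a"
  shows "set_integrable lborel {a..b} (\<lambda>s. s powr (p - 1) / (s + 1))"
  by (rule set_integrable_subset[OF tail_integrable[of p a]]) (use assms in auto)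

text \<open>Both differences are integrals over [a, b] whose integrands have ratio p * (s + 1), and
  s + 1 \<le> b + 1. With a and b the ratios M/m before and after a new maximum, the weight at the
  upper end is exactly x'/m + 1, as \<open>potential_step\<close> requires.\<close>

lemma powr_diff_le_tail_diff:
  assumes p: "0 < p" "p < 1" and ab: "0 < a" "a \<le> b"
  shows "b powr p - a powr p \<le> p * (b + 1) * (tail p a - tail p b)"
proof -
  have "b powr p - a powr p = (LBINT s:{a..b}. p * s powr (p - 1))"
    using powr_integral[of p a b] p ab by simp
  also have "\<dots> \<le> (LBINT s:{a..b}. (p * (b + 1)) * (s powr (p - 1) / (s + 1)))"
  proof (rule set_integral_mono)
    show "set_integrable lborel {a..b} (\<lambda>s. (p * (b + 1)) * (s powr (p - 1) / (s + 1)))"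
      using p ab by (intro set_integrable_mult_right impI tail_diff_integrable) auto
    show "p * s powr (p - 1) \<le> (p * (b + 1)) * (s powr (p - 1) / (s + 1))" if "s \<in> {a..b}" for s
    proof -
      have "1 * (p * s powr (p - 1)) \<le> ((b + 1) / (s + 1)) * (p * s powr (p - 1))"
        using that ab p by (intro mult_right_mono) auto
      then show ?thesis by (simp add: mult_ac)
    qed
  qed (use powr_set_integrable[of p a b] p ab in auto)
  also have "\<dots> = p * (b + 1) * (tail p a - tail p b)"
    unfolding tail_diff[OF p(2) ab] by (intro set_integral_mult_right)
  finally show ?thesis .
qed

text \<open>The converse comparison: a weight w \<le> a + 1 stays below s + 1 on all of [a, b]. It
  serves the continuity of \<open>tail\<close>, with w = 1, and the second phase of the strategy,
  with w the lowered height over the minimum.\<close>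

lemma tail_diff_le_powr_diff:
  assumes p: "0 < p" "p < 1" and ab: "0 < a" "a \<le> b" and w: "0 \<le> w" "w \<le> a + 1"
  shows "p * w * (tail p a - tail p b) \<le> b powr p - a powr p"
proof -
  have "p * w * (tail p a - tail p b) = (LBINT s:{a..b}. (p * w) * (s powr (p - 1) / (s + 1)))"
    unfolding tail_diff[OF p(2) ab] by (intro set_integral_mult_right[symmetric])
  also have "\<dots> \<le> (LBINT s:{a..b}. p * s powr (p - 1))"
  proof (rule set_integral_mono)
    show "set_integrable lborel {a..b} (\<lambda>s. (p * w) * (s powr (p - 1) / (s + 1)))"
      using p ab by (intro set_integrable_mult_right impI tail_diff_integrable) auto
    show "(p * w) * (s powr (p - 1) / (s + 1)) \<le> p * s powr (p - 1)" if "s \<in> {a..b}" for s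
    proof -
      have "(w / (s + 1)) * (p * s powr (p - 1)) \<le> 1 * (p * s powr (p - 1))"
        using that ab p w by (intro mult_right_mono) auto
      then show ?thesis by (simp add: mult_ac)
    qed
  qed (use powr_set_integrable[of p a b] p ab in auto)
  also have "\<dots> = b powr p - a powr p"
    using powr_integral[of p a b] p ab by simp
  finally show ?thesis .
qed

lemma powr_diff_ge:
  fixes p a b :: real
  assumes "0 < p" "p < 1" "0 < a" "a \<le> b"
  shows "p * b powr (p - 1) * (b - a) \<le> b powr p - a powr p"
proof (cases "a = b")
  case False
  then obtain z where z: "z > a" "z < b" "b powr p - a powr p = (b - a) * (p * z powr (p - 1))"
    using MVT2[of a b "\<lambda>x. x powr p" "\<lambda>x. p * x powr (p - 1)"] assms
      has_real_derivative_powr[of _ p]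
    by (smt (verit, best))
  have "b powr (p - 1) \<le> z powr (p - 1)"
    using z assms by (intro powr_mono2') auto
  then have "(b - a) * (p * b powr (p - 1)) \<le> (b - a) * (p * z powr (p - 1))"
    using assms by (intro mult_left_mono) auto
  then show ?thesis using z by (simp add: mult_ac)
qed auto

lemma powr_diff_upper:
  fixes p a b :: real
  assumes "0 < p" "p < 1" "0 < a" "a \<le> b"
  shows "b powr p - a powr p \<le> p * a powr (p - 1) * (b - a)"
proof (cases "a = b")
  case False
  then obtain z where z: "z > a" "z < b" "b powr p - a powr p = (b - a) * (p * z powr (p - 1))"
    using MVT2[of a b "\<lambda>x. x powr p" "\<lambda>x. p * x powr (p - 1)"] assms
      has_real_derivative_powr[of _ p]
    by (smt (verit, best))
  have "z powr (p - 1) \<le> a powr (p - 1)"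
    using z assms by (intro powr_mono2') auto
  then have "(b - a) * (p * z powr (p - 1)) \<le> (b - a) * (p * a powr (p - 1))"
    using assms by (intro mult_left_mono) auto
  then show ?thesis using z by (simp add: mult_ac)
qed auto

text \<open>After division by a + b this is t \<le> t^p on [0, 1], applied to the two fractions. It
  separates the floor e from the running infimum before e tends to 0.\<close>

lemma powr_add_le:
  fixes p a b :: real
  assumes "0 < p" "p < 1" "0 \<le> a" "0 \<le> b"
  shows "(a + b) powr p \<le> a powr p + b powr p"
proof (cases "a + b = 0")
  case False
  then have s: "0 < a + b" using assms by linarith
  have *: "c / (a + b) \<le> (c / (a + b)) powr p" if "0 \<le> c" "c \<le> a + b" for c
    using powr_mono'[of p 1 "c / (a + b)"] assms that s by simp
  have "1 = a / (a + b) + b / (a + b)"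
    using s by (simp add: add_divide_distrib[symmetric])
  also have "\<dots> \<le> (a / (a + b)) powr p + (b / (a + b)) powr p"
    by (intro add_mono *) (use assms in auto)
  also have "\<dots> = (a powr p + b powr p) / (a + b) powr p"
    using assms by (simp add: powr_divide add_divide_distrib)
  finally show ?thesis
    using s by (simp add: pos_le_divide_eq)
qed (use assms in auto)

section \<open>The constant, the potential and its one-step estimate\<close>

definition cutoff :: "real \<Rightarrow> real" where "cutoff p = 1 / p - 1"

text \<open>With this value the potential equals -\<open>tail p (cutoff p)\<close> * m^p at x = -m
  for M below \<open>cutoff p * m\<close>, and its derivative in m vanishes there: a new minimum
  costs nothing to first order.\<close>

definition ratio_const :: "real \<Rightarrow> real" where
  "ratio_const p = cutoff p powr p + tail p (cutoff p)"

text \<open>For \<open>M \<ge> cutoff p * m\<close> the slope in \<open>x\<close> is such that the derivative of the potential in \<open>M\<close>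
  vanishes at \<open>x = M\<close>.\<close>

definition slope :: "real \<Rightarrow> real \<Rightarrow> real \<Rightarrow> real" where
  "slope p m M = p * m powr (p - 1) * tail p (max (M / m) (cutoff p))"

definition potential :: "real \<Rightarrow> real \<Rightarrow> real \<Rightarrow> real \<Rightarrow> real" where
  "potential p x m M =
     max M (cutoff p * m) powr p - ratio_const p * m powr p + (x + m) * slope p m M"

lemma cutoff_pos: "0 < p \<Longrightarrow> p < 1 \<Longrightarrow> 0 < cutoff p"
  by (simp add: cutoff_def)

lemma ratio_const_pos: "0 < p \<Longrightarrow> p < 1 \<Longrightarrow> 0 < ratio_const p"
  using cutoff_pos[of p] tail_nonneg[of "cutoff p" p] by (simp add: ratio_const_def add_pos_nonneg)

lemma slope_nonneg: "0 < p \<Longrightarrow> p < 1 \<Longrightarrow> 0 \<le> slope p m M"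
  using cutoff_pos[of p] tail_nonneg[of "max (M / m) (cutoff p)" p] by (simp add: slope_def)

lemma slope_le:
  assumes "0 < p" "p < 1"
  shows "slope p m M \<le> p * m powr (p - 1) * tail p (cutoff p)"
  unfolding slope_def
  using assms cutoff_pos[of p] by (intro mult_left_mono tail_antimono) auto

lemma potential_lower:
  assumes "0 < p" "p < 1" "0 \<le> M" "- m \<le> x"
  shows "M powr p - ratio_const p * m powr p \<le> potential p x m M"
proof -
  have "M powr p \<le> max M (cutoff p * m) powr p"
    using assms by (intro powr_mono2) auto
  moreover have "0 \<le> (x + m) * slope p m M"
    using assms slope_nonneg[of p] by simp
  ultimately show ?thesis by (simp add: potential_def)
qed

text \<open>The value is (p - 1) * m^p * \<open>tail p (cutoff p)\<close>, and p < 1.\<close>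

lemma potential_start:
  assumes "0 < p" "p < 1" "0 < m"
  shows "potential p 0 m 0 \<le> 0"
proof -
  have "potential p 0 m 0 = cutoff p powr p * m powr p - ratio_const p * m powr p
      + (m * m powr (p - 1)) * (p * tail p (cutoff p))"
    using assms cutoff_pos[of p] by (simp add: potential_def slope_def powr_mult)
  also have "m * m powr (p - 1) = m powr p"
    using assms by (simp add: powr_diff)
  also have "cutoff p powr p * m powr p - ratio_const p * m powr p + m powr p * (p * tail p (cutoff p))
      = (p - 1) * (m powr p * tail p (cutoff p))"
    by (simp add: ratio_const_def algebra_simps)
  also have "\<dots> \<le> 0"
    using assms cutoff_pos[of p] tail_nonneg[of "cutoff p" p] by (intro mult_nonpos_nonneg) auto
  finally show ?thesis .
qed

text \<open>If no new minimum is set, then m' = m and the error term is zero; a new maximum is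
  handled by comparing integrals up to x'/m. If x' falls below -m, then x' + m' = 0 and M is
  unchanged, and only the convexity defect of m^p over one step remains. The error has the form of a
  drop size times a decrement of m^(p-1) so that it telescopes along a path.\<close>

lemma potential_step:
  fixes p m M x x' :: real
  assumes p: "0 < p" "p < 1" and m: "0 < m" and M: "0 \<le> M" and x: "- m \<le> x" "x \<le> M"
  defines "m' \<equiv> max m (- x')" and "M' \<equiv> max M x'"
  shows "potential p x' m' M' \<le> potential p x m M + slope p m M * (x' - x)
    + p * tail p (cutoff p) * (m' - m) * (m powr (p - 1) - m' powr (p - 1))"
proof (cases "- m \<le> x'")
  case True
  define r where "r = max (M / m) (cutoff p)"
  define r' where "r' = max (M' / m) (cutoff p)"
  have c: "0 < cutoff p" using cutoff_pos p by auto
  have m': "m' = m" using True by (simp add: m'_def)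
  have scale: "max N (cutoff p * m) powr p = m powr p * max (N / m) (cutoff p) powr p" if "0 \<le> N" for N
  proof -
    have "max N (cutoff p * m) = m * max (N / m) (cutoff p)"
      using m by (simp add: max_def field_simps)
    then show ?thesis using m that c by (simp add: powr_mult)
  qed
  \<comment> \<open>If the truncated ratio changes at all, then M' = x', so the upper end of the
    integrals is x'/m.\<close>
  have "r' powr p - r powr p \<le> p * (x' / m + 1) * (tail p r - tail p r')"
  proof (cases "r' = r")
    case False
    then have "M' \<noteq> M" by (auto simp: r_def r'_def)
    then have "M' = x'" "M < x'" by (auto simp: M'_def)
    moreover from this have "M / m \<le> x' / m" using m by (simp add: divide_right_mono)
    ultimately have "r' = x' / m" "r \<le> r'"
      using False unfolding r_def r'_def by (auto simp: max_def split: if_splits)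
    then show ?thesis
      using powr_diff_le_tail_diff[of p r r'] p c by (auto simp: r_def)
  qed auto
  then have "m powr p * (r' powr p - r powr p) \<le> m powr p * (p * (x' / m + 1) * (tail p r - tail p r'))"
    by (intro mult_left_mono) auto
  also have "\<dots> = (x' + m) * (p * m powr (p - 1)) * (tail p r - tail p r')"
    using m by (simp add: powr_diff field_simps)
  finally have "m powr p * r' powr p - m powr p * r powr p
      \<le> (x' + m) * (p * m powr (p - 1)) * (tail p r - tail p r')"
    by (simp add: algebra_simps)
  moreover have "potential p x' m' M' = m powr p * r' powr p - ratio_const p * m powr p
      + (x' + m) * (p * m powr (p - 1) * tail p r')"
    using scale[of M'] M by (simp add: potential_def slope_def m' r'_def M'_def)
  moreover have "potential p x m M = m powr p * r powr p - ratio_const p * m powr p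
      + (x + m) * (p * m powr (p - 1) * tail p r)"
    using scale[of M] M by (simp add: potential_def slope_def r_def)
  moreover have "slope p m M = p * m powr (p - 1) * tail p r"
    by (simp add: slope_def r_def)
  ultimately show ?thesis by (simp add: m' algebra_simps)
next
  case False
  define c where "c = cutoff p"
  define T where "T = tail p c"
  have c: "0 < c" using cutoff_pos p by (auto simp: c_def)
  have T: "0 \<le> T" using tail_nonneg c by (auto simp: T_def)
  have m': "m' = - x'" "m < m'" and M': "M' = M"
    using False M m by (auto simp: m'_def M'_def)
  \<comment> \<open>As m grows to m', the truncated maximum moves only through the part of
    [c * m, c * m'] above M.\<close>
  have "max M (c * m') powr p - max M (c * m) powr p \<le> c powr p * (m' powr p - m powr p)"
  proof -
    have q: "(c * m') powr p = c powr p * m' powr p" "(c * m) powr p = c powr p * m powr p"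
      using m'(2) m c by (auto simp: powr_mult)
    consider "M \<ge> c * m'" | "M \<le> c * m" | "c * m < M" "M < c * m'" by linarith
    then show ?thesis
    proof cases
      case 1
      then have "M \<ge> c * m" using m' c by (meson less_imp_le mult_left_mono order_trans)
      then show ?thesis using 1 m' m p by (simp add: max_def powr_mono2)
    next
      case 2
      then have "M \<le> c * m'" using m' c by (meson less_imp_le mult_left_mono order_trans)
      then show ?thesis using 2 q by (simp add: max_absorb2 right_diff_distrib)
    next
      case 3
      have "(c * m) powr p \<le> M powr p" using 3 c m p by (intro powr_mono2) auto
      then show ?thesis using 3 q by (simp add: max_absorb1 max_absorb2 right_diff_distrib)
    qed
  qed
  then have 1: "max M (c * m') powr p - max M (c * m) powr p
      - ratio_const p * (m' powr p - m powr p) \<le> - (T * (m' powr p - m powr p))"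
    by (simp add: ratio_const_def c_def T_def algebra_simps)
  \<comment> \<open>Concavity is used with the derivative at the new m', whereas the slope held
    during the step carries the derivative at the old m. The difference of the two is the error term
    of the statement.\<close>
  have "T * (p * m' powr (p - 1) * (m' - m)) \<le> T * (m' powr p - m powr p)"
    using powr_diff_ge[of p m m'] p m m' T by (intro mult_left_mono) auto
  moreover have "(m' - m) * slope p m M \<le> (m' - m) * (p * m powr (p - 1) * T)"
    using slope_le[of p m M] p m' by (intro mult_left_mono) (auto simp: T_def c_def)
  moreover have "potential p x' m' M' = max M (c * m') powr p - ratio_const p * m' powr p"
    by (simp add: potential_def M' c_def) (simp add: m')
  moreover have "potential p x m M = max M (c * m) powr p - ratio_const p * m powr p + (x + m) * slope p m M"
    by (simp add: potential_def c_def)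
  moreover have "slope p m M * (x' - x) = - ((m' - m) * slope p m M) - (x + m) * slope p m M"
    by (simp add: m' algebra_simps)
  ultimately show ?thesis
    using 1 by (simp add: T_def[symmetric] c_def[symmetric] algebra_simps)
qed

section \<open>The pathwise inequality for discrete paths; \<open>run_min e x\<close> is m, the
  negative of the running minimum, floored at e\<close>

primrec run_min :: "real \<Rightarrow> (nat \<Rightarrow> real) \<Rightarrow> nat \<Rightarrow> real" where
  "run_min e x 0 = e"
| "run_min e x (Suc k) = max (run_min e x k) (- x (Suc k))"

primrec run_max :: "(nat \<Rightarrow> real) \<Rightarrow> nat \<Rightarrow> real" where
  "run_max x 0 = 0"
| "run_max x (Suc k) = max (run_max x k) (x (Suc k))"

lemma run_min_mono: "i \<le> j \<Longrightarrow> run_min e x i \<le> run_min e x j"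
  by (rule lift_Suc_mono_le) auto

lemma run_max_mono: "i \<le> j \<Longrightarrow> run_max x i \<le> run_max x j"
  by (rule lift_Suc_mono_le) auto

lemma run_max_nonneg: "0 \<le> run_max x k"
  using run_max_mono[of 0 k x] by simp

lemma run_min_ge: "e \<le> run_min e x k"
  using run_min_mono[of 0 k e x] by simp

lemma run_min_bound: "x 0 = 0 \<Longrightarrow> 0 \<le> e \<Longrightarrow> - run_min e x k \<le> x k"
  by (cases k) auto

lemma run_max_bound: "x 0 = 0 \<Longrightarrow> x k \<le> run_max x k"
  by (cases k) auto

text \<open>The process is frozen at the end of the first step that falls by more than one. The single
  large fall before the freezing is charged to the negative part of the path.\<close>

definition trading :: "(nat \<Rightarrow> real) \<Rightarrow> nat \<Rightarrow> bool" where
  "trading x k \<longleftrightarrow> (\<forall>j<k. x j - x (Suc j) \<le> 1)"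

lemma trading_Suc: "trading x (Suc k) \<longleftrightarrow> trading x k \<and> x k - x (Suc k) \<le> 1"
  by (auto simp: trading_def less_Suc_eq)

text \<open>While trading, the potential is carried along; after the freezing only -C * m^p is kept,
  since the left side then vanishes and asks nothing of the maximum.\<close>

lemma run_max_powr_le:
  fixes x :: "nat \<Rightarrow> real"
  assumes p: "0 < p" "p < 1" and e: "0 < e" and x0: "x 0 = 0"
    and D: "0 \<le> D" "\<And>k. k < n \<Longrightarrow> x k - x (Suc k) \<le> 1 \<Longrightarrow> x k - x (Suc k) \<le> D"
  shows "of_bool (trading x n) * run_max x n powr p \<le>
     ratio_const p * run_min e x n powr p
   + (\<Sum>k<n. (of_bool (trading x k) * slope p (run_min e x k) (run_max x k)) * (x (Suc k) - x k))
   + p * tail p (cutoff p) * e powr (p - 1) *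
      (D + (\<Sum>k<n. of_bool (trading x k \<and> 1 < x k - x (Suc k)) * max 0 (- x (Suc k))))"
proof -
  let ?m = "run_min e x" and ?M = "run_max x"
  define T where "T = p * tail p (cutoff p)"
  define S where "S n = (\<Sum>k<n. (of_bool (trading x k) * slope p (?m k) (?M k)) * (x (Suc k) - x k))" for n
  define B where "B n = (\<Sum>k<n. of_bool (trading x k \<and> 1 < x k - x (Suc k)) * max 0 (- x (Suc k)))" for n
  have T: "0 \<le> T" using p cutoff_pos[of p] tail_nonneg[of "cutoff p" p] by (simp add: T_def)
  have m: "0 < ?m k" for k using run_min_ge[of e x k] e by linarith
  have B: "0 \<le> B n" for n unfolding B_def by (intro sum_nonneg) auto
  have low: "?M k powr p - ratio_const p * ?m k powr p \<le> potential p (x k) (?m k) (?M k)" for k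
    using run_max_nonneg[of x k] run_min_bound[of x e k] x0 e p by (intro potential_lower) auto
  \<comment> \<open>The error is recorded in telescoped form during trading, and replaced by its
    crude bound e^(p-1) once trading has ended.\<close>
  have "(trading x j \<longrightarrow> potential p (x j) (?m j) (?M j)
          \<le> S j + T * D * (e powr (p - 1) - ?m j powr (p - 1)) + T * e powr (p - 1) * B j)
      \<and> (\<not> trading x j \<longrightarrow> - ratio_const p * ?m j powr p \<le> S j + T * e powr (p - 1) * (D + B j))"
    if "j \<le> n" for j
    using that
  proof (induction j)
    case 0
    then show ?case
      using potential_start[OF p e] x0 by (simp add: trading_def S_def B_def)
  next
    case (Suc j)
    let ?dm = "?m (Suc j) - ?m j"
    let ?dp = "?m j powr (p - 1) - ?m (Suc j) powr (p - 1)"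
    have dm: "0 \<le> ?dm" by simp
    have dp: "0 \<le> ?dp" using m[of j] p by (auto intro!: powr_mono2')
    have ep: "?m j powr (p - 1) \<le> e powr (p - 1)"
      using e p run_min_ge[of e x j] by (intro powr_mono2') auto
    have SS: "S (Suc j) = S j + (of_bool (trading x j) * slope p (?m j) (?M j)) * (x (Suc j) - x j)"
      by (simp add: S_def)
    have BS: "B (Suc j) = B j + of_bool (trading x j \<and> 1 < x j - x (Suc j)) * max 0 (- x (Suc j))"
      by (simp add: B_def)
    have step: "potential p (x (Suc j)) (?m (Suc j)) (?M (Suc j))
      \<le> potential p (x j) (?m j) (?M j) + slope p (?m j) (?M j) * (x (Suc j) - x j) + T * ?dm * ?dp"
      using potential_step[OF p m[of j] run_max_nonneg[of x j], of "x j" "x (Suc j)"]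
        run_min_bound[of x e j] run_max_bound[of x j] x0 e by (simp add: T_def)
    consider "trading x (Suc j)" "trading x j" "x j - x (Suc j) \<le> 1"
      | "\<not> trading x (Suc j)" "trading x j" "1 < x j - x (Suc j)"
      | "\<not> trading x (Suc j)" "\<not> trading x j"
      using trading_Suc[of x j] by linarith
    then show ?case
    proof cases
      case 1
      \<comment> \<open>Each error is at most T * D times a decrement of m^(p-1), and the decrements
        add up to at most e^(p-1).\<close>
      have "x j - x (Suc j) \<le> D" using D(2)[of j] Suc.prems 1 by simp
      then have "?dm \<le> D" using run_min_bound[of x e j] x0 e D(1) by auto
      then have "T * ?dm * ?dp \<le> T * D * ?dp"
        using T dp by (intro mult_right_mono mult_left_mono) auto
      then show ?thesis
        using step Suc 1 SS BS by (simp add: algebra_simps)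
    next
      case 2
      \<comment> \<open>At the freezing step D gives no control of the fall, so the growth of m is
        bounded by the negative part of the new value instead.\<close>
      have "?dm \<le> max 0 (- x (Suc j))" using m[of j] by auto
      moreover have "?dp \<le> e powr (p - 1)" using ep by (smt (verit) powr_ge_zero)
      ultimately have "T * ?dm * ?dp \<le> T * max 0 (- x (Suc j)) * e powr (p - 1)"
        using T dp dm by (intro mult_mono mult_nonneg_nonneg) auto
      moreover have "T * D * (e powr (p - 1) - ?m j powr (p - 1)) \<le> T * D * e powr (p - 1)"
        using T D by (intro mult_left_mono) auto
      moreover have "- ratio_const p * ?m (Suc j) powr p \<le> potential p (x (Suc j)) (?m (Suc j)) (?M (Suc j))"
        using low[of "Suc j"] powr_ge_zero[of "?M (Suc j)" p] by linarith
      moreover have "B (Suc j) = B j + max 0 (- x (Suc j))" "S (Suc j) = S j + slope p (?m j) (?M j) * (x (Suc j) - x j)"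
        using 2 by (simp_all add: BS SS)
      ultimately have "- ratio_const p * ?m (Suc j) powr p \<le> S (Suc j) + T * e powr (p - 1) * (D + B (Suc j))"
        using step Suc 2 by (simp add: algebra_simps del: run_min.simps run_max.simps)
      then show ?thesis using 2 by blast
    next
      case 3
      have "?m j powr p \<le> ?m (Suc j) powr p"
        using m[of j] p by (intro powr_mono2) auto
      then have "- ratio_const p * ?m (Suc j) powr p \<le> - ratio_const p * ?m j powr p"
        using ratio_const_pos[OF p] by simp
      then show ?thesis
        using 3 Suc SS BS by (simp del: run_min.simps run_max.simps)
    qed
  qed
  then have *: "(trading x n \<longrightarrow> potential p (x n) (?m n) (?M n)
          \<le> S n + T * D * (e powr (p - 1) - ?m n powr (p - 1)) + T * e powr (p - 1) * B n)
      \<and> (\<not> trading x n \<longrightarrow> - ratio_const p * ?m n powr p \<le> S n + T * e powr (p - 1) * (D + B n))"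
    by blast
  have "of_bool (trading x n) * ?M n powr p
      \<le> ratio_const p * ?m n powr p + S n + T * e powr (p - 1) * (D + B n)"
  proof (cases "trading x n")
    case True
    have "0 \<le> T * D * ?m n powr (p - 1)" using T D by simp
    then show ?thesis using True * low[of n] by (simp add: algebra_simps)
  next
    case False
    then show ?thesis using * by simp
  qed
  then show ?thesis by (simp add: S_def B_def T_def)
qed

text \<open>At each s the left limit lies below f s, so values just before s exceed values just
  after s by little. Compactness makes the radius uniform, through a Lebesgue number of the
  cover.\<close>

lemma small_drops:
  fixes f :: "real \<Rightarrow> real"
  assumes right: "\<And>s. 0 \<le> s \<Longrightarrow> continuous (at_right s) f"
    and left: "\<And>s. 0 < s \<Longrightarrow> \<exists>l. (f \<longlongrightarrow> l) (at_left s) \<and> l \<le> f s"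
    and e: "0 < e"
  shows "\<exists>r>0. \<forall>u v. 0 \<le> u \<longrightarrow> u \<le> v \<longrightarrow> v \<le> t \<longrightarrow> v - u < r \<longrightarrow> f u - f v \<le> e"
proof -
  \<comment> \<open>Only ordered pairs u \<le> v are compared, so upward jumps inside the ball do no
    harm.\<close>
  define good where "good s d \<longleftrightarrow> (\<forall>u v. 0 \<le> u \<longrightarrow> u \<le> v \<longrightarrow> u \<in> ball s d \<longrightarrow> v \<in> ball s d \<longrightarrow> f u - f v \<le> e)" for s d
  have good: "\<exists>d>0. good s d" if s: "0 \<le> s" for s
  proof -
    have "\<forall>\<^sub>F y in at_right s. dist (f y) (f s) < e / 2"
      using right[OF s] e by (intro tendstoD) (auto simp: continuous_within)
    then obtain b where b: "s < b" "\<And>y. s < y \<Longrightarrow> y < b \<Longrightarrow> dist (f y) (f s) < e / 2"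
      unfolding eventually_at_right_field by blast
    obtain a l where a: "a < s" "\<And>y. 0 \<le> y \<Longrightarrow> a < y \<Longrightarrow> y < s \<Longrightarrow> dist (f y) l < e / 2" and l: "l \<le> f s"
    proof (cases "s = 0")
      case True
      \<comment> \<open>No y satisfies 0 \<le> y < s when s = 0, so any negative a serves, and l may
        be f s itself.\<close>
      show thesis by (rule that[of "-1" "f s"]) (use True in auto)
    next
      case False
      then obtain l where l: "(f \<longlongrightarrow> l) (at_left s)" "l \<le> f s" using left[of s] s by auto
      have "\<forall>\<^sub>F y in at_left s. dist (f y) l < e / 2"
        using l(1) e by (intro tendstoD) auto
      then obtain a where "a < s" "\<And>y. a < y \<Longrightarrow> y < s \<Longrightarrow> dist (f y) l < e / 2"
        unfolding eventually_at_left_field by blast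
      then show thesis using that l(2) by blast
    qed
    define d where "d = min (b - s) (s - a)"
    have "f u - f v \<le> e" if "0 \<le> u" "u \<le> v" "u \<in> ball s d" "v \<in> ball s d" for u v
    proof -
      have uv: "a < u" "v < b" "u < b" "a < v"
        using that a(1) b(1) by (auto simp: d_def dist_real_def)
      have U: "f u \<le> f s + e / 2" if "s \<le> u"
        using that b(2)[of u] uv e by (cases "u = s") (auto simp: dist_real_def abs_if split: if_splits)
      have V: "f s - e / 2 \<le> f v" if "s \<le> v"
        using that b(2)[of v] uv e by (cases "v = s") (auto simp: dist_real_def abs_if split: if_splits)
      have U': "f u \<le> l + e / 2" if "u < s"
        using that a(2)[of u] uv \<open>0 \<le> u\<close> by (auto simp: dist_real_def abs_if split: if_splits)
      have V': "l - e / 2 \<le> f v" if "v < s"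
        using that a(2)[of v] uv \<open>0 \<le> u\<close> \<open>u \<le> v\<close> by (auto simp: dist_real_def abs_if split: if_splits)
      show ?thesis using U V U' V' l \<open>u \<le> v\<close> by linarith
    qed
    then show ?thesis
      using a(1) b(1) unfolding good_def by (intro exI[of _ d]) (auto simp: d_def)
  qed
  define \<G> where "\<G> = {ball s d | s d. 0 \<le> s \<and> good s d}"
  have "{0..t} \<subseteq> \<Union>\<G>"
  proof
    fix s assume "s \<in> {0..t}"
    then obtain d where "d > 0" "good s d" using good by auto
    then show "s \<in> \<Union>\<G>" using \<open>s \<in> {0..t}\<close> by (auto simp: \<G>_def intro!: exI[of _ "ball s d"])
  qed
  then obtain r where r: "0 < r" "\<And>x. x \<in> {0..t} \<Longrightarrow> \<exists>G\<in>\<G>. ball x r \<subseteq> G"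
    by (rule Heine_Borel_lemma[OF compact_Icc]) (auto simp: \<G>_def)
  show ?thesis
  proof (intro exI[of _ r] conjI r(1) allI impI)
    fix u v assume uv: "0 \<le> u" "u \<le> v" "v \<le> t" "v - u < r"
    then obtain s d where "good s d" "ball u r \<subseteq> ball s d"
      using r(2)[of u] by (auto simp: \<G>_def)
    moreover have "u \<in> ball u r" "v \<in> ball u r" using uv r(1) by (auto simp: dist_real_def)
    ultimately show "f u - f v \<le> e" using uv unfolding good_def by blast
  qed
qed

text \<open>Finitely many steps shorter than r lead from u to v, each dropping by at most 1.
  Comparing a path with its values at 0 and t then bounds it on [0, t] from both sides.\<close>

lemma bounded_drops:
  fixes f :: "real \<Rightarrow> real"
  assumes r: "0 < r" "\<forall>u v. 0 \<le> u \<longrightarrow> u \<le> v \<longrightarrow> v \<le> t \<longrightarrow> v - u < r \<longrightarrow> f u - f v \<le> 1"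
  shows "\<exists>K. \<forall>u v. 0 \<le> u \<longrightarrow> u \<le> v \<longrightarrow> v \<le> t \<longrightarrow> f u - f v \<le> K"
proof -
  obtain n :: nat where n: "t / r < real n" using reals_Archimedean2 by blast
  have "f u - f v \<le> real (Suc n)" if uv: "0 \<le> u" "u \<le> v" "v \<le> t" for u v
  proof -
    define g where "g k = u + (v - u) * real k / real (Suc n)" for k
    have "t / real (Suc n) < r"
      using n r(1) by (simp add: field_simps)
    then have d: "(v - u) / real (Suc n) < r"
      using uv by (smt (verit) divide_right_mono of_nat_0_le_iff)
    have "f (g k) - f (g (Suc k)) \<le> 1" if "k < Suc n" for k
    proof (rule r(2)[rule_format])
      have "g (Suc k) - g k = (v - u) / real (Suc n)"
        by (simp add: g_def diff_divide_distrib[symmetric] algebra_simps)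
      then show "g (Suc k) - g k < r" "g k \<le> g (Suc k)"
        using d divide_nonneg_nonneg[of "v - u" "real (Suc n)"] uv by linarith+
      show "0 \<le> g k" using uv by (simp add: g_def)
      have "(v - u) * real (Suc k) / real (Suc n) \<le> v - u"
        using that uv by (simp add: pos_divide_le_eq mult_left_mono)
      then show "g (Suc k) \<le> t" using uv unfolding g_def by linarith
    qed
    then have "(\<Sum>k<Suc n. f (g k) - f (g (Suc k))) \<le> (\<Sum>k<Suc n. 1)"
      by (intro sum_mono) auto
    then have "f (g 0) - f (g (Suc n)) \<le> real (Suc n)"
      by (subst (asm) sum_lessThan_telescope') simp
    moreover have "g 0 = u" "g (Suc n) = v" by (simp_all add: g_def)
    ultimately show ?thesis by simp
  qed
  then show ?thesis by blast
qed

definition grid :: "real \<Rightarrow> nat \<Rightarrow> nat \<Rightarrow> real" where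
  "grid t n k = t * real k / real (Suc n)"

lemma grid_bounds:
  assumes "0 \<le> t" "k \<le> Suc n" shows "0 \<le> grid t n k" "grid t n k \<le> t"
  using assms by (auto simp: grid_def pos_divide_le_eq mult_left_mono)

lemma grid_mono: "0 \<le> t \<Longrightarrow> j \<le> k \<Longrightarrow> grid t n j \<le> grid t n k"
  by (simp add: grid_def divide_right_mono mult_left_mono)

lemma grid_start: "grid t n 0 = 0"
  by (simp add: grid_def)

lemma grid_Suc: "grid t n (Suc k) - grid t n k = t / real (Suc n)"
  by (simp add: grid_def diff_divide_distrib[symmetric] algebra_simps)

lemma mesh_tendsto_0: "(\<lambda>n. t / real (Suc n)) \<longlonglongrightarrow> 0"
  using tendsto_mult_right_zero[OF LIMSEQ_inverse_real_of_nat, of t] by (simp add: field_simps)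

text \<open>Natural subtraction makes the value at 0 vanish. \<open>run_max\<close> of this sequence
  is the largest downward step, or 0 if there is none.\<close>

definition grid_drop :: "(nat \<Rightarrow> real) \<Rightarrow> nat \<Rightarrow> real" where
  "grid_drop x k = x (k - 1) - x k"

lemma run_max_le: "0 \<le> d \<Longrightarrow> (\<And>k. k < n \<Longrightarrow> x (Suc k) \<le> d) \<Longrightarrow> run_max x n \<le> d"
  by (induction n) auto

lemma run_min_le: "e \<le> d \<Longrightarrow> (\<And>k. k < n \<Longrightarrow> - x (Suc k) \<le> d) \<Longrightarrow> run_min e x n \<le> d"
  by (induction n) auto

lemma run_min_le_add: "0 \<le> e \<Longrightarrow> run_min e x n \<le> e + run_min 0 x n"
  by (induction n) auto

text \<open>Only the step at which trading ends contributes, and it lies before n iff trading has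
  ended by n.\<close>

lemma sum_trading_stop:
  "(\<Sum>k<n. of_bool (trading x k \<and> 1 < x k - x (Suc k)) :: real) = of_bool (\<not> trading x n)"
  by (induction n) (auto simp: trading_Suc, auto simp: trading_def)

lemma measurable_run [measurable (raw)]:
  fixes x :: "nat \<Rightarrow> 'a \<Rightarrow> real"
  assumes "\<And>j. j \<le> k \<Longrightarrow> x j \<in> borel_measurable N"
  shows "(\<lambda>\<omega>. run_min e (\<lambda>i. x i \<omega>) k) \<in> borel_measurable N"
    "(\<lambda>\<omega>. run_max (\<lambda>i. x i \<omega>) k) \<in> borel_measurable N"
  using assms by (induction k) auto

lemma measurable_trading:
  fixes x :: "nat \<Rightarrow> 'a \<Rightarrow> real"
  assumes "\<And>j. j \<le> k \<Longrightarrow> x j \<in> borel_measurable N"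
  shows "Measurable.pred N (\<lambda>\<omega>. trading (\<lambda>i. x i \<omega>) k)"
  using assms
proof (induction k)
  case (Suc k)
  then have [measurable]: "Measurable.pred N (\<lambda>\<omega>. trading (\<lambda>i. x i \<omega>) k)"
    "x k \<in> borel_measurable N" "x (Suc k) \<in> borel_measurable N" by auto
  show ?case unfolding trading_Suc by measurable
qed (simp add: trading_def)

text \<open>\<open>tail p\<close> is antitone on positive arguments; the maximum with c > 0 extends
  this to the whole line, and monotone functions are Borel.\<close>

lemma measurable_tail_max:
  assumes "p < 1" "0 < c"
  shows "(\<lambda>r. tail p (max r c)) \<in> borel_measurable borel"
proof -
  have "mono (\<lambda>r. - tail p (max r c))"
    using assms by (intro monoI) (auto intro!: tail_antimono)
  then have "(\<lambda>r. - (- tail p (max r c))) \<in> borel_measurable borel"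
    by (intro borel_measurable_uminus borel_measurable_mono)
  then show ?thesis by simp
qed

lemma measurable_slope:
  assumes p: "0 < p" "p < 1" and [measurable]: "f \<in> borel_measurable N" "g \<in> borel_measurable N"
  shows "(\<lambda>\<omega>. slope p (f \<omega>) (g \<omega>)) \<in> borel_measurable N"
proof -
  note [measurable] = measurable_compose[OF _ measurable_tail_max[OF p(2) cutoff_pos[OF p]]]
  show ?thesis unfolding slope_def by measurable
qed

lemma integrable_run:
  fixes x :: "nat \<Rightarrow> 'a \<Rightarrow> real"
  assumes "finite_measure N" "\<And>j. j \<le> k \<Longrightarrow> integrable N (x j)"
  shows "integrable N (\<lambda>\<omega>. run_min e (\<lambda>i. x i \<omega>) k)"
    "integrable N (\<lambda>\<omega>. run_max (\<lambda>i. x i \<omega>) k)"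
  using assms(2)
  by (induction k) (auto intro: finite_measure.integrable_const[OF assms(1)])

lemma powr_le_one_plus:
  fixes a p :: real
  assumes "0 \<le> a" "0 < p" "p < 1"
  shows "a powr p \<le> 1 + a"
proof (cases "a \<le> 1")
  case True
  then have "a powr p \<le> 1 powr p" using assms by (intro powr_mono2) auto
  then show ?thesis using assms by simp
next
  case False
  then show ?thesis using powr_mono[of p 1 a] assms by simp
qed

lemma integrable_powr_less_one:
  fixes f :: "'a \<Rightarrow> real"
  assumes "finite_measure N" "0 < p" "p < 1" "integrable N f" "\<And>\<omega>. 0 \<le> f \<omega>"
  shows "integrable N (\<lambda>\<omega>. f \<omega> powr p)"
proof (rule Bochner_Integration.integrable_bound)
  show "integrable N (\<lambda>\<omega>. 1 + f \<omega>)"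
    by (intro Bochner_Integration.integrable_add assms finite_measure.integrable_const[OF assms(1)])
  show "AE \<omega> in N. norm (f \<omega> powr p) \<le> norm (1 + f \<omega>)"
  proof (intro AE_I2)
    show "norm (f \<omega> powr p) \<le> norm (1 + f \<omega>)" for \<omega>
      using powr_le_one_plus[OF assms(5)[of \<omega>] assms(2,3)] assms(5)[of \<omega>] by simp
  qed
qed (use assms(4) in measurable)

section \<open>Expectations along grids, and refinement of the grid\<close>

context complete_filtered_prob_space
begin

lemma space_F: "0 \<le> t \<Longrightarrow> space (F t) = space M"
  using subalg[of t] by (auto simp: subalgebra_def)

lemma measurable_F_mono:
  assumes "0 \<le> s" "s \<le> t" "f \<in> borel_measurable (F s)"
  shows "f \<in> borel_measurable (F t)"
  using assms mono[of s t] space_F[of s] space_F[of t] by (auto simp: measurable_def)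

lemma measurable_F_M:
  assumes "0 \<le> s" "f \<in> borel_measurable (F s)"
  shows "f \<in> borel_measurable M"
  using measurable_from_subalg[OF subalg[OF assms(1)] assms(2)] .

lemma supermartingale_weighted_increment:
  assumes X: "supermartingale M F X" and st: "0 \<le> s" "s \<le> t"
    and f: "f \<in> borel_measurable (F s)" "\<And>\<omega>. 0 \<le> f \<omega>" "\<And>\<omega>. f \<omega> \<le> c"
  shows "integrable M (\<lambda>\<omega>. f \<omega> * (X t \<omega> - X s \<omega>))" "(\<integral>\<omega>. f \<omega> * (X t \<omega> - X s \<omega>) \<partial>M) \<le> 0"
proof -
  interpret S: finite_measure_subalgebra M "F s"
    by unfold_locales (rule subalg[OF st(1)])
  have [simp]: "integrable M (X s)" "integrable M (X t)"
    using X st by (auto simp: supermartingale_def)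
  have [measurable]: "f \<in> borel_measurable M" by (rule measurable_F_M[OF st(1) f(1)])
  have bounded: "integrable M (\<lambda>\<omega>. f \<omega> * Y \<omega>)" if "integrable M Y" for Y :: "'a \<Rightarrow> real"
  proof (rule Bochner_Integration.integrable_bound)
    show "integrable M (\<lambda>\<omega>. c * Y \<omega>)" using that by simp
    show "AE \<omega> in M. norm (f \<omega> * Y \<omega>) \<le> norm (c * Y \<omega>)"
      using f order_trans[OF f(2,3)] by (intro AE_I2) (auto simp: abs_mult intro!: mult_right_mono)
  qed (use that in measurable)
  show "integrable M (\<lambda>\<omega>. f \<omega> * (X t \<omega> - X s \<omega>))" by (rule bounded) simp
  have "(\<integral>\<omega>. f \<omega> * X t \<omega> \<partial>M) = (\<integral>\<omega>. f \<omega> * real_cond_exp M (F s) (X t) \<omega> \<partial>M)"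
    using S.real_cond_exp_intg(2)[OF bounded[of "X t"] f(1)] borel_measurable_integrable[of M "X t"] by simp
  also have "\<dots> \<le> (\<integral>\<omega>. f \<omega> * X s \<omega> \<partial>M)"
  proof (rule integral_mono_AE)
    have "AE \<omega> in M. real_cond_exp M (F s) (X t) \<omega> \<le> X s \<omega>"
      using X st by (auto simp: supermartingale_def)
    then show "AE \<omega> in M. f \<omega> * real_cond_exp M (F s) (X t) \<omega> \<le> f \<omega> * X s \<omega>"
      by eventually_elim (use f in \<open>auto intro!: mult_left_mono\<close>)
  qed (auto intro!: bounded S.real_cond_exp_int)
  finally show "(\<integral>\<omega>. f \<omega> * (X t \<omega> - X s \<omega>) \<partial>M) \<le> 0"
    using bounded[of "X t"] bounded[of "X s"] by (simp add: right_diff_distrib)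
qed

text \<open>The weight is the indicator of P together with X s < 0, which is known at time s; then
  -X t is bounded by its positive part. This postpones the charge for a large fall to a later
  time.\<close>

lemma supermartingale_negative_part:
  assumes X: "supermartingale M F X" and st: "0 \<le> s" "s \<le> t" and P: "Measurable.pred (F s) P"
  shows "(\<integral>\<omega>. of_bool (P \<omega>) * max 0 (- X s \<omega>) \<partial>M) \<le> (\<integral>\<omega>. of_bool (P \<omega>) * max 0 (- X t \<omega>) \<partial>M)"
proof -
  have i [simp]: "integrable M (X s)" "integrable M (X t)"
    using X st by (auto simp: supermartingale_def)
  have [measurable]: "X s \<in> borel_measurable (F s)" "Measurable.pred (F s) P"
    using X st P by (auto simp: supermartingale_def adapted_def)
  define f :: "'a \<Rightarrow> real" where "f \<omega> = of_bool (P \<omega> \<and> X s \<omega> < 0)" for \<omega>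
  have f: "f \<in> borel_measurable (F s)"
    unfolding f_def by measurable
  have f: "f \<in> borel_measurable (F s)" "\<And>\<omega>. 0 \<le> f \<omega>" "\<And>\<omega>. f \<omega> \<le> 1"
    by (rule f) (simp_all add: f_def)
  have [measurable]: "f \<in> borel_measurable M" "Measurable.pred M P"
    using measurable_F_M[OF st(1) f(1)] measurable_from_subalg[OF subalg[OF st(1)] P] by auto
  have I: "integrable M (\<lambda>\<omega>. of_bool (P \<omega>) * max 0 (- Y \<omega>))" "integrable M (\<lambda>\<omega>. f \<omega> * Y \<omega>)"
    if "integrable M Y" for Y :: "'a \<Rightarrow> real"
  proof -
    have [measurable]: "Y \<in> borel_measurable M" using that by simp
    show "integrable M (\<lambda>\<omega>. of_bool (P \<omega>) * max 0 (- Y \<omega>))"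
      by (rule Bochner_Integration.integrable_bound[OF that]) auto
    show "integrable M (\<lambda>\<omega>. f \<omega> * Y \<omega>)"
      by (rule Bochner_Integration.integrable_bound[OF that]) (measurable, simp add: f_def)
  qed
  have "(\<integral>\<omega>. of_bool (P \<omega>) * max 0 (- X s \<omega>) \<partial>M) = (\<integral>\<omega>. - (f \<omega> * X s \<omega>) \<partial>M)"
    by (intro Bochner_Integration.integral_cong) (auto simp: f_def)
  also have "\<dots> \<le> (\<integral>\<omega>. - (f \<omega> * X t \<omega>) \<partial>M)"
    using supermartingale_weighted_increment(2)[OF X st f] I(2)[OF i(1)] I(2)[OF i(2)]
    by (simp add: right_diff_distrib)
  also have "\<dots> \<le> (\<integral>\<omega>. of_bool (P \<omega>) * max 0 (- X t \<omega>) \<partial>M)"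
    using I[OF i(2)] by (intro integral_mono) (auto simp: f_def)
  finally show ?thesis .
qed

end

lemma cadlag_path_right: "cadlag M X \<Longrightarrow> \<omega> \<in> space M \<Longrightarrow> 0 \<le> t \<Longrightarrow> continuous (at_right t) (\<lambda>s. X s \<omega>)"
  by (auto simp: cadlag_def)

lemma jump_nonneg_left_limit:
  assumes "cadlag M X" "\<omega> \<in> space M" "0 < t" "0 \<le> jump X t \<omega>"
  shows "\<exists>l. ((\<lambda>s. X s \<omega>) \<longlongrightarrow> l) (at_left t) \<and> l \<le> X t \<omega>"
proof -
  obtain l where l: "((\<lambda>s. X s \<omega>) \<longlongrightarrow> l) (at_left t)"
    using assms unfolding cadlag_def by blast
  then have "Lim (at_left t) (\<lambda>s. X s \<omega>) = l"
    by (intro tendsto_Lim) auto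
  then show ?thesis using l assms by (auto simp: jump_def left_lim_def)
qed

text \<open>Right continuity keeps f above a on an interval to the right of some s with f s > a, and
  a fine grid has a point there. The grids are not nested, so there is no monotonicity in n to
  appeal to.\<close>

lemma run_max_grid_tendsto:
  fixes f :: "real \<Rightarrow> real"
  assumes right: "\<And>s. 0 \<le> s \<Longrightarrow> continuous (at_right s) f"
    and bdd: "bdd_above (f ` {0..t})" and f0: "f 0 = 0" and t: "0 < t"
  shows "(\<lambda>n. run_max (\<lambda>k. f (grid t n k)) (Suc n)) \<longlonglongrightarrow> max (SUP s\<in>{0..t}. f s) 0"
proof (rule order_tendstoI)
  fix a assume "max (SUP s\<in>{0..t}. f s) 0 < a"
  moreover have "run_max (\<lambda>k. f (grid t n k)) (Suc n) \<le> max (SUP s\<in>{0..t}. f s) 0" for n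
  proof (rule run_max_le)
    fix k assume "k < Suc n"
    then have "f (grid t n (Suc k)) \<le> (SUP s\<in>{0..t}. f s)"
      using grid_bounds[of t "Suc k" n] t by (intro cSUP_upper bdd) auto
    then show "f (grid t n (Suc k)) \<le> max (SUP s\<in>{0..t}. f s) 0" by simp
  qed simp
  ultimately show "\<forall>\<^sub>F n in sequentially. run_max (\<lambda>k. f (grid t n k)) (Suc n) < a"
    by (intro always_eventually allI) (meson le_less_trans)
next
  fix a assume a: "a < max (SUP s\<in>{0..t}. f s) 0"
  show "\<forall>\<^sub>F n in sequentially. a < run_max (\<lambda>k. f (grid t n k)) (Suc n)"
  proof (cases "a < 0")
    case True
    then show ?thesis by (intro always_eventually allI less_le_trans[OF True run_max_nonneg])
  next
    case False
    then have "a < (SUP s\<in>{0..t}. f s)" using a by auto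
    then obtain s where s: "s \<in> {0..t}" "a < f s"
      using less_cSUP_iff[OF _ bdd, of a] t by auto
    have "\<forall>\<^sub>F y in at_right s. a < f y"
      using right[of s] s by (intro order_tendstoD(1)) (auto simp: continuous_within)
    then obtain b where b: "s < b" "\<And>y. s < y \<Longrightarrow> y < b \<Longrightarrow> a < f y"
      unfolding eventually_at_right_field by blast
    have "\<forall>\<^sub>F n in sequentially. t / real (Suc n) < b - s"
      using b(1) by (intro order_tendstoD(2)[OF mesh_tendsto_0]) auto
    then show ?thesis
    proof eventually_elim
      case (elim n)
      \<comment> \<open>The first grid point not before s.\<close>
      define k where "k = nat \<lceil>s * real (Suc n) / t\<rceil>"
      have k: "s * real (Suc n) / t \<le> real k" "real k < s * real (Suc n) / t + 1"
        using s t by (auto simp: k_def) linarith+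
      have kn: "k \<le> Suc n"
      proof -
        have "s * real (Suc n) / t \<le> real (Suc n)"
          using s t by (simp add: pos_divide_le_eq mult_right_mono mult.commute)
        then have "real k < real (Suc (Suc n))" using k(2) by simp
        then show ?thesis by linarith
      qed
      have "s \<le> grid t n k"
        using k(1) t by (simp add: grid_def field_simps)
      moreover have "grid t n k < s + t / real (Suc n)"
      proof -
        have "t * real k / real (Suc n) < t * (s * real (Suc n) / t + 1) / real (Suc n)"
          using k(2) t by (intro divide_strict_right_mono mult_strict_left_mono) auto
        also have "t * (s * real (Suc n) / t + 1) = s * real (Suc n) + t"
          using t by (simp add: field_simps)
        also have "(s * real (Suc n) + t) / real (Suc n) = s + t / real (Suc n)"
          by (simp add: add_divide_distrib)
        finally show ?thesis by (simp add: grid_def)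
      qed
      ultimately have "a < f (grid t n k)"
        using b(2)[of "grid t n k"] s elim by (cases "s = grid t n k") auto
      also have "\<dots> \<le> run_max (\<lambda>k. f (grid t n k)) k"
        by (rule run_max_bound) (simp add: grid_start f0)
      also have "\<dots> \<le> run_max (\<lambda>k. f (grid t n k)) (Suc n)"
        by (rule run_max_mono[OF kn])
      finally show ?case .
    qed
  qed
qed

lemma run_min_grid_le:
  assumes bdd: "bdd_below ((\<lambda>s. X s \<omega>) ` {0..t})" and t: "0 < t"
  shows "run_min 0 (\<lambda>k. X (grid t n k) \<omega>) (Suc n) \<le> \<bar>inf_process X t \<omega>\<bar>"
proof (rule run_min_le)
  fix k assume "k < Suc n"
  then have "(INF s\<in>{0..t}. X s \<omega>) \<le> X (grid t n (Suc k)) \<omega>"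
    using grid_bounds[of t "Suc k" n] t by (intro cINF_lower bdd) auto
  then show "- X (grid t n (Suc k)) \<omega> \<le> \<bar>inf_process X t \<omega>\<bar>"
    by (auto simp: inf_process_def)
qed simp

context complete_filtered_prob_space
begin

text \<open>The D of the pathwise inequality is the largest drop cut off at 1: it dominates the
  drops of all steps that fall by at most one, and it is bounded. The slopes are nonnegative,
  bounded because m \<ge> e, and known at the start of each step, so the weighted increments have
  nonpositive mean.\<close>

lemma expected_run_max_le:
  fixes X :: "real \<Rightarrow> 'a \<Rightarrow> real" and n :: nat and t :: real
  assumes p: "0 < p" "p < 1" and e: "0 < e"
    and X: "supermartingale M F X" "AE \<omega> in M. X 0 \<omega> = 0" and t: "0 < t"
  defines "x \<equiv> \<lambda>k. X (grid t n k)"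
  shows "(\<integral>\<omega>. of_bool (trading (\<lambda>k. x k \<omega>) (Suc n)) * run_max (\<lambda>k. x k \<omega>) (Suc n) powr p \<partial>M) \<le>
     ratio_const p * (\<integral>\<omega>. run_min e (\<lambda>k. x k \<omega>) (Suc n) powr p \<partial>M)
   + p * tail p (cutoff p) * e powr (p - 1) *
      ((\<integral>\<omega>. min 1 (run_max (grid_drop (\<lambda>k. x k \<omega>)) (Suc n)) \<partial>M)
     + (\<integral>\<omega>. of_bool (\<not> trading (\<lambda>k. x k \<omega>) (Suc n)) * max 0 (- X t \<omega>) \<partial>M))"
    (is "?L \<le> ?R")
    and "integrable M (\<lambda>\<omega>. of_bool (trading (\<lambda>k. x k \<omega>) (Suc n)) * run_max (\<lambda>k. x k \<omega>) (Suc n) powr p)"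
    and "integrable M (\<lambda>\<omega>. run_min e (\<lambda>k. x k \<omega>) (Suc n) powr p)"
    and "(\<lambda>\<omega>. min 1 (run_max (grid_drop (\<lambda>k. x k \<omega>)) (Suc n))) \<in> borel_measurable M"
    and "Measurable.pred M (\<lambda>\<omega>. trading (\<lambda>k. x k \<omega>) (Suc n))"
proof -
  let ?N = "Suc n"
  have g0: "0 \<le> grid t n k" for k using t by (simp add: grid_def)
  have xF: "x j \<in> borel_measurable (F (grid t n k))" if "j \<le> k" for j k
  proof (rule measurable_F_mono[of "grid t n j"])
    show "x j \<in> borel_measurable (F (grid t n j))"
      using X(1) g0[of j] by (auto simp: supermartingale_def adapted_def x_def)
  qed (use that t g0 grid_mono[of t j k n] in auto)
  have xi [simp]: "integrable M (x j)" for j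
    using X(1) g0[of j] by (auto simp: supermartingale_def x_def)
  have [measurable]: "x j \<in> borel_measurable M" for j
    using xi[of j] by measurable
  have [simp]: "integrable M (X t)" using X(1) t by (auto simp: supermartingale_def)
  have trF: "Measurable.pred (F (grid t n k)) (\<lambda>\<omega>. trading (\<lambda>i. x i \<omega>) k)" for k
    by (rule measurable_trading) (rule xF)
  have tr [measurable]: "Measurable.pred M (\<lambda>\<omega>. trading (\<lambda>i. x i \<omega>) k)" for k
    by (rule measurable_trading) simp
  then show "Measurable.pred M (\<lambda>\<omega>. trading (\<lambda>k. x k \<omega>) (Suc n))" .
  define w where "w k \<omega> = of_bool (trading (\<lambda>i. x i \<omega>) k) *
      slope p (run_min e (\<lambda>i. x i \<omega>) k) (run_max (\<lambda>i. x i \<omega>) k)" for k \<omega>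
  define c where "c = p * e powr (p - 1) * tail p (cutoff p)"
  have w: "w k \<in> borel_measurable (F (grid t n k))" "0 \<le> w k \<omega>" "w k \<omega> \<le> c" for k \<omega>
  proof -
    note [measurable] = trF[of k] measurable_run[of k x "F (grid t n k)", OF xF]
    note [measurable (raw)] = measurable_slope[OF p]
    show "w k \<in> borel_measurable (F (grid t n k))"
      unfolding w_def by measurable
    show "0 \<le> w k \<omega>" using slope_nonneg[OF p] by (simp add: w_def)
    have "slope p (run_min e (\<lambda>i. x i \<omega>) k) (run_max (\<lambda>i. x i \<omega>) k)
        \<le> p * run_min e (\<lambda>i. x i \<omega>) k powr (p - 1) * tail p (cutoff p)"
      using slope_le[OF p] .
    also have "\<dots> \<le> c"
      unfolding c_def using e p tail_nonneg[OF cutoff_pos[OF p]] run_min_ge[of e "\<lambda>i. x i \<omega>" k]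
      by (intro mult_right_mono mult_left_mono powr_mono2') auto
    finally have *: "slope p (run_min e (\<lambda>i. x i \<omega>) k) (run_max (\<lambda>i. x i \<omega>) k) \<le> c" .
    have "0 \<le> c" using p e tail_nonneg[OF cutoff_pos[OF p]] by (simp add: c_def)
    then show "w k \<omega> \<le> c" using * by (simp add: w_def)
  qed
  have incr: "integrable M (\<lambda>\<omega>. w k \<omega> * (x (Suc k) \<omega> - x k \<omega>))"
    "(\<integral>\<omega>. w k \<omega> * (x (Suc k) \<omega> - x k \<omega>) \<partial>M) \<le> 0" for k
    using supermartingale_weighted_increment[OF X(1) g0 grid_mono w, of k "Suc k"] t by (auto simp: x_def)
  \<comment> \<open>Whether step k is the freezing one is known at its end, so
    \<open>supermartingale_negative_part\<close> can move the charge from there to time t; by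
    \<open>sum_trading_stop\<close> the steps then combine into one indicator.\<close>
  define fall where "fall k \<omega> \<longleftrightarrow> trading (\<lambda>i. x i \<omega>) k \<and> 1 < x k \<omega> - x (Suc k) \<omega>" for k \<omega>
  have fallF: "Measurable.pred (F (grid t n (Suc k))) (fall k)" for k
  proof -
    have [measurable]: "Measurable.pred (F (grid t n (Suc k))) (\<lambda>\<omega>. trading (\<lambda>i. x i \<omega>) k)"
      by (rule measurable_trading) (simp add: xF)
    note [measurable] = xF[of k "Suc k", simplified] xF[of "Suc k" "Suc k", simplified]
    show ?thesis unfolding fall_def by measurable
  qed
  have [measurable]: "Measurable.pred M (fall k)" for k
    unfolding fall_def by measurable
  have fi: "integrable M (\<lambda>\<omega>. of_bool (P \<omega>) * max 0 (- Y \<omega>))"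
    if [measurable]: "Measurable.pred M P" and i: "integrable M Y" for P and Y :: "'a \<Rightarrow> real"
  proof -
    have [measurable]: "Y \<in> borel_measurable M" using i by simp
    show ?thesis by (rule Bochner_Integration.integrable_bound[OF i]) auto
  qed
  have fall_le: "(\<integral>\<omega>. (\<Sum>k<?N. of_bool (fall k \<omega>) * max 0 (- x (Suc k) \<omega>)) \<partial>M)
      \<le> (\<integral>\<omega>. of_bool (\<not> trading (\<lambda>k. x k \<omega>) ?N) * max 0 (- X t \<omega>) \<partial>M)"
  proof -
    have "(\<integral>\<omega>. (\<Sum>k<?N. of_bool (fall k \<omega>) * max 0 (- x (Suc k) \<omega>)) \<partial>M)
        = (\<Sum>k<?N. \<integral>\<omega>. of_bool (fall k \<omega>) * max 0 (- x (Suc k) \<omega>) \<partial>M)"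
      by (intro Bochner_Integration.integral_sum fi) auto
    also have "\<dots> \<le> (\<Sum>k<?N. \<integral>\<omega>. of_bool (fall k \<omega>) * max 0 (- X t \<omega>) \<partial>M)"
    proof (rule sum_mono)
      fix k assume "k \<in> {..<?N}"
      then show "(\<integral>\<omega>. of_bool (fall k \<omega>) * max 0 (- x (Suc k) \<omega>) \<partial>M)
          \<le> (\<integral>\<omega>. of_bool (fall k \<omega>) * max 0 (- X t \<omega>) \<partial>M)"
        unfolding x_def
        using supermartingale_negative_part[OF X(1) g0 _ fallF, of k t] grid_bounds[of t "Suc k" n] t
        by auto
    qed
    also have "\<dots> = (\<integral>\<omega>. (\<Sum>k<?N. of_bool (fall k \<omega>) * max 0 (- X t \<omega>)) \<partial>M)"
      by (intro Bochner_Integration.integral_sum[symmetric] fi) auto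
    also have "\<dots> = (\<integral>\<omega>. of_bool (\<not> trading (\<lambda>k. x k \<omega>) ?N) * max 0 (- X t \<omega>) \<partial>M)"
      unfolding sum_distrib_right[symmetric] fall_def
      using sum_trading_stop[of "\<lambda>k. x k \<omega>" ?N for \<omega>]
      by (intro Bochner_Integration.integral_cong refl) (simp only:)
    finally show ?thesis .
  qed
  have ri: "integrable M (\<lambda>\<omega>. run_min e (\<lambda>k. x k \<omega>) ?N)" "integrable M (\<lambda>\<omega>. run_max (\<lambda>k. x k \<omega>) ?N)"
    "integrable M (\<lambda>\<omega>. run_max (grid_drop (\<lambda>k. x k \<omega>)) ?N)"
    using integrable_run(1)[OF finite_measure_axioms, of ?N x e] integrable_run(2)[OF finite_measure_axioms, of ?N x]
      integrable_run(2)[OF finite_measure_axioms, of ?N "\<lambda>k \<omega>. grid_drop (\<lambda>k. x k \<omega>) k"]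
    by (simp_all add: grid_drop_def[abs_def] del: run_min.simps run_max.simps)
  have [measurable]: "(\<lambda>\<omega>. run_max (grid_drop (\<lambda>k. x k \<omega>)) ?N) \<in> borel_measurable M"
    using ri(3) by (rule borel_measurable_integrable)
  show "(\<lambda>\<omega>. min 1 (run_max (grid_drop (\<lambda>k. x k \<omega>)) ?N)) \<in> borel_measurable M"
    by measurable
  show mp: "integrable M (\<lambda>\<omega>. run_min e (\<lambda>k. x k \<omega>) ?N powr p)"
    using run_min_ge[of e] e by (intro integrable_powr_less_one[OF finite_measure_axioms p ri(1)]) (meson less_imp_le order_trans)
  have Mp: "integrable M (\<lambda>\<omega>. run_max (\<lambda>k. x k \<omega>) ?N powr p)"
    by (intro integrable_powr_less_one[OF finite_measure_axioms p ri(2)] run_max_nonneg)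
  then have [measurable]: "(\<lambda>\<omega>. run_max (\<lambda>k. x k \<omega>) ?N powr p) \<in> borel_measurable M" by simp
  show tM: "integrable M (\<lambda>\<omega>. of_bool (trading (\<lambda>k. x k \<omega>) ?N) * run_max (\<lambda>k. x k \<omega>) ?N powr p)"
    by (rule Bochner_Integration.integrable_bound[OF Mp]) auto
  have Di: "integrable M (\<lambda>\<omega>. min 1 (run_max (grid_drop (\<lambda>k. x k \<omega>)) ?N))"
    using ri(3) by (intro integrable_min) auto
  have fs: "integrable M (\<lambda>\<omega>. \<Sum>k<?N. of_bool (fall k \<omega>) * max 0 (- x (Suc k) \<omega>))"
    by (intro Bochner_Integration.integrable_sum fi) auto
  define T where "T = p * tail p (cutoff p) * e powr (p - 1)"
  have T: "0 \<le> T" using p tail_nonneg[OF cutoff_pos[OF p]] by (simp add: T_def)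
  have "?L \<le> (\<integral>\<omega>. ratio_const p * run_min e (\<lambda>k. x k \<omega>) ?N powr p
      + (\<Sum>k<?N. w k \<omega> * (x (Suc k) \<omega> - x k \<omega>))
      + T * (min 1 (run_max (grid_drop (\<lambda>k. x k \<omega>)) ?N)
            + (\<Sum>k<?N. of_bool (fall k \<omega>) * max 0 (- x (Suc k) \<omega>))) \<partial>M)"
  proof (rule integral_mono_AE)
    show "AE \<omega> in M. of_bool (trading (\<lambda>k. x k \<omega>) ?N) * run_max (\<lambda>k. x k \<omega>) ?N powr p
      \<le> ratio_const p * run_min e (\<lambda>k. x k \<omega>) ?N powr p
      + (\<Sum>k<?N. w k \<omega> * (x (Suc k) \<omega> - x k \<omega>))
      + T * (min 1 (run_max (grid_drop (\<lambda>k. x k \<omega>)) ?N)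
            + (\<Sum>k<?N. of_bool (fall k \<omega>) * max 0 (- x (Suc k) \<omega>)))"
      using X(2)
    proof eventually_elim
      case (elim \<omega>)
      show ?case
        unfolding w_def fall_def T_def
      proof (rule run_max_powr_le[OF p e])
        show "x 0 \<omega> = 0" using elim by (simp add: x_def grid_start)
        show "0 \<le> min 1 (run_max (grid_drop (\<lambda>k. x k \<omega>)) ?N)" using run_max_nonneg[of "grid_drop (\<lambda>k. x k \<omega>)" ?N] by simp
        fix k assume "k < ?N" "x k \<omega> - x (Suc k) \<omega> \<le> 1"
        then show "x k \<omega> - x (Suc k) \<omega> \<le> min 1 (run_max (grid_drop (\<lambda>k. x k \<omega>)) ?N)"
          using run_max_mono[of "Suc k" ?N "grid_drop (\<lambda>k. x k \<omega>)"] by (simp add: grid_drop_def)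
      qed
    qed
  qed (intro Bochner_Integration.integrable_add Bochner_Integration.integrable_sum integrable_mult_right tM mp incr Di fs)+
  also have "\<dots> = ratio_const p * (\<integral>\<omega>. run_min e (\<lambda>k. x k \<omega>) ?N powr p \<partial>M)
      + (\<Sum>k<?N. \<integral>\<omega>. w k \<omega> * (x (Suc k) \<omega> - x k \<omega>) \<partial>M)
      + T * ((\<integral>\<omega>. min 1 (run_max (grid_drop (\<lambda>k. x k \<omega>)) ?N) \<partial>M)
            + (\<integral>\<omega>. (\<Sum>k<?N. of_bool (fall k \<omega>) * max 0 (- x (Suc k) \<omega>)) \<partial>M))"
  proof -
    note iA = integrable_mult_right[OF mp, of "ratio_const p"]
    note iS = Bochner_Integration.integrable_sum[OF incr(1), of "\<lambda>k. k" "{..<?N}"]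
    note iB = Bochner_Integration.integrable_add[OF Di fs]
    note iE = integrable_mult_right[OF iB, of T]
    show ?thesis
      by (simp only: Bochner_Integration.integral_add[OF Bochner_Integration.integrable_add[OF iA iS] iE]
          Bochner_Integration.integral_add[OF iA iS] Bochner_Integration.integral_add[OF Di fs]
          integral_mult_right_zero Bochner_Integration.integral_sum[OF incr(1), of "\<lambda>k. k"])
  qed
  also have "\<dots> \<le> ?R"
    using mult_left_mono[OF fall_le T] sum_nonpos[of "{..<?N}" "\<lambda>k. \<integral>\<omega>. w k \<omega> * (x (Suc k) \<omega> - x k \<omega>) \<partial>M", OF incr(2)]
    unfolding T_def[symmetric] distrib_left by linarith
  finally show "?L \<le> ?R" .
qed


text \<open>The floor e stays fixed while the grid is refined, because the error carries the factor
  e^(p-1); only when the error has gone does e tend to 0.\<close>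

lemma sup_process_moment_le:
  assumes p: "0 < p" "p < 1" and X: "nonneg_jump_supermartingale M F X" and t: "0 < t"
  shows "(\<integral>\<^sup>+\<omega>. ennreal (\<bar>sup_process X t \<omega>\<bar> powr p) \<partial>M)
    \<le> ennreal (ratio_const p) * (\<integral>\<^sup>+\<omega>. ennreal (\<bar>inf_process X t \<omega>\<bar> powr p) \<partial>M)" (is "?S \<le> ennreal ?C * ?I")
proof -
  have sm: "supermartingale M F X" and cl: "cadlag M X" and X0: "AE \<omega> in M. X 0 \<omega> = 0"
    and jp: "AE \<omega> in M. \<forall>t\<ge>0. 0 \<le> jump X t \<omega>"
    using X by (auto simp: nonneg_jump_supermartingale_def)
  have C: "0 < ?C" using ratio_const_pos[OF p] .
  define x where "x n \<omega> k = X (grid t n k) \<omega>" for n \<omega> k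
  define tr where "tr n \<omega> \<longleftrightarrow> trading (x n \<omega>) (Suc n)" for n \<omega>
  define D where "D n \<omega> = min 1 (run_max (grid_drop (x n \<omega>)) (Suc n))" for n \<omega>
  have small: "AE \<omega> in M. \<forall>e>0. \<exists>r>0. \<forall>u v. 0 \<le> u \<longrightarrow> u \<le> v \<longrightarrow> v \<le> t \<longrightarrow> v - u < r \<longrightarrow> X u \<omega> - X v \<omega> \<le> e"
    using jp AE_space
  proof eventually_elim
    case (elim \<omega>)
    show ?case
    proof (intro allI impI)
      fix e :: real assume "0 < e"
      moreover have "\<exists>l. ((\<lambda>s. X s \<omega>) \<longlongrightarrow> l) (at_left s) \<and> l \<le> X s \<omega>" if "0 < s" for s
        using jump_nonneg_left_limit[OF cl elim(2) that] elim(1) that by simp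
      ultimately show "\<exists>r>0. \<forall>u v. 0 \<le> u \<longrightarrow> u \<le> v \<longrightarrow> v \<le> t \<longrightarrow> v - u < r \<longrightarrow> X u \<omega> - X v \<omega> \<le> e"
        using small_drops[of "\<lambda>s. X s \<omega>" e t, OF cadlag_path_right[OF cl elim(2)]] by simp
    qed
  qed
  have bounded: "AE \<omega> in M. bdd_above ((\<lambda>s. X s \<omega>) ` {0..t}) \<and> bdd_below ((\<lambda>s. X s \<omega>) ` {0..t})"
    using small
  proof eventually_elim
    case (elim \<omega>)
    from elim[rule_format, OF zero_less_one] obtain r where r: "0 < r"
      "\<forall>u v. 0 \<le> u \<longrightarrow> u \<le> v \<longrightarrow> v \<le> t \<longrightarrow> v - u < r \<longrightarrow> X u \<omega> - X v \<omega> \<le> 1"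
      by auto
    obtain K where K: "\<forall>u v. 0 \<le> u \<longrightarrow> u \<le> v \<longrightarrow> v \<le> t \<longrightarrow> X u \<omega> - X v \<omega> \<le> K"
      using bounded_drops[OF r] by auto
    have "X s \<omega> \<le> X t \<omega> + K \<and> X 0 \<omega> - K \<le> X s \<omega>" if "s \<in> {0..t}" for s
      using K[rule_format, of s t] K[rule_format, of 0 s] that by auto
    then show ?case unfolding bdd_above_def bdd_below_def by blast
  qed
  have drops: "AE \<omega> in M. \<forall>e>0. \<forall>\<^sub>F n in sequentially. \<forall>k\<le>n. x n \<omega> k - x n \<omega> (Suc k) \<le> e"
    using small
  proof eventually_elim
    case (elim \<omega>)
    show ?case
    proof (intro allI impI)
      fix e :: real assume "0 < e"
      then obtain r where r: "0 < r"
        "\<forall>u v. 0 \<le> u \<longrightarrow> u \<le> v \<longrightarrow> v \<le> t \<longrightarrow> v - u < r \<longrightarrow> X u \<omega> - X v \<omega> \<le> e"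
        using elim by auto
      have "\<forall>\<^sub>F n in sequentially. t / real (Suc n) < r"
        by (rule order_tendstoD(2)[OF mesh_tendsto_0 r(1)])
      then show "\<forall>\<^sub>F n in sequentially. \<forall>k\<le>n. x n \<omega> k - x n \<omega> (Suc k) \<le> e"
      proof eventually_elim
        case (elim n)
        show ?case
        proof (intro allI impI)
          fix k assume "k \<le> n"
          then show "x n \<omega> k - x n \<omega> (Suc k) \<le> e"
            unfolding x_def using t grid_bounds[of t k n] grid_bounds[of t "Suc k" n] grid_mono[of t k "Suc k" n]
              grid_Suc[of t n k] elim by (intro r(2)[rule_format]) auto
        qed
      qed
    qed
  qed
  have ev_tr: "AE \<omega> in M. \<forall>\<^sub>F n in sequentially. tr n \<omega>"
    using drops
  proof eventually_elim
    case (elim \<omega>)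
    have "\<forall>\<^sub>F n in sequentially. \<forall>k\<le>n. x n \<omega> k - x n \<omega> (Suc k) \<le> 1" using elim by simp
    then show ?case by eventually_elim (auto simp: tr_def trading_def)
  qed
  have D0: "0 \<le> D n \<omega>" "D n \<omega> \<le> 1" for n \<omega>
    using run_max_nonneg[of "grid_drop (x n \<omega>)" "Suc n"] by (auto simp: D_def)
  have D_lim: "AE \<omega> in M. (\<lambda>n. D n \<omega>) \<longlonglongrightarrow> 0"
    using drops
  proof eventually_elim
    case (elim \<omega>)
    show ?case
    proof (rule order_tendstoI)
      fix a :: real assume "a < 0"
      then show "\<forall>\<^sub>F n in sequentially. a < D n \<omega>"
        by (intro always_eventually allI) (use D0(1) less_le_trans in blast)
    next
      fix a :: real assume "0 < a"
      then have "\<forall>\<^sub>F n in sequentially. \<forall>k\<le>n. x n \<omega> k - x n \<omega> (Suc k) \<le> a / 2"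
        by (intro elim[rule_format]) simp
      then show "\<forall>\<^sub>F n in sequentially. D n \<omega> < a"
      proof eventually_elim
        case (elim n)
        have "run_max (grid_drop (x n \<omega>)) (Suc n) \<le> a / 2"
          using elim \<open>0 < a\<close> by (intro run_max_le) (auto simp: grid_drop_def)
        then show ?case using \<open>0 < a\<close> by (simp add: D_def)
      qed
    qed
  qed
  have conv: "AE \<omega> in M. (\<lambda>n. ennreal (of_bool (tr n \<omega>) * run_max (x n \<omega>) (Suc n) powr p))
      \<longlonglongrightarrow> ennreal (\<bar>sup_process X t \<omega>\<bar> powr p)"
    using ev_tr bounded X0 AE_space
  proof eventually_elim
    case (elim \<omega>)
    have "(\<lambda>n. run_max (x n \<omega>) (Suc n)) \<longlonglongrightarrow> sup_process X t \<omega>"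
      unfolding x_def sup_process_def
      by (rule run_max_grid_tendsto) (use elim t cadlag_path_right[OF cl] in auto)
    then have "(\<lambda>n. run_max (x n \<omega>) (Suc n) powr p) \<longlonglongrightarrow> sup_process X t \<omega> powr p"
      by (rule tendsto_powr') (use p run_max_nonneg in \<open>auto simp del: run_max.simps\<close>)
    then have "(\<lambda>n. of_bool (tr n \<omega>) * run_max (x n \<omega>) (Suc n) powr p) \<longlonglongrightarrow> sup_process X t \<omega> powr p"
      by (rule Lim_transform_eventually) (use elim(1) in eventually_elim, simp)
    moreover have "\<bar>sup_process X t \<omega>\<bar> = sup_process X t \<omega>" by (simp add: sup_process_def)
    ultimately show ?case by (auto intro: tendsto_ennrealI)
  qed
  have eps: "?S \<le> ennreal ?C * (ennreal (e powr p) + ?I)" if e: "0 < e" for e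
  proof -
    note bnd = expected_run_max_le[OF p e sm X0 t, folded x_def, folded D_def tr_def]
    define err where "err n = p * tail p (cutoff p) * e powr (p - 1) * ((\<integral>\<omega>. D n \<omega> \<partial>M)
      + (\<integral>\<omega>. of_bool (\<not> tr n \<omega>) * max 0 (- X t \<omega>) \<partial>M))" for n
    have Xt: "integrable M (X t)" using sm t by (auto simp: supermartingale_def)
    have [measurable]: "X t \<in> borel_measurable M" "\<And>n. Measurable.pred M (tr n)" "\<And>n. D n \<in> borel_measurable M"
      using Xt bnd(4,5) by (auto simp: D_def[abs_def] tr_def[abs_def])
    have "(\<lambda>n. \<integral>\<omega>. D n \<omega> \<partial>M) \<longlonglongrightarrow> (\<integral>\<omega>. 0 \<partial>M)"
      by (rule integral_dominated_convergence[where w="\<lambda>_. 1"]) (use D0 D_lim in auto)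
    \<comment> \<open>Here it pays that the large fall was charged to X at the fixed time t: one
      integrable function dominates for all grids.\<close>
    moreover have "(\<lambda>n. \<integral>\<omega>. of_bool (\<not> tr n \<omega>) * max 0 (- X t \<omega>) \<partial>M) \<longlonglongrightarrow> (\<integral>\<omega>. 0 \<partial>M)"
    proof (rule integral_dominated_convergence[where w="\<lambda>\<omega>. \<bar>X t \<omega>\<bar>"])
      show "AE \<omega> in M. (\<lambda>n. of_bool (\<not> tr n \<omega>) * max 0 (- X t \<omega>)) \<longlonglongrightarrow> 0"
        using ev_tr
      proof eventually_elim
        case (elim \<omega>)
        show ?case by (rule tendsto_eventually) (use elim in eventually_elim, simp)
      qed
    qed (use Xt in auto)
    ultimately have "err \<longlonglongrightarrow> p * tail p (cutoff p) * e powr (p - 1) * ((\<integral>\<omega>. 0 \<partial>M) + (\<integral>\<omega>. 0 \<partial>M))"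
      unfolding err_def by (intro tendsto_intros)
    then have err: "(\<lambda>n. ennreal (err n)) \<longlonglongrightarrow> 0"
      using tendsto_ennrealI[of err 0] by simp
    have main: "(\<integral>\<^sup>+\<omega>. ennreal (of_bool (tr n \<omega>) * run_max (x n \<omega>) (Suc n) powr p) \<partial>M)
        \<le> ennreal ?C * (ennreal (e powr p) + ?I) + ennreal (err n)" for n
    proof -
      have [measurable]: "X (grid t n j) \<in> borel_measurable M" for j
        using sm grid_def[of t n j] t by (auto simp: supermartingale_def intro!: borel_measurable_integrable)
      have [measurable]: "(\<lambda>\<omega>. run_min 0 (x n \<omega>) (Suc n)) \<in> borel_measurable M"
        unfolding x_def by (rule measurable_run) simp
      have "(\<integral>\<^sup>+\<omega>. ennreal (of_bool (tr n \<omega>) * run_max (x n \<omega>) (Suc n) powr p) \<partial>M)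
          = ennreal (\<integral>\<omega>. of_bool (tr n \<omega>) * run_max (x n \<omega>) (Suc n) powr p \<partial>M)"
        by (rule nn_integral_eq_integral) (use bnd(2) in auto)
      also have "\<dots> \<le> ennreal (?C * (\<integral>\<omega>. run_min e (x n \<omega>) (Suc n) powr p \<partial>M) + err n)"
        using bnd(1)[of n] by (intro ennreal_leI) (simp add: err_def)
      also have "\<dots> \<le> ennreal (?C * (\<integral>\<omega>. run_min e (x n \<omega>) (Suc n) powr p \<partial>M)) + ennreal (err n)"
      proof (rule eq_refl, rule ennreal_plus)
        show "0 \<le> ?C * (\<integral>\<omega>. run_min e (x n \<omega>) (Suc n) powr p \<partial>M)"
          using C by (intro mult_nonneg_nonneg integral_nonneg_AE AE_I2) auto
        show "0 \<le> err n"
          unfolding err_def using p tail_nonneg[OF cutoff_pos[OF p]] D0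
          by (intro mult_nonneg_nonneg add_nonneg_nonneg integral_nonneg_AE AE_I2) auto
      qed
      also have "ennreal (?C * (\<integral>\<omega>. run_min e (x n \<omega>) (Suc n) powr p \<partial>M))
          = ennreal ?C * (\<integral>\<^sup>+\<omega>. ennreal (run_min e (x n \<omega>) (Suc n) powr p) \<partial>M)"
        using C nn_integral_eq_integral[OF bnd(3)] by (simp add: ennreal_mult)
      also have "(\<integral>\<^sup>+\<omega>. ennreal (run_min e (x n \<omega>) (Suc n) powr p) \<partial>M)
          \<le> (\<integral>\<^sup>+\<omega>. ennreal (e powr p) + ennreal (run_min 0 (x n \<omega>) (Suc n) powr p) \<partial>M)"
      proof (rule nn_integral_mono)
        fix \<omega>
        have r0: "0 \<le> run_min 0 (x n \<omega>) (Suc n)" by (rule run_min_ge)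
        have "run_min e (x n \<omega>) (Suc n) powr p \<le> (e + run_min 0 (x n \<omega>) (Suc n)) powr p"
          using e p run_min_ge[of e "x n \<omega>" "Suc n"] run_min_le_add[of e "x n \<omega>" "Suc n"]
          by (intro powr_mono2) linarith+
        also have "\<dots> \<le> e powr p + run_min 0 (x n \<omega>) (Suc n) powr p"
          using e p r0 by (intro powr_add_le) auto
        finally show "ennreal (run_min e (x n \<omega>) (Suc n) powr p)
            \<le> ennreal (e powr p) + ennreal (run_min 0 (x n \<omega>) (Suc n) powr p)"
          by (simp add: ennreal_leI del: run_min.simps flip: ennreal_plus)
      qed
      also have "\<dots> = ennreal (e powr p) + (\<integral>\<^sup>+\<omega>. ennreal (run_min 0 (x n \<omega>) (Suc n) powr p) \<partial>M)"
        by (subst nn_integral_add) (simp_all add: emeasure_space_1 del: run_min.simps)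
      also have "(\<integral>\<^sup>+\<omega>. ennreal (run_min 0 (x n \<omega>) (Suc n) powr p) \<partial>M) \<le> ?I"
      proof (rule nn_integral_mono_AE)
        show "AE \<omega> in M. ennreal (run_min 0 (x n \<omega>) (Suc n) powr p) \<le> ennreal (\<bar>inf_process X t \<omega>\<bar> powr p)"
          using bounded
          by eventually_elim (use run_min_grid_le[of X _ t n] t p run_min_ge[of 0] in
              \<open>auto simp: x_def[abs_def] intro!: ennreal_leI powr_mono2 simp del: run_min.simps\<close>)
      qed
      finally show ?thesis by (simp add: add_mono mult_left_mono)
    qed
    \<comment> \<open>Fatou's lemma suffices on this side; no domination of the discrete maxima is
      at hand.\<close>
    have "?S = (\<integral>\<^sup>+\<omega>. liminf (\<lambda>n. ennreal (of_bool (tr n \<omega>) * run_max (x n \<omega>) (Suc n) powr p)) \<partial>M)"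
      using conv by (intro nn_integral_cong_AE, eventually_elim) (rule lim_imp_Liminf[OF sequentially_bot, symmetric])
    also have "\<dots> \<le> liminf (\<lambda>n. \<integral>\<^sup>+\<omega>. ennreal (of_bool (tr n \<omega>) * run_max (x n \<omega>) (Suc n) powr p) \<partial>M)"
      by (rule nn_integral_liminf, rule measurable_compose[OF borel_measurable_integrable[OF bnd(2)] measurable_ennreal])
    also have "\<dots> \<le> liminf (\<lambda>n. ennreal ?C * (ennreal (e powr p) + ?I) + ennreal (err n))"
      by (rule Liminf_mono) (use main in auto)
    also have "\<dots> = ennreal ?C * (ennreal (e powr p) + ?I) + 0"
      by (intro lim_imp_Liminf sequentially_bot tendsto_add tendsto_const err)
    finally show ?thesis by simp
  qed
  have "(\<lambda>n. ennreal ((1 / real (Suc n)) powr p)) \<longlonglongrightarrow> ennreal (0 powr p)"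
    by (intro tendsto_ennrealI tendsto_powr' mesh_tendsto_0 tendsto_const) (use p in auto)
  then have "(\<lambda>n. ennreal ?C * (ennreal ((1 / real (Suc n)) powr p) + ?I)) \<longlonglongrightarrow> ennreal ?C * (0 + ?I)"
    by (intro tendsto_add tendsto_const ennreal_tendsto_cmult) (auto)
  then have "?S \<le> ennreal ?C * (0 + ?I)"
    by (rule LIMSEQ_le_const) (use eps in auto)
  then show ?thesis by simp
qed

end

section \<open>From moments to norms in the extended nonnegative reals\<close>

lemma c_const_eq: "c_const p = ratio_const p powr (1 / p)"
  by (simp add: c_const_def ratio_const_def cutoff_def tail_def)

lemma ennreal_powr_ennreal: "0 \<le> x \<Longrightarrow> ennreal_powr (ennreal x) a = ennreal (x powr a)"
  by (simp add: ennreal_powr_def)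

lemma ennreal_powr_mono:
  assumes "x \<le> y" "0 \<le> a"
  shows "ennreal_powr x a \<le> ennreal_powr y a"
proof (cases "y = \<infinity>")
  case False
  then have "x < \<infinity>" "y < \<infinity>"
    using assms(1) by (auto simp: less_top top_unique)
  then show ?thesis
    using assms by (auto simp: ennreal_powr_def intro!: ennreal_leI powr_mono2 enn2real_mono)
qed (simp add: ennreal_powr_def)

lemma ennreal_powr_mult:
  assumes "0 < C"
  shows "ennreal_powr (ennreal C * x) a = ennreal (C powr a) * ennreal_powr x a"
proof (cases x)
  case (real r)
  then show ?thesis
    using assms by (simp add: ennreal_powr_ennreal ennreal_mult[symmetric] powr_mult)
next
  case top
  then show ?thesis
    using assms by (simp add: ennreal_powr_def ennreal_mult_eq_top_iff)
qed

lemma (in complete_filtered_prob_space) process_norm_sup_le: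
  assumes p: "0 < p" "p < 1" and X: "nonneg_jump_supermartingale M F X"
  shows "process_norm M p (sup_process X) \<le> ennreal (c_const p) * process_norm M p (inf_process X)"
  unfolding process_norm_def
proof (rule SUP_least)
  fix t :: real assume "t \<in> {0..}"
  let ?S = "\<integral>\<^sup>+\<omega>. ennreal (\<bar>sup_process X t \<omega>\<bar> powr p) \<partial>M"
  let ?I = "\<lambda>t. \<integral>\<^sup>+\<omega>. ennreal (\<bar>inf_process X t \<omega>\<bar> powr p) \<partial>M"
  have "?S \<le> ennreal (ratio_const p) * ?I t"
  proof (cases "t = 0")
    case True
    have "AE \<omega> in M. X 0 \<omega> = 0" using X by (simp add: nonneg_jump_supermartingale_def)
    then have "?S = (\<integral>\<^sup>+\<omega>. 0 \<partial>M)"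
      by (intro nn_integral_cong_AE, eventually_elim) (simp add: True sup_process_def)
    then show ?thesis by simp
  next
    case False
    then show ?thesis
      using sup_process_moment_le[OF p X] \<open>t \<in> {0..}\<close> by simp
  qed
  then have "ennreal_powr ?S (1 / p) \<le> ennreal_powr (ennreal (ratio_const p) * ?I t) (1 / p)"
    using p by (intro ennreal_powr_mono) auto
  also have "\<dots> = ennreal (c_const p) * ennreal_powr (?I t) (1 / p)"
    using ratio_const_pos[OF p] by (simp add: ennreal_powr_mult c_const_eq)
  also have "\<dots> \<le> ennreal (c_const p) * (SUP t\<in>{0..}. ennreal_powr (?I t) (1 / p))"
    using \<open>t \<in> {0..}\<close> by (intro mult_left_mono SUP_upper) auto
  finally show "ennreal_powr ?S (1 / p) \<le> ennreal (c_const p) * (SUP t\<in>{0..}. ennreal_powr (?I t) (1 / p))" .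
qed

section \<open>Brownian motion\<close>

lemma std_normal_density_rotate:
  "std_normal_density ((u + v) / sqrt 2) * std_normal_density ((u - v) / sqrt 2)
    = std_normal_density u * std_normal_density v"
proof -
  have "- ((u + v) / sqrt 2)\<^sup>2 / 2 + - ((u - v) / sqrt 2)\<^sup>2 / 2 = - u\<^sup>2 / 2 + - v\<^sup>2 / 2"
    by (simp add: power_divide power2_eq_square field_simps)
  then show ?thesis
    by (simp add: std_normal_density_def exp_add[symmetric] del: minus_divide_left)
qed

text \<open>The substitution in the plane is carried out as two affine substitutions on the line,
  with factors sqrt 2 and 1 / sqrt 2 that cancel, and an exchange of the integrals between
  them.\<close>

lemma nn_integral_std_normal_rotate:
  fixes f :: "real \<Rightarrow> real \<Rightarrow> ennreal"
  assumes f [measurable]: "case_prod f \<in> borel_measurable (borel \<Otimes>\<^sub>M borel)"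
  defines "\<phi> \<equiv> std_normal_density"
  shows "(\<integral>\<^sup>+y. (\<integral>\<^sup>+x. ennreal (\<phi> x * \<phi> y) * f ((x + y) / sqrt 2) ((x - y) / sqrt 2) \<partial>lborel) \<partial>lborel)
    = (\<integral>\<^sup>+u. (\<integral>\<^sup>+v. ennreal (\<phi> u * \<phi> v) * f u v \<partial>lborel) \<partial>lborel)"
proof -
  have s: "sqrt 2 * sqrt 2 = (2 :: real)" by simp
  have [measurable]: "\<phi> \<in> borel_measurable borel" by (simp add: \<phi>_def)
  have "(\<integral>\<^sup>+y. (\<integral>\<^sup>+x. ennreal (\<phi> x * \<phi> y) * f ((x + y) / sqrt 2) ((x - y) / sqrt 2) \<partial>lborel) \<partial>lborel)
      = (\<integral>\<^sup>+y. ennreal (sqrt 2) * (\<integral>\<^sup>+u. ennreal (\<phi> (- y + sqrt 2 * u) * \<phi> y) * f u (u - sqrt 2 * y) \<partial>lborel) \<partial>lborel)"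
  proof (rule nn_integral_cong)
    fix y :: real
    have a: "(- y + sqrt 2 * u + y) / sqrt 2 = u" "(- y + sqrt 2 * u - y) / sqrt 2 = u - sqrt 2 * y" for u
      using s by (simp_all add: field_simps)
    show "(\<integral>\<^sup>+x. ennreal (\<phi> x * \<phi> y) * f ((x + y) / sqrt 2) ((x - y) / sqrt 2) \<partial>lborel)
      = ennreal (sqrt 2) * (\<integral>\<^sup>+u. ennreal (\<phi> (- y + sqrt 2 * u) * \<phi> y) * f u (u - sqrt 2 * y) \<partial>lborel)"
      by (subst nn_integral_real_affine[where c="sqrt 2" and t="- y"]) (simp_all only: a, auto)
  qed
  also have "\<dots> = ennreal (sqrt 2) * (\<integral>\<^sup>+y. (\<integral>\<^sup>+u. ennreal (\<phi> (- y + sqrt 2 * u) * \<phi> y) * f u (u - sqrt 2 * y) \<partial>lborel) \<partial>lborel)"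
    by (rule nn_integral_cmult) measurable
  also have "\<dots> = ennreal (sqrt 2) * (\<integral>\<^sup>+u. (\<integral>\<^sup>+y. ennreal (\<phi> (- y + sqrt 2 * u) * \<phi> y) * f u (u - sqrt 2 * y) \<partial>lborel) \<partial>lborel)"
    by (subst lborel_pair.Fubini') auto
  also have "(\<integral>\<^sup>+u. (\<integral>\<^sup>+y. ennreal (\<phi> (- y + sqrt 2 * u) * \<phi> y) * f u (u - sqrt 2 * y) \<partial>lborel) \<partial>lborel)
      = (\<integral>\<^sup>+u. ennreal (1 / sqrt 2) * (\<integral>\<^sup>+v. ennreal (\<phi> u * \<phi> v) * f u v \<partial>lborel) \<partial>lborel)"
  proof (rule nn_integral_cong)
    fix u :: real
    have a: "u - sqrt 2 * ((u - v) / sqrt 2) = v"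
      "- ((u - v) / sqrt 2) + sqrt 2 * u = (u + v) / sqrt 2"
      "u / sqrt 2 + - (1 / sqrt 2) * v = (u - v) / sqrt 2" for v
      using s by (simp_all add: field_simps)
    show "(\<integral>\<^sup>+y. ennreal (\<phi> (- y + sqrt 2 * u) * \<phi> y) * f u (u - sqrt 2 * y) \<partial>lborel)
      = ennreal (1 / sqrt 2) * (\<integral>\<^sup>+v. ennreal (\<phi> u * \<phi> v) * f u v \<partial>lborel)"
      by (subst nn_integral_real_affine[where c="- (1 / sqrt 2)" and t="u / sqrt 2"])
        (simp_all only: a, auto simp: \<phi>_def std_normal_density_rotate)
  qed
  also have "\<dots> = ennreal (1 / sqrt 2) * (\<integral>\<^sup>+u. (\<integral>\<^sup>+v. ennreal (\<phi> u * \<phi> v) * f u v \<partial>lborel) \<partial>lborel)"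
    by (rule nn_integral_cmult) measurable
  also have "ennreal (sqrt 2) * \<dots> = (\<integral>\<^sup>+u. (\<integral>\<^sup>+v. ennreal (\<phi> u * \<phi> v) * f u v \<partial>lborel) \<partial>lborel)"
    by (simp add: mult.assoc[symmetric] ennreal_mult[symmetric])
  finally show ?thesis .
qed

context prob_space
begin

abbreviation std_normal :: "('a \<Rightarrow> real) \<Rightarrow> bool" where
  "std_normal X \<equiv> distributed M lborel X std_normal_density"

lemma std_normal_measurable: "std_normal X \<Longrightarrow> X \<in> borel_measurable M"
  using distributed_measurable[of M lborel X] by simp

lemma std_normal_distr:
  "X \<in> borel_measurable M \<Longrightarrow> std_normal X \<longleftrightarrow> distr M borel X = std_normal_distribution"
  by (auto simp: distributed_def cong: distr_cong)

text \<open>The product law of (X, Y) is invariant under the orthogonal map \<open>rot\<close>; the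
  marginals and the product form of the law of (U, V) are read off from this.\<close>

lemma indep_std_normal_rotate:
  assumes ind: "indep_var borel X borel Y" and X: "std_normal X" and Y: "std_normal Y"
  defines "U \<equiv> \<lambda>\<omega>. (X \<omega> + Y \<omega>) / sqrt 2" and "V \<equiv> \<lambda>\<omega>. (X \<omega> - Y \<omega>) / sqrt 2"
  shows "indep_var borel U borel V" "std_normal U" "std_normal V"
proof -
  let ?N = "std_normal_distribution"
  interpret N: prob_space ?N by (rule prob_space_normal_density) simp
  interpret NN: pair_prob_space ?N ?N ..
  have [measurable]: "X \<in> borel_measurable M" "Y \<in> borel_measurable M"
    using X Y by (auto intro: std_normal_measurable)
  have [measurable]: "U \<in> borel_measurable M" "V \<in> borel_measurable M"
    by (auto simp: U_def V_def)
  define rot where "rot = (\<lambda>z. ((fst z + snd z) / sqrt 2, (fst z - snd z) / sqrt 2 :: real))"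
  have [measurable]: "rot \<in> borel \<Otimes>\<^sub>M borel \<rightarrow>\<^sub>M borel \<Otimes>\<^sub>M borel" by (simp add: rot_def)
  have XY: "distr M (borel \<Otimes>\<^sub>M borel) (\<lambda>\<omega>. (X \<omega>, Y \<omega>)) = ?N \<Otimes>\<^sub>M ?N"
    using indep_var_distribution_eq[of borel X borel Y] ind X Y by (simp add: std_normal_distr)
  have nn: "(\<integral>\<^sup>+z. g z \<partial>(?N \<Otimes>\<^sub>M ?N)) = (\<integral>\<^sup>+x. (\<integral>\<^sup>+y. ennreal (std_normal_density x * std_normal_density y) * g (x, y) \<partial>lborel) \<partial>lborel)"
    if [measurable]: "g \<in> borel_measurable (borel \<Otimes>\<^sub>M borel)" for g
  proof -
    have "(\<integral>\<^sup>+z. g z \<partial>(?N \<Otimes>\<^sub>M ?N)) = (\<integral>\<^sup>+x. (\<integral>\<^sup>+y. g (x, y) \<partial>?N) \<partial>?N)"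
      by (rule N.nn_integral_fst[symmetric]) simp
    then show ?thesis
      by (simp add: nn_integral_density nn_integral_cmult[symmetric] ennreal_mult mult.assoc)
  qed
  have UV: "distr M (borel \<Otimes>\<^sub>M borel) (\<lambda>\<omega>. (U \<omega>, V \<omega>)) = ?N \<Otimes>\<^sub>M ?N"
  proof -
    have "distr M (borel \<Otimes>\<^sub>M borel) (\<lambda>\<omega>. (U \<omega>, V \<omega>)) = distr (distr M (borel \<Otimes>\<^sub>M borel) (\<lambda>\<omega>. (X \<omega>, Y \<omega>))) (borel \<Otimes>\<^sub>M borel) rot"
      by (subst distr_distr) (auto simp: comp_def rot_def U_def V_def)
    also have "\<dots> = ?N \<Otimes>\<^sub>M ?N"
      unfolding XY
    proof (rule measure_eqI)
      fix A assume "A \<in> sets (distr (?N \<Otimes>\<^sub>M ?N) (borel \<Otimes>\<^sub>M borel) rot)"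
      then have [measurable]: "A \<in> sets (borel \<Otimes>\<^sub>M borel)" by simp
      have "emeasure (distr (?N \<Otimes>\<^sub>M ?N) (borel \<Otimes>\<^sub>M borel) rot) A = (\<integral>\<^sup>+z. indicator A z \<partial>distr (?N \<Otimes>\<^sub>M ?N) (borel \<Otimes>\<^sub>M borel) rot)"
        by simp
      also have "\<dots> = (\<integral>\<^sup>+z. indicator A (rot z) \<partial>(?N \<Otimes>\<^sub>M ?N))"
        by (subst nn_integral_distr) (auto cong: measurable_cong_sets sets_pair_measure_cong)
      also have "\<dots> = (\<integral>\<^sup>+x. (\<integral>\<^sup>+y. ennreal (std_normal_density x * std_normal_density y) * indicator A ((x + y) / sqrt 2, (x - y) / sqrt 2) \<partial>lborel) \<partial>lborel)"
        by (subst nn) (auto simp: rot_def)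
      also have "\<dots> = (\<integral>\<^sup>+y. (\<integral>\<^sup>+x. ennreal (std_normal_density x * std_normal_density y) * indicator A ((x + y) / sqrt 2, (x - y) / sqrt 2) \<partial>lborel) \<partial>lborel)"
        by (subst lborel_pair.Fubini') auto
      also have "\<dots> = (\<integral>\<^sup>+u. (\<integral>\<^sup>+v. ennreal (std_normal_density u * std_normal_density v) * indicator A (u, v) \<partial>lborel) \<partial>lborel)"
        by (rule nn_integral_std_normal_rotate[where f="\<lambda>u v. indicator A (u, v)"]) auto
      also have "\<dots> = (\<integral>\<^sup>+z. indicator A z \<partial>(?N \<Otimes>\<^sub>M ?N))"
        by (subst nn) auto
      finally show "emeasure (distr (?N \<Otimes>\<^sub>M ?N) (borel \<Otimes>\<^sub>M borel) rot) A = emeasure (?N \<Otimes>\<^sub>M ?N) A"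
        using nn_integral_indicator[of A "?N \<Otimes>\<^sub>M ?N"] by (simp cong: sets_pair_measure_cong)
    qed (auto cong: sets_pair_measure_cong)
    finally show ?thesis .
  qed
  have "distr M borel U = distr (distr M (borel \<Otimes>\<^sub>M borel) (\<lambda>\<omega>. (U \<omega>, V \<omega>))) borel fst"
    by (subst distr_distr) (auto simp: comp_def)
  also have "\<dots> = ?N"
    unfolding UV using N.distr_pair_fst[of ?N] by (simp cong: distr_cong)
  finally have U: "distr M borel U = ?N" .
  have "distr M borel V = distr (distr M (borel \<Otimes>\<^sub>M borel) (\<lambda>\<omega>. (U \<omega>, V \<omega>))) borel snd"
    by (subst distr_distr) (auto simp: comp_def)
  also have "\<dots> = ?N"
  proof -
    have "distr (distr (?N \<Otimes>\<^sub>M ?N) (?N \<Otimes>\<^sub>M ?N) (\<lambda>(x, y). (y, x))) ?N fst = distr (?N \<Otimes>\<^sub>M ?N) ?N snd"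
      by (subst distr_distr) (auto simp: comp_def split_beta)
    then have "distr (?N \<Otimes>\<^sub>M ?N) ?N snd = ?N"
      using N.distr_pair_fst[of ?N] NN.distr_pair_swap by simp
    then show ?thesis unfolding UV by (simp cong: distr_cong)
  qed
  finally have V: "distr M borel V = ?N" .
  show "std_normal U" "std_normal V" using U V by (simp_all add: std_normal_distr)
  show "indep_var borel U borel V" by (simp add: indep_var_distribution_eq U V UV)
qed

text \<open>Independence of the singleton blocks {g j} of the family, evaluated at their only
  coordinate.\<close>

lemma indep_vars_reindex:
  assumes "indep_vars (\<lambda>_. N) V I" "inj_on g J" "g ` J \<subseteq> I"
  shows "indep_vars (\<lambda>_. N) (\<lambda>j. V (g j)) J"
proof -
  have "indep_vars (\<lambda>j. PiM {g j} (\<lambda>_. N)) (\<lambda>j \<omega>. restrict (\<lambda>i. V i \<omega>) {g j}) J"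
    by (rule indep_vars_restrict[OF assms(1)])
      (use assms in \<open>auto simp: disjoint_family_on_def inj_on_def\<close>)
  from indep_vars_compose2[OF this, of "\<lambda>j z. z (g j)" "\<lambda>_. N"]
  show ?thesis by simp
qed

lemma indep_vars_flatten:
  fixes W :: "'i \<times> bool \<Rightarrow> 'a \<Rightarrow> real"
  assumes Z: "indep_vars (\<lambda>_. borel \<Otimes>\<^sub>M borel) (\<lambda>k \<omega>. (W (k, False) \<omega>, W (k, True) \<omega>)) UNIV"
    and pair: "\<And>k. indep_var borel (W (k, False)) borel (W (k, True))"
  shows "indep_vars (\<lambda>_. borel) W UNIV"
proof -
  have rv [measurable]: "W i \<in> borel_measurable M" for i
    using indep_var_rv1[OF pair] indep_var_rv2[OF pair] by (cases i; cases "snd i") auto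
  show ?thesis
    unfolding indep_vars_def2
  proof (intro conjI ballI rv indep_setsI)
    fix A J assume J: "J \<noteq> {}" "J \<subseteq> (UNIV :: ('i \<times> bool) set)" "finite J"
      and "\<forall>j\<in>J. A j \<in> {W j -` A \<inter> space M |A. A \<in> sets borel}"
    then have "\<forall>j\<in>J. \<exists>B. B \<in> sets borel \<and> A j = W j -` B \<inter> space M" by auto
    then obtain B where B: "\<And>j. j \<in> J \<Longrightarrow> B j \<in> sets borel \<and> A j = W j -` B j \<inter> space M"
      by metis
    \<comment> \<open>Indices outside J get the whole line, so that every pair touched by J is
      complete; the added factors are 1.\<close>
    define B' where "B' j = (if j \<in> J then B j else UNIV)" for j
    have B'[measurable]: "B' j \<in> sets borel" for j using B by (auto simp: B'_def)
    define K where "K = fst ` J"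
    have K: "finite K" "K \<noteq> {}" using J by (auto simp: K_def)
    let ?Z = "\<lambda>k \<omega>. (W (k, False) \<omega>, W (k, True) \<omega>)"
    let ?P = "\<lambda>j. prob (W j -` B' j \<inter> space M)"
    have "(\<Inter>j\<in>J. A j) = (\<Inter>k\<in>K. ?Z k -` (B' (k, False) \<times> B' (k, True)) \<inter> space M)"
    proof (intro set_eqI iffI)
      fix \<omega> assume \<omega>: "\<omega> \<in> (\<Inter>j\<in>J. A j)"
      then have "\<omega> \<in> space M" using B J(1) by blast
      moreover have "W j \<omega> \<in> B' j" for j
        using \<omega> B[of j] by (auto simp: B'_def)
      ultimately show "\<omega> \<in> (\<Inter>k\<in>K. ?Z k -` (B' (k, False) \<times> B' (k, True)) \<inter> space M)" by auto
    next
      fix \<omega> assume \<omega>: "\<omega> \<in> (\<Inter>k\<in>K. ?Z k -` (B' (k, False) \<times> B' (k, True)) \<inter> space M)"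
      show "\<omega> \<in> (\<Inter>j\<in>J. A j)"
      proof
        fix j assume j: "j \<in> J"
        then have "fst j \<in> K" by (simp add: K_def)
        with \<omega> have "\<omega> \<in> ?Z (fst j) -` (B' (fst j, False) \<times> B' (fst j, True)) \<inter> space M"
          by (rule INT_D)
        then have "W (fst j, snd j) \<omega> \<in> B' (fst j, snd j)" "\<omega> \<in> space M"
          by (cases "snd j", auto)
        then show "\<omega> \<in> A j" using j B[OF j] by (simp add: B'_def)
      qed
    qed
    then have "prob (\<Inter>j\<in>J. A j) = (\<Prod>k\<in>K. prob (?Z k -` (B' (k, False) \<times> B' (k, True)) \<inter> space M))"
      using indep_varsD[OF Z, of K "\<lambda>k. B' (k, False) \<times> B' (k, True)"] K by simp
    also have "\<dots> = (\<Prod>k\<in>K. \<Prod>b\<in>UNIV. ?P (k, b))"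
    proof (rule prod.cong[OF refl])
      fix k
      have "?Z k -` (B' (k, False) \<times> B' (k, True)) \<inter> space M
          = (\<lambda>\<omega>. (W (k, False) \<omega>, W (k, True) \<omega>)) -` (B' (k, False) \<times> B' (k, True)) \<inter> space M" by auto
      then show "prob (?Z k -` (B' (k, False) \<times> B' (k, True)) \<inter> space M) = (\<Prod>b\<in>UNIV. ?P (k, b))"
        using indep_varD[OF pair[of k], of "B' (k, False)" "B' (k, True)"]
        by (simp add: UNIV_bool)
    qed
    also have "\<dots> = (\<Prod>j\<in>K \<times> UNIV. ?P j)"
      by (simp add: prod.cartesian_product)
    also have "\<dots> = (\<Prod>j\<in>J. ?P j)"
      by (rule prod.mono_neutral_right) (use K in \<open>auto simp: K_def B'_def prob_space image_iff\<close>, force)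
    also have "\<dots> = (\<Prod>j\<in>J. prob (A j))"
      by (rule prod.cong) (use B in \<open>auto simp: B'_def\<close>)
    finally show "prob (\<Inter>j\<in>J. A j) = (\<Prod>j\<in>J. prob (A j))" .
  qed auto
qed

text \<open>Rotation keeps each pair an independent normal pair, and distinct pairs are functions of
  disjoint blocks; \<open>indep_vars_flatten\<close> joins the two facts.\<close>

lemma iid_normal_rotate_pairs:
  fixes V :: "'i \<times> bool \<Rightarrow> 'a \<Rightarrow> real" and R :: "'i set"
  assumes ind: "indep_vars (\<lambda>_. borel) V UNIV" and n: "\<And>i. std_normal (V i)"
  defines "W \<equiv> \<lambda>(k, b). if k \<in> R then
      (if b then (\<lambda>\<omega>. (V (k, False) \<omega> - V (k, True) \<omega>) / sqrt 2)
       else (\<lambda>\<omega>. (V (k, False) \<omega> + V (k, True) \<omega>) / sqrt 2)) else V (k, b)"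
  shows "indep_vars (\<lambda>_. borel) W UNIV" "\<And>i. std_normal (W i)"
proof -
  have pair: "indep_var borel (V (k, False)) borel (V (k, True))" for k
  proof -
    have "indep_vars (\<lambda>_. borel) (\<lambda>b. V (k, \<not> b)) UNIV"
      by (rule indep_vars_reindex[OF ind]) (auto simp: inj_on_def)
    then show ?thesis
      unfolding indep_var_def
      by (rule back_subst[where P="\<lambda>x. x"])
        (intro arg_cong3[where f="\<lambda>a b. indep_vars a b"] ext, auto split: bool.splits)
  qed
  note rot = indep_std_normal_rotate[OF pair n n]
  have 1: "indep_var borel (W (k, False)) borel (W (k, True))" for k
    using rot(1)[of k] pair[of k] by (cases "k \<in> R") (auto simp: W_def)
  show "std_normal (W i)" for i
    using rot(2,3) n by (cases i) (auto simp: W_def)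
  have "indep_vars (\<lambda>k. PiM {(k, False), (k, True)} (\<lambda>_. borel)) (\<lambda>k \<omega>. restrict (\<lambda>i. V i \<omega>) {(k, False), (k, True)}) (UNIV :: 'i set)"
    by (rule indep_vars_restrict[OF ind]) (auto simp: disjoint_family_on_def)
  from indep_vars_compose2[OF this, of
      "\<lambda>k z. if k \<in> R then ((z (k, False) + z (k, True)) / sqrt 2, (z (k, False) - z (k, True)) / sqrt 2)
        else (z (k, False), z (k, True))" "\<lambda>_. borel \<Otimes>\<^sub>M borel"]
  have "indep_vars (\<lambda>_. borel \<Otimes>\<^sub>M borel) (\<lambda>k x. if k \<in> R then ((V (k, False) x + V (k, True) x) / sqrt 2, (V (k, False) x - V (k, True) x) / sqrt 2)
        else (V (k, False) x, V (k, True) x)) (UNIV :: 'i set)"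
    by (simp cong: if_cong)
  moreover have "(\<lambda>k x. if k \<in> R then ((V (k, False) x + V (k, True) x) / sqrt 2, (V (k, False) x - V (k, True) x) / sqrt 2)
        else (V (k, False) x, V (k, True) x)) = (\<lambda>k \<omega>. (W (k, False) \<omega>, W (k, True) \<omega>))"
    by (auto simp: W_def fun_eq_iff)
  ultimately show "indep_vars (\<lambda>_. borel) W UNIV"
    using 1 by (intro indep_vars_flatten) simp_all
qed

end

text \<open>Levy's construction: at level \<open>n\<close> the variables \<open>levy \<xi> n 0 k\<close> are the standardised increments
  over the dyadic intervals of length \<open>2\<^sup>-\<^sup>n\<close>, and the variables \<open>levy \<xi> n m k\<close> with \<open>m > 0\<close> are the
  randomness not used so far.\<close>

primrec levy :: "(nat \<Rightarrow> nat \<Rightarrow> 'a \<Rightarrow> real) \<Rightarrow> nat \<Rightarrow> nat \<Rightarrow> nat \<Rightarrow> 'a \<Rightarrow> real" where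
  "levy \<xi> 0 m k = \<xi> m k"
| "levy \<xi> (Suc n) m k =
    (if m = 0 then
      (if odd k then (\<lambda>\<omega>. (levy \<xi> n 0 (k div 2) \<omega> - levy \<xi> n 1 (k div 2) \<omega>) / sqrt 2)
       else (\<lambda>\<omega>. (levy \<xi> n 0 (k div 2) \<omega> + levy \<xi> n 1 (k div 2) \<omega>) / sqrt 2))
     else levy \<xi> n (Suc m) k)"

text \<open>At each position k the rows are grouped in pairs 2j, 2j + 1. The pair j = 0 is rotated
  and yields the variables of the two halves 2k and 2k + 1 of the interval k in the new row 0; the
  other rows are renumbered. Rotation and renumbering both preserve the iid normal property.\<close>

lemma (in prob_space) levy_iid:
  assumes "indep_vars (\<lambda>_. borel) (\<lambda>(m, k). \<xi> m k) UNIV" "\<And>m k. std_normal (\<xi> m k)"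
  shows "indep_vars (\<lambda>_. borel) (\<lambda>(m, k). levy \<xi> n m k) UNIV \<and> (\<forall>m k. std_normal (levy \<xi> n m k))"
proof (induction n)
  case 0
  then show ?case using assms by simp
next
  case (Suc n)
  define V :: "(nat \<times> nat) \<times> bool \<Rightarrow> 'a \<Rightarrow> real"
    where "V = (\<lambda>((k, j), b). levy \<xi> n (2 * j + of_bool b) k)"
  define g :: "(nat \<times> nat) \<times> bool \<Rightarrow> nat \<times> nat" where "g = (\<lambda>((k, j), b). (2 * j + of_bool b, k))"
  have bit: "2 * (k div 2) + of_bool (odd k) = k" for k :: nat
    by (cases "odd k") auto
  have "inj g"
  proof (rule inj_on_inverseI[where g="\<lambda>(m, k). ((k, m div 2), odd m)"])
    fix x :: "(nat \<times> nat) \<times> bool"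
    obtain k j b where x: "x = ((k, j), b)" by (cases x) force
    show "(case g x of (m, k) \<Rightarrow> ((k, m div 2), odd m)) = x"
      by (cases b) (simp_all add: x g_def)
  qed
  then have "indep_vars (\<lambda>_. borel) (\<lambda>i. (\<lambda>(m, k). levy \<xi> n m k) (g i)) UNIV"
    by (intro indep_vars_reindex[OF conjunct1[OF Suc.IH]]) simp_all
  moreover have "(\<lambda>i. (\<lambda>(m, k). levy \<xi> n m k) (g i)) = V"
    by (auto simp: V_def g_def fun_eq_iff)
  ultimately have V: "indep_vars (\<lambda>_. borel) V UNIV" "std_normal (V i)" for i
    using Suc by (auto simp: V_def split: prod.splits)
  define R where "R = {(k :: nat, 0 :: nat) | k. True}"
  define W where "W = (\<lambda>(k, b). if k \<in> R then
      (if b then (\<lambda>\<omega>. (V (k, False) \<omega> - V (k, True) \<omega>) / sqrt 2)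
       else (\<lambda>\<omega>. (V (k, False) \<omega> + V (k, True) \<omega>) / sqrt 2)) else V (k, b))"
  have W: "indep_vars (\<lambda>_. borel) W UNIV" "std_normal (W i)" for i
    unfolding W_def using iid_normal_rotate_pairs[OF V, of R] by auto
  \<comment> \<open>The new row m > 0 is the old row m + 1, here split into pair number and parity;
    the new row 0 is split by halving its position k.\<close>
  define h :: "nat \<times> nat \<Rightarrow> (nat \<times> nat) \<times> bool" where
    "h = (\<lambda>(m, k). if m = 0 then ((k div 2, 0), odd k) else ((k, Suc m div 2), odd (Suc m)))"
  have eq: "levy \<xi> (Suc n) m k = W (h (m, k))" for m k
    by (auto simp: W_def h_def R_def V_def fun_eq_iff elim!: oddE evenE)
  define hinv :: "(nat \<times> nat) \<times> bool \<Rightarrow> nat \<times> nat" where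
    "hinv = (\<lambda>((k, j), b). if j = 0 then (0, 2 * k + of_bool b) else (2 * j + of_bool b - 1, k))"
  have "hinv (h (m, k)) = (m, k)" for m k
  proof (cases "m = 0")
    case True
    then show ?thesis using bit[of k] by (simp add: h_def hinv_def)
  next
    case False
    then have "Suc m div 2 \<noteq> 0" by presburger
    then show ?thesis using bit[of "Suc m"] False by (simp only: hinv_def h_def split_conv if_False if_True) simp
  qed
  then have "inj h" by (intro inj_on_inverseI[where g=hinv]) auto
  then have "indep_vars (\<lambda>_. borel) (\<lambda>i. W (h i)) UNIV"
    by (intro indep_vars_reindex[OF W(1)]) simp_all
  moreover have "(\<lambda>i. W (h i)) = (\<lambda>(m, k). levy \<xi> (Suc n) m k)"
    unfolding eq[abs_def] by auto
  ultimately show ?case using W(2) by (simp only: eq simp_thms)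
qed

section \<open>Continuous extension from dyadic points\<close>

definition dyadic_floor :: "nat \<Rightarrow> real \<Rightarrow> nat" where
  "dyadic_floor n t = nat \<lfloor>2 ^ n * t\<rfloor>"

lemma dyadic_floor_bounds:
  assumes "0 \<le> t"
  shows "real (dyadic_floor n t) \<le> 2 ^ n * t" "2 ^ n * t < real (dyadic_floor n t) + 1"
  using assms by (auto simp: dyadic_floor_def)

lemma dyadic_floor_Suc:
  assumes "0 \<le> t"
  shows "dyadic_floor (Suc n) t = 2 * dyadic_floor n t \<or> dyadic_floor (Suc n) t = Suc (2 * dyadic_floor n t)"
proof -
  note a = dyadic_floor_bounds[OF assms, of n] and b = dyadic_floor_bounds[OF assms, of "Suc n"]
  have "real (2 * dyadic_floor n t) < real (Suc (dyadic_floor (Suc n) t))"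
    "real (dyadic_floor (Suc n) t) < real (2 * dyadic_floor n t + 2)"
    using a b by auto
  then show ?thesis unfolding of_nat_less_iff by linarith
qed

lemma dyadic_floor_less:
  assumes "0 \<le> t" "t < real L"
  shows "dyadic_floor n t < L * 2 ^ n"
proof -
  have "real (dyadic_floor n t) < real (L * 2 ^ n)"
    using dyadic_floor_bounds(1)[OF assms(1), of n] assms(2) by (simp add: mult.commute order_le_less_trans)
  then show ?thesis by (simp only: of_nat_less_iff)
qed

text \<open>The values \<open>s n j\<close> at the dyadic points \<open>j / 2\<^sup>n\<close> extend to a continuous function as soon as the
  increments of level \<open>n\<close> are summable in \<open>n\<close>, locally uniformly.\<close>

locale dyadic_path =
  fixes s :: "nat \<Rightarrow> nat \<Rightarrow> real" and w :: "nat \<Rightarrow> nat \<Rightarrow> real"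
  assumes consistent: "\<And>n j. s (Suc n) (2 * j) = s n j"
    and incr: "\<And>L n j. j < L * 2 ^ n \<Longrightarrow> \<bar>s n (Suc j) - s n j\<bar> \<le> w L n"
    and summable: "\<And>L. summable (w L)"
    and w_nonneg: "\<And>L n. 0 \<le> w L n"
begin

definition path :: "real \<Rightarrow> real" where
  "path t = lim (\<lambda>n. s n (dyadic_floor n t))"

lemma refine: "s (n + k) (j * 2 ^ k) = s n j"
proof (induction k)
  case (Suc k)
  then show ?case using consistent[of "n + k" "j * 2 ^ k"] by (simp add: mult_ac)
qed simp

lemma step:
  assumes "0 \<le> t" "t < real L"
  shows "\<bar>s (Suc n) (dyadic_floor (Suc n) t) - s n (dyadic_floor n t)\<bar> \<le> w L (Suc n)"
  using dyadic_floor_Suc[OF assms(1), of n]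
proof
  assume "dyadic_floor (Suc n) t = Suc (2 * dyadic_floor n t)"
  then show ?thesis
    using incr[of "2 * dyadic_floor n t" L "Suc n"] dyadic_floor_less[OF assms, of n]
    by (simp add: consistent)
qed (use w_nonneg in \<open>simp add: consistent\<close>)

lemma
  assumes t: "0 \<le> t" "t < real L"
  shows path_tendsto: "(\<lambda>n. s n (dyadic_floor n t)) \<longlonglongrightarrow> path t"
    and path_approx: "\<bar>path t - s n (dyadic_floor n t)\<bar> \<le> (\<Sum>k. w L (k + Suc n))"
proof -
  define a where "a n = s n (dyadic_floor n t)" for n
  have d: "norm (a (Suc k) - a k) \<le> w L (Suc k)" for k
    using step[OF t] by (simp add: a_def)
  have "summable (\<lambda>k. w L (Suc k))"
    using summable[of L] by (simp add: summable_Suc_iff)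
  then have "summable (\<lambda>k. a (Suc k) - a k)"
    by (rule summable_comparison_test'[where N=0]) (rule d)
  then have "(\<lambda>n. \<Sum>k<n. a (Suc k) - a k) \<longlonglongrightarrow> (\<Sum>k. a (Suc k) - a k)"
    by (rule summable_LIMSEQ)
  then have "(\<lambda>n. a n - a 0) \<longlonglongrightarrow> (\<Sum>k. a (Suc k) - a k)"
    by (simp add: sum_lessThan_telescope)
  from tendsto_add[OF this tendsto_const[of "a 0"]] have "convergent a"
    by (auto simp: convergent_def)
  then show lim: "(\<lambda>n. s n (dyadic_floor n t)) \<longlonglongrightarrow> path t"
    by (simp add: path_def a_def[abs_def] convergent_LIMSEQ_iff)
  then have "(\<lambda>k. a (k + n)) \<longlonglongrightarrow> path t"
    unfolding a_def[symmetric] by (rule LIMSEQ_ignore_initial_segment)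
  from telescope_sums[OF this] have sums: "(\<lambda>k. a (Suc k + n) - a (k + n)) sums (path t - a n)" by simp
  have sw: "summable (\<lambda>k. w L (k + Suc n))" using summable[of L] by (rule summable_ignore_initial_segment)
  have "norm (\<Sum>k. a (Suc k + n) - a (k + n)) \<le> (\<Sum>k. w L (k + Suc n))"
  proof (rule norm_suminf_le[OF _ sw])
    show "norm (a (Suc k + n) - a (k + n)) \<le> w L (k + Suc n)" for k
      using d[of "k + n"] by simp
  qed
  then show "\<bar>path t - s n (dyadic_floor n t)\<bar> \<le> (\<Sum>k. w L (k + Suc n))"
    using sums_unique[OF sums] by (simp add: a_def)
qed

lemma path_dyadic: "path (real j / 2 ^ n) = s n j"
proof -
  have "0 \<le> real j / 2 ^ n" "real j / 2 ^ n < real (Suc j)"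
  proof -
    have "real j / 2 ^ n \<le> real j / 1" by (intro divide_left_mono) auto
    then show "real j / 2 ^ n < real (Suc j)" by simp
  qed simp
  from path_tendsto[OF this] have "(\<lambda>k. s (k + n) (dyadic_floor (k + n) (real j / 2 ^ n))) \<longlonglongrightarrow> path (real j / 2 ^ n)"
    by (rule LIMSEQ_ignore_initial_segment)
  moreover have "s (k + n) (dyadic_floor (k + n) (real j / 2 ^ n)) = s n j" for k
  proof -
    have "2 ^ (k + n) * (real j / 2 ^ n) = real (j * 2 ^ k)"
      by (simp add: power_add)
    then have "dyadic_floor (k + n) (real j / 2 ^ n) = j * 2 ^ k"
      unfolding dyadic_floor_def by (simp only: floor_of_nat nat_int)
    then show ?thesis using refine[of n k j] by (simp add: add.commute)
  qed
  ultimately show ?thesis by (simp add: LIMSEQ_const_iff)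
qed

text \<open>Points closer than 2^(-n) have dyadic floors at most one apart, so one increment of
  level n and two tails bound the difference.\<close>

lemma path_modulus:
  assumes t: "0 \<le> t" "t < real L" and u: "0 \<le> u" "u < real L" and d: "\<bar>t - u\<bar> < 1 / 2 ^ n"
  shows "\<bar>path t - path u\<bar> \<le> w L n + 2 * (\<Sum>k. w L (k + Suc n))"
proof -
  have "2 ^ n * t - 2 ^ n * u = 2 ^ n * (t - u)" by (simp only: right_diff_distrib)
  then have "\<bar>2 ^ n * t - 2 ^ n * u\<bar> < 1"
    using d by (simp only: abs_mult) (simp add: pos_less_divide_eq mult.commute)
  then have "real (dyadic_floor n t) < real (dyadic_floor n u + 2)" "real (dyadic_floor n u) < real (dyadic_floor n t + 2)"
    using dyadic_floor_bounds[OF t(1), of n] dyadic_floor_bounds[OF u(1), of n] by auto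
  then have "dyadic_floor n t = dyadic_floor n u \<or> dyadic_floor n t = Suc (dyadic_floor n u) \<or> dyadic_floor n u = Suc (dyadic_floor n t)"
    unfolding of_nat_less_iff by linarith
  then have "\<bar>s n (dyadic_floor n t) - s n (dyadic_floor n u)\<bar> \<le> w L n"
    using incr[OF dyadic_floor_less[OF t, of n]] incr[OF dyadic_floor_less[OF u, of n]] w_nonneg[of L n]
    by (auto simp: abs_minus_commute)
  then show ?thesis
    using path_approx[OF t, of n] path_approx[OF u, of n] by linarith
qed

lemma path_continuous: "continuous_on {0..} path"
  unfolding continuous_on_iff
proof (intro ballI allI impI)
  fix t e :: real assume t: "t \<in> {0..}" and e: "0 < e"
  define L where "L = nat \<lceil>t\<rceil> + 2"
  have L: "t + 1 < real L" using t by (simp add: L_def) linarith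
  have "(\<lambda>n. \<Sum>k. w L (k + Suc n)) \<longlonglongrightarrow> 0"
    using LIMSEQ_Suc[OF suminf_exist_split2[OF summable[of L]]] by (simp add: add.commute)
  then have "(\<lambda>n. w L n + 2 * (\<Sum>k. w L (k + Suc n))) \<longlonglongrightarrow> 0 + 2 * 0"
    by (intro tendsto_add tendsto_mult tendsto_const summable_LIMSEQ_zero[OF summable])
  then have "\<forall>\<^sub>F n in sequentially. w L n + 2 * (\<Sum>k. w L (k + Suc n)) < e"
    using e by (intro order_tendstoD) auto
  then obtain n where n: "w L n + 2 * (\<Sum>k. w L (k + Suc n)) < e"
    by (auto simp: eventually_sequentially)
  show "\<exists>d>0. \<forall>u\<in>{0..}. dist u t < d \<longrightarrow> dist (path u) (path t) < e"
  proof (intro exI[of _ "1 / 2 ^ n"] conjI ballI impI)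
    fix u assume u: "u \<in> {0..}" "dist u t < 1 / 2 ^ n"
    have n1: "(1 :: real) / 2 ^ n \<le> 1" by simp
    have "\<bar>u - t\<bar> < 1 / 2 ^ n" using u(2) by (simp add: dist_real_def)
    then have "u < real L" using n1 L by linarith
    then have "\<bar>path u - path t\<bar> \<le> w L n + 2 * (\<Sum>k. w L (k + Suc n))"
      using u t L by (intro path_modulus) (auto simp: dist_real_def)
    then show "dist (path u) (path t) < e" using n by (simp add: dist_real_def)
  qed simp
qed

end

lemma le_add_fourth_power:
  fixes y q :: real
  assumes "0 < q"
  shows "y \<le> q + y ^ 4 / q ^ 3"
proof (cases "y \<le> q")
  case False
  then have "q ^ 3 \<le> y ^ 3" using assms by (intro power_mono) auto
  then have "y * q ^ 3 \<le> y * y ^ 3" using False assms by (intro mult_left_mono) auto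
  then have "y \<le> y ^ 4 / q ^ 3" using assms by (simp add: pos_le_divide_eq power_Suc[symmetric] del: power_Suc)
  then show ?thesis using assms by simp
next
  case True
  have "0 \<le> y ^ 4 / q ^ 3" using assms by simp
  then show ?thesis using True by linarith
qed

section \<open>The Brownian path built from a normal family\<close>

locale gaussian_family = prob_space M + complete_measure M for M :: "'a measure" +
  fixes \<xi> :: "nat \<Rightarrow> nat \<Rightarrow> 'a \<Rightarrow> real"
  assumes indep_family: "indep_vars (\<lambda>_. borel) (\<lambda>(m, k). \<xi> m k) UNIV"
    and normal_family: "\<And>m k. std_normal (\<xi> m k)"
begin

definition W :: "nat \<Rightarrow> nat \<Rightarrow> 'a \<Rightarrow> real" where "W n = levy \<xi> n 0"

lemma W_Suc:
  "W (Suc n) (2 * k) \<omega> + W (Suc n) (Suc (2 * k)) \<omega> = sqrt 2 * W n k \<omega>"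
proof -
  have "(a + b) / sqrt 2 + (a - b) / sqrt 2 = sqrt 2 * a" for a b :: real
    by (simp add: add_divide_distrib[symmetric] field_simps)
  then show ?thesis by (simp add: W_def)
qed

lemma W_normal: "std_normal (W n k)"
  using levy_iid[OF indep_family normal_family, of n] by (simp add: W_def)

lemma W_measurable [measurable]: "W n k \<in> borel_measurable M"
  by (rule std_normal_measurable[OF W_normal])

lemma W_indep: "indep_vars (\<lambda>_. borel) (W n) UNIV"
proof -
  have "indep_vars (\<lambda>_. borel) (\<lambda>k. (\<lambda>(m, k). levy \<xi> n m k) (0, k)) UNIV"
    using conjunct1[OF levy_iid[OF indep_family normal_family, of n]]
    by (rule indep_vars_reindex) (simp_all add: inj_on_def)
  then show ?thesis by (simp add: W_def)
qed

definition scale :: "nat \<Rightarrow> real" where "scale n = (1 / sqrt 2) ^ n"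

lemma scale_pos: "0 < scale n" by (simp add: scale_def)

lemma scale_square: "scale n ^ 2 = (1 / 2) ^ n"
proof -
  have "((1 / sqrt 2) ^ n) ^ 2 = ((1 / sqrt 2) ^ 2) ^ n"
    by (simp only: power_mult[symmetric] mult.commute)
  then show ?thesis by (simp add: scale_def power_divide)
qed

lemma scale_Suc: "scale (Suc n) * sqrt 2 = scale n" by (simp add: scale_def)

definition S :: "nat \<Rightarrow> nat \<Rightarrow> 'a \<Rightarrow> real" where
  "S n j \<omega> = scale n * (\<Sum>k<j. W n k \<omega>)"

lemma S_measurable [measurable]: "S n j \<in> borel_measurable M"
  unfolding S_def by measurable

lemma S_consistent: "S (Suc n) (2 * j) \<omega> = S n j \<omega>"
proof -
  have "(\<Sum>k<2 * j. W (Suc n) k \<omega>) = (\<Sum>k<j. sqrt 2 * W n k \<omega>)"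
  proof (induction j)
    case (Suc j)
    then show ?case using W_Suc[of n j \<omega>] by simp
  qed simp
  then have "S (Suc n) (2 * j) \<omega> = (scale (Suc n) * sqrt 2) * (\<Sum>k<j. W n k \<omega>)"
    by (simp add: S_def sum_distrib_left[symmetric])
  then show ?thesis by (simp add: scale_Suc S_def)
qed

text \<open>With q = \<open>osc_rate\<close>, the L * 2^n fourth powers of increments have expected
  sum 3 * L * 2^(-n) = 3 * L * q^(8n); division by q^(3n) leaves q^(5n), so both parts of
  \<open>osc\<close> decay geometrically.\<close>

definition osc_rate :: real where "osc_rate = (1 / 2) powr (1 / 8)"

lemma osc_rate: "0 < osc_rate" "osc_rate < 1" "osc_rate ^ 8 = 1 / 2"
proof -
  show "0 < osc_rate" by (simp add: osc_rate_def)
  show e8: "osc_rate ^ 8 = 1 / 2" by (simp add: osc_rate_def powr_realpow[symmetric] powr_powr)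
  show "osc_rate < 1"
  proof (rule ccontr)
    assume "\<not> osc_rate < 1"
    then have "1 \<le> osc_rate ^ 8" by (intro one_le_power) simp
    then show False using e8 by linarith
  qed
qed

text \<open>Bounding an increment \<open>y\<close> by \<open>q + y\<^sup>4 / q\<^sup>3\<close> makes the oscillation integrable and summable over
  the levels at the same time.\<close>

definition osc :: "nat \<Rightarrow> nat \<Rightarrow> 'a \<Rightarrow> real" where
  "osc L n \<omega> = osc_rate ^ n + (\<Sum>k<L * 2 ^ n. (scale n * W n k \<omega>) ^ 4) / (osc_rate ^ n) ^ 3"

lemma osc_nonneg: "0 \<le> osc L n \<omega>"
  unfolding osc_def using osc_rate by (intro add_nonneg_nonneg divide_nonneg_nonneg sum_nonneg) auto

lemma S_incr_le_osc:
  assumes "j < L * 2 ^ n"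
  shows "\<bar>S n (Suc j) \<omega> - S n j \<omega>\<bar> \<le> osc L n \<omega>"
proof -
  let ?q = "osc_rate ^ n"
  have "\<bar>S n (Suc j) \<omega> - S n j \<omega>\<bar> = \<bar>scale n * W n j \<omega>\<bar>"
    by (simp add: S_def distrib_left)
  also have "\<dots> \<le> ?q + \<bar>scale n * W n j \<omega>\<bar> ^ 4 / ?q ^ 3"
    using osc_rate by (intro le_add_fourth_power) simp
  also have "\<bar>scale n * W n j \<omega>\<bar> ^ 4 = (scale n * W n j \<omega>) ^ 4"
    by (simp add: power_even_abs)
  also have "(scale n * W n j \<omega>) ^ 4 \<le> (\<Sum>k<L * 2 ^ n. (scale n * W n k \<omega>) ^ 4)"
    using assms by (intro member_le_sum) auto
  finally show ?thesis
    unfolding osc_def using osc_rate by (simp add: divide_right_mono)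
qed

lemma osc_measurable [measurable]: "osc L n \<in> borel_measurable M"
  unfolding osc_def by measurable

lemma
  assumes X: "std_normal X"
  shows std_normal_fourth_moment: "(\<integral>\<omega>. X \<omega> ^ 4 \<partial>M) = 3"
    and std_normal_fourth_integrable: "integrable M (\<lambda>\<omega>. X \<omega> ^ 4)"
proof -
  have f: "fact 4 = (24 :: real)" by (simp add: fact_numeral)
  have "has_bochner_integral lborel (\<lambda>x. std_normal_density x * x ^ (2 * 2)) (fact (2 * 2) / (2 ^ 2 * fact 2))"
    by (rule std_normal_moment_even)
  then have h: "integrable lborel (\<lambda>x. std_normal_density x * x ^ 4)" "(\<integral>x. std_normal_density x * x ^ 4 \<partial>lborel) = 3"
    by (simp_all add: has_bochner_integral_iff f)
  show "(\<integral>\<omega>. X \<omega> ^ 4 \<partial>M) = 3"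
    using distributed_integral[OF X, of "\<lambda>x. x ^ 4"] h by simp
  show "integrable M (\<lambda>\<omega>. X \<omega> ^ 4)"
    using distributed_integrable[OF X, of "\<lambda>x. x ^ 4"] h by simp
qed

lemma
  shows osc_integrable: "integrable M (osc L n)"
    and osc_expectation: "(\<integral>\<omega>. osc L n \<omega> \<partial>M) \<le> (1 + 3 * real L) * osc_rate ^ n"
proof -
  let ?q = "osc_rate ^ n"
  have i: "integrable M (\<lambda>\<omega>. (scale n * W n k \<omega>) ^ 4)" for k
    using std_normal_fourth_integrable[OF W_normal[of n k]] by (simp add: power_mult_distrib)
  have e: "(\<integral>\<omega>. (scale n * W n k \<omega>) ^ 4 \<partial>M) = 3 * (1 / 4) ^ n" for k
  proof -
    have "scale n ^ 4 = (scale n ^ 2) ^ 2" by simp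
    also have "\<dots> = (1 / 4) ^ n"
    proof -
      have "((1 / 2 :: real) ^ n) ^ 2 = ((1 / 2) ^ 2) ^ n"
        by (simp only: power_mult[symmetric] mult.commute)
      then show ?thesis by (simp add: scale_square power_divide)
    qed
    finally show ?thesis
      using std_normal_fourth_moment[OF W_normal[of n k]] by (simp add: power_mult_distrib)
  qed
  show "integrable M (osc L n)" unfolding osc_def using i by simp
  have "(\<integral>\<omega>. osc L n \<omega> \<partial>M) = ?q + (\<Sum>k<L * 2 ^ n. 3 * (1 / 4) ^ n) / ?q ^ 3"
    unfolding osc_def using i by (simp add: e prob_space)
  also have "(\<Sum>k<L * 2 ^ n. 3 * (1 / 4) ^ n) = 3 * real L * ((1 / 2) ^ n)"
    by (simp add: power_divide field_simps power_mult_distrib[symmetric])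
  also have "(1 / 2) ^ n = ?q ^ 8"
    unfolding osc_rate(3)[symmetric] by (simp add: power_mult[symmetric] mult.commute)
  also have "3 * real L * ?q ^ 8 / ?q ^ 3 = 3 * real L * ?q ^ 5"
    using osc_rate by (simp add: field_simps power_add[symmetric])
  finally have "(\<integral>\<omega>. osc L n \<omega> \<partial>M) = ?q + 3 * real L * ?q ^ 5" .
  moreover have "?q ^ 5 \<le> ?q ^ 1"
    using osc_rate by (intro power_decreasing) (auto intro: power_le_one)
  then have "3 * real L * ?q ^ 5 \<le> 3 * real L * ?q"
    by (intro mult_left_mono) auto
  ultimately show "(\<integral>\<omega>. osc L n \<omega> \<partial>M) \<le> (1 + 3 * real L) * ?q"
    by (simp add: distrib_right)
qed

text \<open>Extended values allow termwise integration before convergence is known. This gives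
  summability almost everywhere and, in the sharpness part, the cost of passing from the grid to all
  times.\<close>

definition osc_tail :: "nat \<Rightarrow> nat \<Rightarrow> 'a \<Rightarrow> ennreal" where
  "osc_tail L n \<omega> = (\<Sum>k. ennreal (osc L (k + n) \<omega>))"

lemma osc_tail_measurable [measurable]: "osc_tail L n \<in> borel_measurable M"
  unfolding osc_tail_def by measurable

lemma osc_tail_integral:
  "(\<integral>\<^sup>+\<omega>. osc_tail L n \<omega> \<partial>M) \<le> ennreal ((1 + 3 * real L) * osc_rate ^ n / (1 - osc_rate))"
proof -
  have "(\<integral>\<^sup>+\<omega>. osc_tail L n \<omega> \<partial>M) = (\<Sum>k. \<integral>\<^sup>+\<omega>. ennreal (osc L (k + n) \<omega>) \<partial>M)"
    unfolding osc_tail_def by (rule nn_integral_suminf) measurable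
  also have "\<dots> \<le> (\<Sum>k. ennreal ((1 + 3 * real L) * osc_rate ^ n * osc_rate ^ k))"
  proof (rule suminf_le)
    fix k
    have "(\<integral>\<^sup>+\<omega>. ennreal (osc L (k + n) \<omega>) \<partial>M) = ennreal (\<integral>\<omega>. osc L (k + n) \<omega> \<partial>M)"
      by (rule nn_integral_eq_integral) (auto simp: osc_integrable osc_nonneg)
    also have "\<dots> \<le> ennreal ((1 + 3 * real L) * osc_rate ^ n * osc_rate ^ k)"
      using osc_expectation[of L "k + n"] by (intro ennreal_leI) (simp add: power_add mult_ac)
    finally show "(\<integral>\<^sup>+\<omega>. ennreal (osc L (k + n) \<omega>) \<partial>M) \<le> ennreal ((1 + 3 * real L) * osc_rate ^ n * osc_rate ^ k)" .
  qed auto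
  also have "\<dots> = ennreal (\<Sum>k. (1 + 3 * real L) * osc_rate ^ n * osc_rate ^ k)"
    using osc_rate by (intro suminf_ennreal2 summable_mult summable_geometric) auto
  also have "(\<Sum>k. (1 + 3 * real L) * osc_rate ^ n * osc_rate ^ k) = (1 + 3 * real L) * osc_rate ^ n / (1 - osc_rate)"
    using osc_rate by (subst suminf_mult) (auto simp: suminf_geometric intro: summable_geometric)
  finally show ?thesis .
qed

definition Good :: "'a set" where
  "Good = {\<omega> \<in> space M. \<forall>L. summable (\<lambda>n. osc L n \<omega>)}"

lemma AE_Good: "AE \<omega> in M. \<omega> \<in> Good"
proof -
  have "AE \<omega> in M. summable (\<lambda>n. osc L n \<omega>)" for L
  proof -
    have "AE \<omega> in M. osc_tail L 0 \<omega> \<noteq> \<infinity>"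
      using osc_tail_integral[of L 0] by (intro nn_integral_noteq_infinite) (auto simp: top_unique)
    then show ?thesis
    proof eventually_elim
      case (elim \<omega>)
      then show ?case
        by (intro summable_suminf_not_top osc_nonneg) (simp add: osc_tail_def)
    qed
  qed
  then have "AE \<omega> in M. \<forall>L. summable (\<lambda>n. osc L n \<omega>)" by (simp add: AE_all_countable)
  then show ?thesis using AE_space by eventually_elim (simp add: Good_def)
qed

lemma Good_sets [measurable]: "Good \<in> sets M"
proof -
  obtain N where "{\<omega> \<in> space M. \<omega> \<notin> Good} \<subseteq> N" "N \<in> null_sets M"
    using AE_Good by (auto elim!: AE_E3 simp: subset_iff)
  then have "{\<omega> \<in> space M. \<omega> \<notin> Good} \<in> sets M"
    by (rule complete)
  then have "space M - {\<omega> \<in> space M. \<omega> \<notin> Good} \<in> sets M" by auto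
  also have "space M - {\<omega> \<in> space M. \<omega> \<notin> Good} = Good" by (auto simp: Good_def)
  finally show ?thesis .
qed

lemma Good_path: "\<omega> \<in> Good \<Longrightarrow> dyadic_path (\<lambda>n j. S n j \<omega>) (\<lambda>L n. osc L n \<omega>)"
  by unfold_locales (auto simp: S_consistent S_incr_le_osc osc_nonneg Good_def)

definition B0 :: "real \<Rightarrow> 'a \<Rightarrow> real" where
  "B0 t \<omega> = lim (\<lambda>n. S n (dyadic_floor n t) \<omega>)"

text \<open>Set to zero off \<open>Good\<close>, so that every path is continuous, as
  \<open>brownian_motion\<close> demands of all sample points.\<close>

definition B :: "real \<Rightarrow> 'a \<Rightarrow> real" where
  "B t \<omega> = (if \<omega> \<in> Good then B0 t \<omega> else 0)"

lemma B_measurable [measurable]: "B t \<in> borel_measurable M"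
proof -
  have [measurable]: "B0 t \<in> borel_measurable M"
    unfolding B0_def by (rule borel_measurable_lim_metric) simp
  show ?thesis unfolding B_def by measurable
qed

lemma B_path: "\<omega> \<in> Good \<Longrightarrow> B t \<omega> = dyadic_path.path (\<lambda>n j. S n j \<omega>) t"
  by (simp add: B_def B0_def dyadic_path.path_def[OF Good_path])

lemma B_continuous: "continuous_on {0..} (\<lambda>t. B t \<omega>)"
proof (cases "\<omega> \<in> Good")
  case True
  then show ?thesis using dyadic_path.path_continuous[OF Good_path[OF True]] by (simp add: B_path)
qed (simp add: B_def)

lemma B_dyadic: "\<omega> \<in> Good \<Longrightarrow> B (real j / 2 ^ n) \<omega> = S n j \<omega>"
  using dyadic_path.path_dyadic[OF Good_path] by (simp add: B_path)

lemma B_0: "B 0 \<omega> = 0"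
  using B_dyadic[of \<omega> 0 0] by (cases "\<omega> \<in> Good") (auto simp: S_def B_def)

lemma B_approx:
  assumes "\<omega> \<in> Good" "0 \<le> t" "t < real L"
  shows "ennreal \<bar>B t \<omega> - S n (dyadic_floor n t) \<omega>\<bar> \<le> osc_tail L (Suc n) \<omega>"
proof -
  have s: "summable (\<lambda>k. osc L (k + Suc n) \<omega>)"
    using assms(1) by (intro summable_ignore_initial_segment) (simp add: Good_def)
  have "osc_tail L (Suc n) \<omega> = ennreal (\<Sum>k. osc L (k + Suc n) \<omega>)"
    unfolding osc_tail_def by (rule suminf_ennreal2[OF osc_nonneg s])
  then show ?thesis
    using dyadic_path.path_approx[OF Good_path[OF assms(1)] assms(2,3), of n] B_path[OF assms(1)]
    by (simp add: ennreal_leI)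
qed

end

section \<open>Dyadic increments and their independence of the past\<close>

lemma std_normal_distribution_scale:
  assumes "0 < \<sigma>"
  shows "density lborel (normal_density 0 \<sigma>) = distr std_normal_distribution borel (\<lambda>x. \<sigma> * x)"
proof -
  interpret N: prob_space std_normal_distribution by (rule prob_space_normal_density) simp
  have "distributed std_normal_distribution lborel (\<lambda>x. x) (normal_density 0 1)"
    unfolding distributed_def by (auto simp: distr_id2)
  from N.normal_density_affine[OF this, of \<sigma> 0] assms
  have "distributed std_normal_distribution lborel (\<lambda>x. \<sigma> * x) (normal_density 0 \<sigma>)" by simp
  then show ?thesis unfolding distributed_def by (simp cong: distr_cong)
qed

lemma char_normal:
  assumes "0 < \<sigma>"
  shows "char (density lborel (normal_density 0 \<sigma>)) t = exp (- (\<sigma>\<^sup>2 * t\<^sup>2 / 2))"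
proof -
  have "char (density lborel (normal_density 0 \<sigma>)) t = char std_normal_distribution (t * \<sigma>)"
    unfolding char_def std_normal_distribution_scale[OF assms]
    by (subst integral_distr) (auto simp: mult.assoc)
  also have "\<dots> = exp (- (\<sigma>\<^sup>2 * t\<^sup>2 / 2))"
    unfolding char_std_normal_distribution by (simp add: power_mult_distrib mult.commute exp_of_real)
  finally show ?thesis .
qed

context gaussian_family
begin

text \<open>As the preimage algebra of a tuple, each event comes from one set of the product space;
  independence of disjoint blocks of a family applies to events of this form.\<close>

definition level_algebra :: "nat \<Rightarrow> nat \<Rightarrow> 'a measure" where
  "level_algebra n a = vimage_algebra (space M) (\<lambda>\<omega>. \<lambda>k\<in>{..<a}. W n k \<omega>) (PiM {..<a} (\<lambda>_. borel))"

lemma tuple_measurable [measurable]: "(\<lambda>\<omega>. \<lambda>k\<in>{..<a}. W n k \<omega>) \<in> M \<rightarrow>\<^sub>M PiM {..<a} (\<lambda>_. borel)"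
  by (rule measurable_restrict) simp

lemma space_level_algebra [simp]: "space (level_algebra n a) = space M"
  by (simp add: level_algebra_def)

lemma sets_level_algebra:
  "sets (level_algebra n a) = {(\<lambda>\<omega>. \<lambda>k\<in>{..<a}. W n k \<omega>) -` A \<inter> space M | A. A \<in> sets (PiM {..<a} (\<lambda>_. borel))}"
  unfolding level_algebra_def
  by (rule sets_vimage_algebra2) (auto simp: space_PiM)

lemma level_algebra_events: "sets (level_algebra n a) \<subseteq> events"
  unfolding sets_level_algebra using measurable_sets[OF tuple_measurable] by auto

lemma W_level_algebra:
  assumes "k < a"
  shows "W n k \<in> borel_measurable (level_algebra n a)"
proof -
  have "(\<lambda>\<omega>. \<lambda>k\<in>{..<a}. W n k \<omega>) \<in> level_algebra n a \<rightarrow>\<^sub>M PiM {..<a} (\<lambda>_. borel)"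
    unfolding level_algebra_def
    by (rule measurable_vimage_algebra1) (auto simp: space_PiM)
  from measurable_compose[OF this measurable_component_singleton[of k]]
  show ?thesis using assms by simp
qed

lemma level_algebra_le:
  assumes "\<And>k. k < a \<Longrightarrow> W n k \<in> borel_measurable N" "space N = space M"
  shows "sets (level_algebra n a) \<subseteq> sets N"
proof
  fix G assume "G \<in> sets (level_algebra n a)"
  then obtain A where A: "A \<in> sets (PiM {..<a} (\<lambda>_. borel))" "G = (\<lambda>\<omega>. \<lambda>k\<in>{..<a}. W n k \<omega>) -` A \<inter> space M"
    by (auto simp: sets_level_algebra)
  have "(\<lambda>\<omega>. \<lambda>k\<in>{..<a}. W n k \<omega>) \<in> N \<rightarrow>\<^sub>M PiM {..<a} (\<lambda>_. borel)"
    by (rule measurable_restrict) (use assms in auto)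
  from measurable_sets[OF this A(1)] show "G \<in> sets N" using A(2) assms(2) by simp
qed

lemma level_algebra_Suc: "sets (level_algebra n a) \<subseteq> sets (level_algebra (Suc n) (a * 2))"
proof (rule level_algebra_le)
  fix k assume "k < a"
  then have [measurable]: "W (Suc n) (2 * k) \<in> borel_measurable (level_algebra (Suc n) (a * 2))"
    "W (Suc n) (Suc (2 * k)) \<in> borel_measurable (level_algebra (Suc n) (a * 2))"
    by (auto intro!: W_level_algebra)
  have "W n k = (\<lambda>\<omega>. (W (Suc n) (2 * k) \<omega> + W (Suc n) (Suc (2 * k)) \<omega>) / sqrt 2)"
    using W_Suc[of n k] by (simp add: fun_eq_iff)
  then show "W n k \<in> borel_measurable (level_algebra (Suc n) (a * 2))" by simp
qed simp

text \<open>The increments up to time i / 2^n at all finer levels. The algebras increase with N, so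
  the union is stable under intersection, which the extension of independence to the generated
  sigma-algebra needs.\<close>

definition dyadic_generator :: "nat \<Rightarrow> nat \<Rightarrow> 'a set set" where
  "dyadic_generator n i = (\<Union>N. sets (level_algebra (n + N) (i * 2 ^ N)))"

definition dyadic_history :: "nat \<Rightarrow> nat \<Rightarrow> 'a measure" where
  "dyadic_history n i = sigma (space M) (dyadic_generator n i)"

lemma generator_subset: "dyadic_generator n i \<subseteq> Pow (space M)"
  unfolding dyadic_generator_def using sets.sets_into_space[of _ "level_algebra _ _"] by fastforce

lemma space_history [simp]: "space (dyadic_history n i) = space M"
  by (simp add: dyadic_history_def generator_subset)

lemma sets_history: "sets (dyadic_history n i) = sigma_sets (space M) (dyadic_generator n i)"
  by (simp add: dyadic_history_def generator_subset)

lemma history_events: "sets (dyadic_history n i) \<subseteq> events"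
  unfolding sets_history dyadic_generator_def
  by (intro sets.sigma_sets_subset) (use level_algebra_events in blast)

lemma generator_Int_stable: "Int_stable (dyadic_generator n i)"
proof (rule Int_stableI)
  fix a b assume "a \<in> dyadic_generator n i" "b \<in> dyadic_generator n i"
  then obtain N K where N: "a \<in> sets (level_algebra (n + N) (i * 2 ^ N))" "b \<in> sets (level_algebra (n + K) (i * 2 ^ K))"
    by (auto simp: dyadic_generator_def)
  have "sets (level_algebra (n + N) (i * 2 ^ N)) \<subseteq> sets (level_algebra (n + K) (i * 2 ^ K))" if "N \<le> K" for N K
    using that
  proof (induction K rule: dec_induct)
    case (step K)
    then show ?case using level_algebra_Suc[of "n + K" "i * 2 ^ K"] by (simp add: mult_ac)
  qed simp
  from this[of N "max N K"] this[of K "max N K"] N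
  have "a \<inter> b \<in> sets (level_algebra (n + max N K) (i * 2 ^ max N K))" by auto
  then show "a \<inter> b \<in> dyadic_generator n i" by (auto simp: dyadic_generator_def)
qed

lemma S_refine: "S (n + k) (j * 2 ^ k) \<omega> = S n j \<omega>"
proof (induction k)
  case (Suc k)
  then show ?case using S_consistent[of "n + k" "j * 2 ^ k" \<omega>] by (simp add: mult_ac)
qed simp

lemma S_level_algebra: "j \<le> a \<Longrightarrow> S n j \<in> borel_measurable (level_algebra n a)"
  unfolding S_def by (intro borel_measurable_times borel_measurable_const borel_measurable_sum W_level_algebra) auto

lemma S_history:
  assumes "k * 2 ^ n \<le> i * 2 ^ m"
  shows "S m k \<in> borel_measurable (dyadic_history n i)"
proof -
  have "S m k = S (n + m) (k * 2 ^ n)"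
    using S_refine[of m n k] by (simp add: fun_eq_iff add.commute)
  then have "S m k \<in> borel_measurable (level_algebra (n + m) (i * 2 ^ m))"
    using S_level_algebra[OF assms, of "n + m"] by simp
  moreover have "sets (level_algebra (n + m) (i * 2 ^ m)) \<subseteq> sets (dyadic_history n i)"
    unfolding sets_history dyadic_generator_def by auto
  ultimately show ?thesis by (auto simp: measurable_def)
qed

lemma S_diff: "i \<le> j \<Longrightarrow> S n j \<omega> - S n i \<omega> = scale n * (\<Sum>k\<in>{i..<j}. W n k \<omega>)"
proof -
  assume "i \<le> j"
  then have "(\<Sum>k<j. W n k \<omega>) = (\<Sum>k<i. W n k \<omega>) + (\<Sum>k\<in>{i..<j}. W n k \<omega>)"
    using sum.atLeastLessThan_concat[of 0 i j "\<lambda>k. W n k \<omega>"] by (simp add: atLeast0LessThan)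
  then show ?thesis by (simp add: S_def distrib_left)
qed

text \<open>At level n + N the generating event depends on the increments with index below i * 2^N,
  and Y on those from there to j * 2^N. Disjoint blocks are independent, and intersection stability
  carries this to the whole history.\<close>

lemma S_increment_indep:
  assumes G: "G \<in> sets (dyadic_history n i)" and ij: "i \<le> j" and A: "A \<in> sets borel"
  defines "Y \<equiv> \<lambda>\<omega>. S n j \<omega> - S n i \<omega>"
  shows "prob (G \<inter> (Y -` A \<inter> space M)) = prob G * prob (Y -` A \<inter> space M)"
proof -
  have Y [measurable]: "Y \<in> borel_measurable M" unfolding Y_def by simp
  have "indep_set (dyadic_generator n i) {Y -` A \<inter> space M | A. A \<in> sets borel}"
  proof (rule indep_setI)
    show "dyadic_generator n i \<subseteq> events"
      unfolding dyadic_generator_def using level_algebra_events by blast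
    show "{Y -` A \<inter> space M | A. A \<in> sets borel} \<subseteq> events" by auto
    fix G E assume "G \<in> dyadic_generator n i" "E \<in> {Y -` A \<inter> space M | A. A \<in> sets borel}"
    then obtain N A where G: "G \<in> sets (level_algebra (n + N) (i * 2 ^ N))"
      and A: "A \<in> sets borel" "E = Y -` A \<inter> space M"
      by (auto simp: dyadic_generator_def)
    let ?I = "{..<i * 2 ^ N}" and ?J = "{i * 2 ^ N..<j * 2 ^ N}" and ?V = "W (n + N)"
    obtain C where C: "C \<in> sets (PiM ?I (\<lambda>_. borel))" "G = (\<lambda>\<omega>. \<lambda>k\<in>?I. ?V k \<omega>) -` C \<inter> space M"
      using G by (auto simp: sets_level_algebra)
    have Yeq: "Y \<omega> = scale (n + N) * (\<Sum>k\<in>?J. ?V k \<omega>)" for \<omega>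
      using S_diff[of "i * 2 ^ N" "j * 2 ^ N" "n + N" \<omega>] ij by (simp add: Y_def S_refine)
    have 1: "indep_var (PiM ?I (\<lambda>_. borel)) (\<lambda>\<omega>. restrict (\<lambda>i. ?V i \<omega>) ?I) (PiM ?J (\<lambda>_. borel)) (\<lambda>\<omega>. restrict (\<lambda>i. ?V i \<omega>) ?J)"
      by (rule indep_var_restrict[OF W_indep]) auto
    moreover have "(\<lambda>z. scale (n + N) * (\<Sum>k\<in>?J. z k)) \<in> borel_measurable (PiM ?J (\<lambda>_. borel))"
      by measurable
    \<comment> \<open>The indicator turns G into the event that a real variable equals 1, so that
      the product rule for two variables applies.\<close>
    moreover have "(indicator C :: _ \<Rightarrow> real) \<in> borel_measurable (PiM ?I (\<lambda>_. borel))"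
      using C(1) by simp
    ultimately have "indep_var borel ((indicator C :: _ \<Rightarrow> real) \<circ> (\<lambda>\<omega>. restrict (\<lambda>i. ?V i \<omega>) ?I)) borel
        ((\<lambda>z. scale (n + N) * (\<Sum>k\<in>?J. z k)) \<circ> (\<lambda>\<omega>. restrict (\<lambda>i. ?V i \<omega>) ?J))"
      by (intro indep_var_compose[OF 1])
    then have "indep_var borel (\<lambda>\<omega>. indicator C (restrict (\<lambda>i. ?V i \<omega>) ?I) :: real) borel Y"
      by (simp add: comp_def Yeq[abs_def])
    from indep_varD[OF this, of "{1}" A] A(1)
    have "prob ((\<lambda>\<omega>. (indicator C (restrict (\<lambda>i. ?V i \<omega>) ?I) :: real, Y \<omega>)) -` ({1} \<times> A) \<inter> space M)
      = prob ((\<lambda>\<omega>. indicator C (restrict (\<lambda>i. ?V i \<omega>) ?I) :: real) -` {1} \<inter> space M) * prob E"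
      by (simp add: A(2))
    also have "(\<lambda>\<omega>. indicator C (restrict (\<lambda>i. ?V i \<omega>) ?I) :: real) -` {1} \<inter> space M = G"
      using C(2) by (auto simp: indicator_def split: if_splits)
    also have "(\<lambda>\<omega>. (indicator C (restrict (\<lambda>i. ?V i \<omega>) ?I) :: real, Y \<omega>)) -` ({1} \<times> A) \<inter> space M = G \<inter> E"
      using C(2) A(2) by (auto simp: indicator_def split: if_splits)
    finally show "prob (G \<inter> E) = prob G * prob E" .
  qed
  then have "indep_set (sigma_sets (space M) (dyadic_generator n i)) (sigma_sets (space M) {Y -` A \<inter> space M | A. A \<in> sets borel})"
  proof (rule indep_set_sigma_sets[OF _ generator_Int_stable])
    show "Int_stable {Y -` A \<inter> space M | A. A \<in> sets borel}"
    proof (rule Int_stableI)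
      fix a b assume "a \<in> {Y -` A \<inter> space M | A. A \<in> sets borel}" "b \<in> {Y -` A \<inter> space M | A. A \<in> sets borel}"
      then obtain A A' where "a = Y -` A \<inter> space M" "b = Y -` A' \<inter> space M" "A \<in> sets borel" "A' \<in> sets borel"
        by auto
      then show "a \<inter> b \<in> {Y -` A \<inter> space M | A. A \<in> sets borel}"
        by (intro CollectI exI[of _ "A \<inter> A'"]) auto
    qed
  qed
  from indep_setD[OF this, of G "Y -` A \<inter> space M"] G A show ?thesis
    by (auto simp: sets_history)
qed

lemma S_increment_normal:
  assumes "i < j"
  shows "distributed M lborel (\<lambda>\<omega>. S n j \<omega> - S n i \<omega>) (normal_density 0 (sqrt (real (j - i) / 2 ^ n)))"
proof -
  have "distributed M lborel (\<lambda>\<omega>. \<Sum>k\<in>{i..<j}. W n k \<omega>) (normal_density (\<Sum>k\<in>{i..<j}. 0) (sqrt (\<Sum>k\<in>{i..<j}. 1\<^sup>2)))"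
    by (rule sum_indep_normal) (use assms W_normal in \<open>auto intro: indep_vars_subset[OF W_indep]\<close>)
  then have "distributed M lborel (\<lambda>\<omega>. \<Sum>k\<in>{i..<j}. W n k \<omega>) (normal_density 0 (sqrt (real (j - i))))"
    by simp
  from normal_density_affine[OF this, of "scale n" 0] assms scale_pos[of n]
  have "distributed M lborel (\<lambda>\<omega>. S n j \<omega> - S n i \<omega>) (normal_density 0 (scale n * sqrt (real (j - i))))"
    by (simp add: S_diff)
  moreover have "scale n * sqrt (real (j - i)) = sqrt (real (j - i) / 2 ^ n)"
  proof -
    have "scale n = sqrt ((1 / 2) ^ n)"
      unfolding scale_square[symmetric] using scale_pos[of n] by simp
    then show ?thesis by (simp add: real_sqrt_mult[symmetric] power_divide)
  qed
  ultimately show ?thesis by simp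
qed

text \<open>Up to null sets, an event of the augmented filtration is a dyadic one: B s is almost
  everywhere a limit of values at dyadic points not after s, and a null set matches the empty set.
  The property survives complements and countable unions.\<close>

lemma augmented_filtration_history:
  assumes G: "G \<in> sets (augmented_filtration M B u)" and u: "u \<le> real i / 2 ^ n"
  shows "G \<in> events \<and> (\<exists>G'\<in>sets (dyadic_history n i). AE \<omega> in M. \<omega> \<in> G \<longleftrightarrow> \<omega> \<in> G')"
proof -
  let ?gen = "{B s -` A \<inter> space M | s A. 0 \<le> s \<and> s \<le> u \<and> A \<in> sets borel} \<union> null_sets M"
  have "?gen \<subseteq> Pow (space M)" using sets.sets_into_space by (auto simp: null_sets_def)
  then have "G \<in> sigma_sets (space M) ?gen"
    using G by (simp add: augmented_filtration_def)
  then show ?thesis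
  proof (induction rule: sigma_sets.induct)
    case (Basic a)
    then consider s A where "a = B s -` A \<inter> space M" "0 \<le> s" "s \<le> u" "A \<in> sets borel" | "a \<in> null_sets M"
      by blast
    then show ?case
    proof cases
      case 1
      have "S m (dyadic_floor m s) \<in> borel_measurable (dyadic_history n i)" for m
      proof (rule S_history)
        have "real (dyadic_floor m s) \<le> 2 ^ m * (real i / 2 ^ n)"
          using dyadic_floor_bounds(1)[OF 1(2), of m] 1(3) u
          by (meson mult_left_mono order_trans zero_le_numeral zero_le_power)
        then have "real (dyadic_floor m s * 2 ^ n) \<le> real (i * 2 ^ m)"
          by (simp add: field_simps)
        then show "dyadic_floor m s * 2 ^ n \<le> i * 2 ^ m" by (simp only: of_nat_le_iff)
      qed
      \<comment> \<open>\<open>B0\<close> and not \<open>B\<close>: the set \<open>Good\<close>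
        depends on the whole path and need not belong to the history.\<close>
      then have "B0 s \<in> borel_measurable (dyadic_history n i)"
        unfolding B0_def by (rule borel_measurable_lim_metric)
      from measurable_sets[OF this 1(4)] have "B0 s -` A \<inter> space M \<in> sets (dyadic_history n i)" by simp
      moreover have "AE \<omega> in M. \<omega> \<in> a \<longleftrightarrow> \<omega> \<in> B0 s -` A \<inter> space M"
        using AE_Good by eventually_elim (simp add: 1(1) B_def)
      moreover have "a \<in> events" using 1 by simp
      ultimately show ?thesis by blast
    next
      case 2
      have "AE \<omega> in M. \<omega> \<in> a \<longleftrightarrow> \<omega> \<in> {}"
        using AE_not_in[OF 2] by simp
      then show ?thesis using 2 by (intro conjI bexI[of _ "{}"]) auto
    qed
  next
    case Empty
    then show ?case by (intro conjI bexI[of _ "{}"]) auto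
  next
    case (Compl a)
    then obtain G' where G': "G' \<in> sets (dyadic_history n i)" "AE \<omega> in M. \<omega> \<in> a \<longleftrightarrow> \<omega> \<in> G'" and "a \<in> events" by auto
    moreover have "AE \<omega> in M. \<omega> \<in> space M - a \<longleftrightarrow> \<omega> \<in> space M - G'"
      using G'(2) by eventually_elim auto
    moreover have "space M - G' \<in> sets (dyadic_history n i)"
      using sets.compl_sets[OF G'(1)] by simp
    ultimately show ?case by blast
  next
    case (Union a)
    then have "\<forall>k. \<exists>G'. G' \<in> sets (dyadic_history n i) \<and> (AE \<omega> in M. \<omega> \<in> a k \<longleftrightarrow> \<omega> \<in> G')" by blast
    then obtain G' where G': "\<And>k. G' k \<in> sets (dyadic_history n i)" "\<And>k. AE \<omega> in M. \<omega> \<in> a k \<longleftrightarrow> \<omega> \<in> G' k"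
      by metis
    have "AE \<omega> in M. \<forall>k. \<omega> \<in> a k \<longleftrightarrow> \<omega> \<in> G' k"
      using G'(2) by (simp add: AE_all_countable)
    then have "AE \<omega> in M. \<omega> \<in> (\<Union>k. a k) \<longleftrightarrow> \<omega> \<in> (\<Union>k. G' k)"
      by eventually_elim simp
    moreover have "(\<Union>k. G' k) \<in> sets (dyadic_history n i)" using G'(1) by auto
    moreover have "(\<Union>k. a k) \<in> events" using Union by auto
    ultimately show ?case by blast
  qed
qed

lemma dyadic_increment_indep:
  assumes G: "G \<in> sets (augmented_filtration M B u)" and u: "u \<le> real i / 2 ^ n" and ij: "i \<le> j"
    and A: "A \<in> sets borel"
  defines "Y \<equiv> \<lambda>\<omega>. S n j \<omega> - S n i \<omega>"
  shows "prob (G \<inter> (Y -` A \<inter> space M)) = prob G * prob (Y -` A \<inter> space M)"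
proof -
  have [measurable]: "Y \<in> borel_measurable M" unfolding Y_def by simp
  obtain G' where G': "G' \<in> sets (dyadic_history n i)" "AE \<omega> in M. \<omega> \<in> G \<longleftrightarrow> \<omega> \<in> G'" and [measurable]: "G \<in> events"
    using augmented_filtration_history[OF G u] by auto
  have [measurable]: "G' \<in> events" using history_events G'(1) by auto
  have "prob (G \<inter> (Y -` A \<inter> space M)) = prob (G' \<inter> (Y -` A \<inter> space M))"
    by (rule finite_measure_eq_AE) (use G'(2) A in auto)
  moreover have "prob G = prob G'"
    by (rule finite_measure_eq_AE) (use G'(2) in auto)
  ultimately show ?thesis using S_increment_indep[OF G'(1) ij A] by (simp add: Y_def)
qed

end

section \<open>The augmented filtration and the increments in continuous time\<close>

context gaussian_family
begin

abbreviation "\<F> \<equiv> augmented_filtration M B"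

lemma sets_augmented: "sets (\<F> t) = sigma_sets (space M)
    ({B s -` A \<inter> space M | s A. 0 \<le> s \<and> s \<le> t \<and> A \<in> sets borel} \<union> null_sets M)"
  and space_augmented [simp]: "space (\<F> t) = space M"
proof -
  have "{B s -` A \<inter> space M | s A. 0 \<le> s \<and> s \<le> t \<and> A \<in> sets borel} \<union> null_sets M \<subseteq> Pow (space M)"
    using sets.sets_into_space by (auto simp: null_sets_def)
  then show "sets (\<F> t) = sigma_sets (space M)
    ({B s -` A \<inter> space M | s A. 0 \<le> s \<and> s \<le> t \<and> A \<in> sets borel} \<union> null_sets M)" "space (\<F> t) = space M"
    by (auto simp: augmented_filtration_def)
qed

lemma augmented_events: "sets (\<F> t) \<subseteq> events"
  unfolding sets_augmented by (intro sets.sigma_sets_subset) auto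

lemma augmented_complete_filtered: "complete_filtered_prob_space M \<F>"
proof unfold_locales
  show "subalgebra M (\<F> t)" for t
    unfolding subalgebra_def using augmented_events[of t] by simp
  show "sets (\<F> s) \<subseteq> sets (\<F> t)" if "s \<le> t" for s t
    unfolding sets_augmented
  proof (intro sigma_sets_mono' Un_mono subset_refl subsetI)
    fix a assume "a \<in> {B r -` A \<inter> space M | r A. 0 \<le> r \<and> r \<le> s \<and> A \<in> sets borel}"
    then obtain r A where "a = B r -` A \<inter> space M" "0 \<le> r" "r \<le> s" "A \<in> sets borel" by blast
    then show "a \<in> {B r -` A \<inter> space M | r A. 0 \<le> r \<and> r \<le> t \<and> A \<in> sets borel}"
      using that by (intro CollectI exI[of _ r] exI[of _ A]) auto
  qed
  show "null_sets M \<subseteq> sets (\<F> 0)"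
    unfolding sets_augmented by auto
qed

sublocale filtered: complete_filtered_prob_space M \<F>
  by (rule augmented_complete_filtered)

lemma B_adapted: "0 \<le> s \<Longrightarrow> s \<le> t \<Longrightarrow> B s \<in> borel_measurable (\<F> t)"
  by (rule measurableI) (auto simp: sets_augmented intro!: sigma_sets.Basic exI[of _ s])

text \<open>Rounding up puts the start of the approximating increment in the future of u, as
  \<open>dyadic_increment_indep\<close> requires.\<close>

definition dyadic_ceiling :: "nat \<Rightarrow> real \<Rightarrow> nat" where
  "dyadic_ceiling n t = nat \<lceil>2 ^ n * t\<rceil>"

lemma dyadic_ceiling_bounds:
  assumes "0 \<le> t"
  shows "t \<le> real (dyadic_ceiling n t) / 2 ^ n" "real (dyadic_ceiling n t) / 2 ^ n < t + 1 / 2 ^ n"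
proof -
  have "2 ^ n * t \<le> real (dyadic_ceiling n t)" "real (dyadic_ceiling n t) < 2 ^ n * t + 1"
    using assms by (auto simp: dyadic_ceiling_def) (smt (verit) ceiling_correct mult_nonneg_nonneg zero_le_power of_int_ceiling_le_add_one)+
  then show "t \<le> real (dyadic_ceiling n t) / 2 ^ n" "real (dyadic_ceiling n t) / 2 ^ n < t + 1 / 2 ^ n"
    by (simp_all add: field_simps)
qed

lemma half_power_tendsto_0: "(\<lambda>n. 1 / 2 ^ n :: real) \<longlonglongrightarrow> 0"
  using LIMSEQ_realpow_zero[of "1 / 2 :: real"] by (simp add: power_divide)

lemma dyadic_ceiling_tendsto:
  assumes "0 \<le> t"
  shows "(\<lambda>n. real (dyadic_ceiling n t) / 2 ^ n) \<longlonglongrightarrow> t"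
proof (rule tendsto_sandwich[of "\<lambda>_. t" _ _ "\<lambda>n. t + 1 / 2 ^ n"])
  show "(\<lambda>n. t + 1 / 2 ^ n) \<longlonglongrightarrow> t"
    using tendsto_add[OF tendsto_const[of t] half_power_tendsto_0] by simp
qed (use dyadic_ceiling_bounds[OF assms] in \<open>auto intro!: always_eventually less_imp_le\<close>)

lemma B_dyadic_tendsto:
  assumes "\<omega> \<in> Good" "0 \<le> t"
  shows "(\<lambda>n. S n (dyadic_ceiling n t) \<omega>) \<longlonglongrightarrow> B t \<omega>"
proof -
  have "(\<lambda>n. B (real (dyadic_ceiling n t) / 2 ^ n) \<omega>) \<longlonglongrightarrow> B t \<omega>"
    using continuous_on_tendsto_compose[OF B_continuous[of \<omega>] dyadic_ceiling_tendsto[OF assms(2)]] assms(2)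
    by simp
  then show ?thesis by (simp add: B_dyadic[OF assms(1)])
qed

text \<open>One limit settles law and independence together: conditioning on G does not change the
  laws of the dyadic increments, hence not that of their limit. Taking G to be the whole space gives
  the law, arbitrary G the independence of the past.\<close>

lemma uniform_increment_law:
  assumes uv: "0 \<le> u" "u < v" and G: "G \<in> sets (\<F> u)" "prob G \<noteq> 0"
  shows "distr (uniform_measure M G) borel (\<lambda>\<omega>. B v \<omega> - B u \<omega>) = density lborel (normal_density 0 (sqrt (v - u)))"
proof -
  have Gev [measurable]: "G \<in> events" using G augmented_events by auto
  have Gp: "emeasure M G \<noteq> 0" "emeasure M G \<noteq> \<infinity>"
    using G(2) by (auto simp: emeasure_eq_measure)
  define Q where "Q = uniform_measure M G"
  interpret Q: prob_space Q unfolding Q_def by (rule prob_space_uniform_measure) (use Gp in auto)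
  have sQ [measurable_cong, simp]: "sets Q = events" and spQ [simp]: "space Q = space M" by (simp_all add: Q_def)
  define Y where "Y n \<omega> = S n (dyadic_ceiling n v) \<omega> - S n (dyadic_ceiling n u) \<omega>" for n \<omega>
  define D where "D \<omega> = B v \<omega> - B u \<omega>" for \<omega>
  define \<sigma>2 where "\<sigma>2 n = real (dyadic_ceiling n v - dyadic_ceiling n u) / 2 ^ n" for n
  have [measurable]: "Y n \<in> borel_measurable M" "D \<in> borel_measurable M" for n
    by (auto simp: Y_def[abs_def] D_def[abs_def])
  have le: "dyadic_ceiling n u \<le> dyadic_ceiling n v" for n
    unfolding dyadic_ceiling_def using uv by (intro nat_mono ceiling_mono) simp
  have "\<forall>\<^sub>F n in sequentially. 1 / 2 ^ n < v - u"
    using uv by (intro order_tendstoD(2)[OF half_power_tendsto_0]) simp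
  then have lt: "\<forall>\<^sub>F n in sequentially. dyadic_ceiling n u < dyadic_ceiling n v"
  proof eventually_elim
    case (elim n)
    then have "real (dyadic_ceiling n u) / 2 ^ n < real (dyadic_ceiling n v) / 2 ^ n"
      using dyadic_ceiling_bounds[of u n] dyadic_ceiling_bounds[of v n] uv by linarith
    then show ?case by (simp add: divide_less_cancel)
  qed
  have YQ: "distr Q borel (Y n) = distr M borel (Y n)" for n
  proof (rule measure_eqI)
    fix A assume "A \<in> sets (distr Q borel (Y n))"
    then have A [measurable]: "A \<in> sets borel" by simp
    have "prob (G \<inter> (Y n -` A \<inter> space M)) = prob G * prob (Y n -` A \<inter> space M)"
      unfolding Y_def by (rule dyadic_increment_indep[OF G(1) _ le A]) (rule dyadic_ceiling_bounds[OF uv(1)])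
    then have "measure Q (Y n -` A \<inter> space M) = prob (Y n -` A \<inter> space M)"
      unfolding Q_def using G(2) by (subst measure_uniform_measure) (use Gp in auto)
    then show "emeasure (distr Q borel (Y n)) A = emeasure (distr M borel (Y n)) A"
      by (simp add: emeasure_distr Q.emeasure_eq_measure emeasure_eq_measure)
  qed simp
  have chY: "\<forall>\<^sub>F n in sequentially. char (distr Q borel (Y n)) t = exp (- (\<sigma>2 n * t\<^sup>2 / 2))" for t
    using lt
  proof eventually_elim
    case (elim n)
    have "distr M borel (Y n) = density lborel (normal_density 0 (sqrt (\<sigma>2 n)))"
      using S_increment_normal[OF elim, of n] by (simp add: distributed_def Y_def[abs_def] \<sigma>2_def cong: distr_cong)
    then show ?case
      using elim char_normal[of "sqrt (\<sigma>2 n)" t] by (simp add: YQ \<sigma>2_def)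
  qed
  have s2: "\<sigma>2 \<longlonglongrightarrow> v - u"
  proof -
    have "\<sigma>2 = (\<lambda>n. real (dyadic_ceiling n v) / 2 ^ n - real (dyadic_ceiling n u) / 2 ^ n)"
      using le by (simp add: \<sigma>2_def fun_eq_iff of_nat_diff diff_divide_distrib)
    then show ?thesis
      using tendsto_diff[OF dyadic_ceiling_tendsto[of v] dyadic_ceiling_tendsto[of u]] uv by simp
  qed
  have YD: "AE \<omega> in Q. (\<lambda>n. Y n \<omega>) \<longlonglongrightarrow> D \<omega>"
    unfolding Q_def
  proof (rule AE_uniform_measureI[OF Gev])
    show "AE \<omega> in M. \<omega> \<in> G \<longrightarrow> (\<lambda>n. Y n \<omega>) \<longlonglongrightarrow> D \<omega>"
      using AE_Good
      by eventually_elim (use uv in \<open>auto simp: Y_def D_def intro!: tendsto_diff B_dyadic_tendsto\<close>)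
  qed
  have "char (distr Q borel D) t = char (density lborel (normal_density 0 (sqrt (v - u)))) t" for t
  proof (rule LIMSEQ_unique)
    have "(\<lambda>n. CLINT \<omega>|Q. iexp (t * Y n \<omega>)) \<longlonglongrightarrow> (CLINT \<omega>|Q. iexp (t * D \<omega>))"
    proof (rule integral_dominated_convergence[where w="\<lambda>_. 1"])
      show "AE \<omega> in Q. (\<lambda>n. iexp (t * Y n \<omega>)) \<longlonglongrightarrow> iexp (t * D \<omega>)"
        using YD by eventually_elim (auto intro!: tendsto_intros)
    qed auto
    then show "(\<lambda>n. char (distr Q borel (Y n)) t) \<longlonglongrightarrow> char (distr Q borel D) t"
      unfolding char_def by (simp add: integral_distr)
    have "(\<lambda>n. complex_of_real (exp (- (\<sigma>2 n * t\<^sup>2 / 2)))) \<longlonglongrightarrow> exp (- ((v - u) * t\<^sup>2 / 2))"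
      by (intro tendsto_intros s2) auto
    then have "(\<lambda>n. char (distr Q borel (Y n)) t) \<longlonglongrightarrow> exp (- ((v - u) * t\<^sup>2 / 2))"
      by (rule Lim_transform_eventually) (use chY[of t] in eventually_elim, simp)
    then show "(\<lambda>n. char (distr Q borel (Y n)) t) \<longlonglongrightarrow> char (density lborel (normal_density 0 (sqrt (v - u)))) t"
      using uv by (simp add: char_normal)
  qed
  then have "distr Q borel D = density lborel (normal_density 0 (sqrt (v - u)))"
  proof (intro Levy_uniqueness ext)
    show "real_distribution (distr Q borel D)"
      by (rule Q.real_distribution_distr) measurable
    show "real_distribution (density lborel (normal_density 0 (sqrt (v - u))))"
      using prob_space_normal_density[of "sqrt (v - u)" 0] uv
      by (simp add: real_distribution_def real_distribution_axioms_def)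
  qed
  then show ?thesis by (simp add: Q_def D_def[abs_def])
qed

lemma increment_law:
  assumes uv: "0 \<le> u" "u < v" and G: "G \<in> sets (\<F> u)" and A: "A \<in> sets borel"
  shows "prob (G \<inter> ((\<lambda>\<omega>. B v \<omega> - B u \<omega>) -` A \<inter> space M))
    = prob G * measure (density lborel (normal_density 0 (sqrt (v - u)))) A"
proof (cases "prob G = 0")
  case True
  have "prob (G \<inter> ((\<lambda>\<omega>. B v \<omega> - B u \<omega>) -` A \<inter> space M)) \<le> prob G"
    using G augmented_events by (intro finite_measure_mono) auto
  then show ?thesis using True by (simp add: measure_le_0_iff)
next
  case False
  have [measurable]: "G \<in> events" "A \<in> sets borel" using G A augmented_events by auto
  have "measure (density lborel (normal_density 0 (sqrt (v - u)))) A
    = measure (distr (uniform_measure M G) borel (\<lambda>\<omega>. B v \<omega> - B u \<omega>)) A"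
    by (simp add: uniform_increment_law[OF uv G False])
  also have "\<dots> = measure (uniform_measure M G) ((\<lambda>\<omega>. B v \<omega> - B u \<omega>) -` A \<inter> space M)"
    by (subst measure_distr) auto
  also have "\<dots> = prob (G \<inter> ((\<lambda>\<omega>. B v \<omega> - B u \<omega>) -` A \<inter> space M)) / prob G"
    using False by (subst measure_uniform_measure) (auto simp: emeasure_eq_measure)
  finally show ?thesis using False by (simp add: field_simps)
qed

lemma increment_distributed:
  assumes "0 \<le> u" "u < v"
  shows "distributed M lborel (\<lambda>\<omega>. B v \<omega> - B u \<omega>) (normal_density 0 (sqrt (v - u)))"
proof -
  have "distr M borel (\<lambda>\<omega>. B v \<omega> - B u \<omega>) = density lborel (normal_density 0 (sqrt (v - u)))"
  proof (rule measure_eqI)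
    fix A assume "A \<in> sets (distr M borel (\<lambda>\<omega>. B v \<omega> - B u \<omega>))"
    then have A: "A \<in> sets borel" by simp
    interpret N: prob_space "density lborel (normal_density 0 (sqrt (v - u)))"
      by (rule prob_space_normal_density) (use assms in simp)
    have "prob ((\<lambda>\<omega>. B v \<omega> - B u \<omega>) -` A \<inter> space M) = measure (density lborel (normal_density 0 (sqrt (v - u)))) A"
      using increment_law[OF assms sets.top[of "\<F> u"] A] by (simp add: prob_space Int_absorb1)
    then show "emeasure (distr M borel (\<lambda>\<omega>. B v \<omega> - B u \<omega>)) A = emeasure (density lborel (normal_density 0 (sqrt (v - u)))) A"
      using A by (simp add: emeasure_distr emeasure_eq_measure N.emeasure_eq_measure)
  qed simp
  then show ?thesis
    by (simp add: distributed_def cong: distr_cong)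
qed

lemma increment_indep:
  assumes uv: "0 \<le> u" "u \<le> v" and G: "G \<in> sets (\<F> u)" and A: "A \<in> sets borel"
  shows "prob (G \<inter> ((\<lambda>\<omega>. B v \<omega> - B u \<omega>) -` A \<inter> space M))
    = prob G * prob ((\<lambda>\<omega>. B v \<omega> - B u \<omega>) -` A \<inter> space M)"
proof (cases "u = v")
  case True
  have "(\<lambda>\<omega>. B v \<omega> - B u \<omega>) -` A \<inter> space M = (if 0 \<in> A then space M else {})"
    by (auto simp: True)
  then show ?thesis
    using G augmented_events[of u] sets.sets_into_space[of G M] by (auto simp: prob_space Int_absorb2)
next
  case False
  then have uv': "u < v" using uv by simp
  show ?thesis
    using increment_law[OF uv(1) uv' G A] increment_law[OF uv(1) uv' sets.top[of "\<F> u"] A]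
    by (simp add: prob_space Int_absorb1)
qed

lemma B_brownian: "brownian_motion M B"
  unfolding brownian_motion_def
proof (intro conjI allI impI ballI)
  show "prob_space M" by (rule prob_space_axioms)
  show "AE \<omega> in M. B 0 \<omega> = 0" by (simp add: B_0)
  fix n :: nat and u :: "nat \<Rightarrow> real" assume u: "0 \<le> u 0 \<and> (\<forall>i<n. u i \<le> u (Suc i))"
  define D where "D i \<omega> = B (u (Suc i)) \<omega> - B (u i) \<omega>" for i \<omega>
  have mono: "u i \<le> u j" if "i \<le> j" "j \<le> n" for i j
    using that
  proof (induction j rule: dec_induct)
    case (step j)
    then show ?case using u by (meson Suc_le_lessD Suc_leD order_trans)
  qed simp
  have u0: "0 \<le> u i" if "i \<le> n" for i using mono[of 0 i] u that by simp
  have [measurable]: "D i \<in> borel_measurable M" for i by (simp add: D_def[abs_def])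
  \<comment> \<open>Events of the first k increments lie in \<open>\<F> (u k)\<close>, so the next
    increment factors off. The intersection with \<open>space M\<close> matters at k = 0, where the
    empty intersection is the whole type.\<close>
  have prod: "(\<Inter>i<k. D i -` A i \<inter> space M) \<inter> space M \<in> sets (\<F> (u k)) \<and>
      prob ((\<Inter>i<k. D i -` A i \<inter> space M) \<inter> space M) = (\<Prod>i<k. prob (D i -` A i \<inter> space M))"
    if "k \<le> n" "\<And>i. A i \<in> sets borel" for k A
    using that
  proof (induction k)
    case 0
    then show ?case using sets.top[of "\<F> (u 0)"] by (simp add: prob_space)
  next
    case (Suc k)
    let ?G = "(\<Inter>i<k. D i -` A i \<inter> space M) \<inter> space M"
    have k: "0 \<le> u k" "u k \<le> u (Suc k)" using u0[of k] mono[of k "Suc k"] Suc.prems by auto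
    have G: "?G \<in> sets (\<F> (u k))" "prob ?G = (\<Prod>i<k. prob (D i -` A i \<inter> space M))"
      using Suc by auto
    have eq: "(\<Inter>i<Suc k. D i -` A i \<inter> space M) \<inter> space M = ?G \<inter> (D k -` A k \<inter> space M)"
      by (auto simp: lessThan_Suc)
    have "D k \<in> borel_measurable (\<F> (u (Suc k)))"
      unfolding D_def[abs_def] using k by (intro borel_measurable_diff B_adapted) auto
    then have Dk: "D k -` A k \<inter> space M \<in> sets (\<F> (u (Suc k)))"
      using measurable_sets[of "D k" "\<F> (u (Suc k))" borel "A k"] Suc.prems by simp
    have "?G \<in> sets (\<F> (u (Suc k)))" by (rule subsetD[OF filtered.mono[OF k] G(1)])
    then have "?G \<inter> (D k -` A k \<inter> space M) \<in> sets (\<F> (u (Suc k)))" by (rule sets.Int[OF _ Dk])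
    moreover have "prob (?G \<inter> (D k -` A k \<inter> space M)) = prob ?G * prob (D k -` A k \<inter> space M)"
    proof -
      have "(\<lambda>\<omega>. B (u (Suc k)) \<omega> - B (u k) \<omega>) = D k" by (simp add: D_def[abs_def])
      from increment_indep[OF k G(1) Suc.prems(2), unfolded this] show ?thesis .
    qed
    ultimately show ?case unfolding eq G(2) by (simp only: prod.lessThan_Suc simp_thms)
  qed
  show "indep_vars (\<lambda>_. borel) (\<lambda>i \<omega>. B (u (Suc i)) \<omega> - B (u i) \<omega>) {..<n}"
    unfolding D_def[symmetric] indep_vars_def2
  proof (intro conjI ballI indep_setsI)
    fix A J assume J: "J \<noteq> {}" "J \<subseteq> {..<n}" "finite J"
      and "\<forall>j\<in>J. A j \<in> {D j -` A \<inter> space M |A. A \<in> sets borel}"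
    then have "\<forall>j\<in>J. \<exists>C. C \<in> sets borel \<and> A j = D j -` C \<inter> space M" by auto
    then obtain C where C: "\<And>j. j \<in> J \<Longrightarrow> C j \<in> sets borel \<and> A j = D j -` C j \<inter> space M"
      by metis
    \<comment> \<open>Padding with the whole line turns an arbitrary J into the full prefix of
      length n; the added factors are 1.\<close>
    define C' where "C' j = (if j \<in> J then C j else UNIV)" for j
    have C': "C' j \<in> sets borel" for j using C by (auto simp: C'_def)
    have "(\<Inter>j\<in>J. A j) = (\<Inter>i<n. D i -` C' i \<inter> space M) \<inter> space M"
    proof (intro set_eqI iffI)
      fix \<omega> assume \<omega>: "\<omega> \<in> (\<Inter>j\<in>J. A j)"
      have D: "D j \<omega> \<in> C j \<and> \<omega> \<in> space M" if "j \<in> J" for j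
      proof -
        have "\<omega> \<in> A j" by (rule INT_D[OF \<omega> that])
        then show ?thesis using C[OF that] by simp
      qed
      then have sp: "\<omega> \<in> space M" using J(1) by blast
      have "D i \<omega> \<in> C' i" for i using D[of i] by (simp add: C'_def)
      then show "\<omega> \<in> (\<Inter>i<n. D i -` C' i \<inter> space M) \<inter> space M" using sp by simp
    next
      fix \<omega> assume \<omega>: "\<omega> \<in> (\<Inter>i<n. D i -` C' i \<inter> space M) \<inter> space M"
      show "\<omega> \<in> (\<Inter>j\<in>J. A j)"
      proof
        fix j assume j: "j \<in> J"
        then have "j \<in> {..<n}" using J(2) by blast
        then have "\<omega> \<in> D j -` C' j \<inter> space M" by (rule INT_D[OF IntD1[OF \<omega>]])
        then show "\<omega> \<in> A j" using C[OF j] j by (simp add: C'_def)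
      qed
    qed
    then have "prob (\<Inter>j\<in>J. A j) = (\<Prod>i<n. prob (D i -` C' i \<inter> space M))"
      by (simp only: conjunct2[OF prod[OF order_refl C']])
    also have "\<dots> = (\<Prod>j\<in>J. prob (D j -` C' j \<inter> space M))"
      by (rule prod.mono_neutral_right) (use J in \<open>auto simp: C'_def prob_space\<close>)
    also have "\<dots> = (\<Prod>j\<in>J. prob (A j))"
      by (rule prod.cong) (use C in \<open>auto simp: C'_def\<close>)
    finally show "prob (\<Inter>j\<in>J. A j) = (\<Prod>j\<in>J. prob (A j))" .
  qed (auto simp: D_def[abs_def])
qed (auto simp: increment_distributed B_continuous)

lemma increment_indep_var:
  assumes uv: "0 \<le> u" "u \<le> v" and f: "f \<in> borel_measurable (\<F> u)"
  shows "indep_var borel f borel (\<lambda>\<omega>. B v \<omega> - B u \<omega>)"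
proof -
  let ?D = "\<lambda>\<omega>. B v \<omega> - B u \<omega>"
  have [measurable]: "f \<in> borel_measurable M" using filtered.measurable_F_M[OF uv(1) f] .
  have st: "Int_stable {g -` A \<inter> space M | A. A \<in> sets borel}" for g :: "'a \<Rightarrow> real"
  proof (rule Int_stableI)
    fix a b assume "a \<in> {g -` A \<inter> space M | A. A \<in> sets borel}" "b \<in> {g -` A \<inter> space M | A. A \<in> sets borel}"
    then obtain A A' where "a = g -` A \<inter> space M" "b = g -` A' \<inter> space M" "A \<in> sets borel" "A' \<in> sets borel"
      by auto
    then show "a \<inter> b \<in> {g -` A \<inter> space M | A. A \<in> sets borel}"
      by (intro CollectI exI[of _ "A \<inter> A'"]) auto
  qed
  have "indep_set {f -` A \<inter> space M | A. A \<in> sets borel} {?D -` A \<inter> space M | A. A \<in> sets borel}"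
  proof (rule indep_setI)
    fix a b assume "a \<in> {f -` A \<inter> space M | A. A \<in> sets borel}" "b \<in> {?D -` A \<inter> space M | A. A \<in> sets borel}"
    then obtain A A' where a: "a = f -` A \<inter> space M" "b = ?D -` A' \<inter> space M" "A \<in> sets borel" "A' \<in> sets borel"
      by auto
    then have "a \<in> sets (\<F> u)" using measurable_sets[OF f a(3)] by simp
    then show "prob (a \<inter> b) = prob a * prob b" unfolding a(2) by (rule increment_indep[OF uv _ a(4)])
  qed auto
  then show ?thesis
    unfolding indep_var_eq by (intro conjI indep_set_sigma_sets st) auto
qed

lemma increment_integrable: "0 \<le> u \<Longrightarrow> u \<le> v \<Longrightarrow> integrable M (\<lambda>\<omega>. B v \<omega> - B u \<omega>)"
  and increment_mean: "0 \<le> u \<Longrightarrow> u \<le> v \<Longrightarrow> (\<integral>\<omega>. B v \<omega> - B u \<omega> \<partial>M) = 0"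
proof -
  assume uv: "0 \<le> u" "u \<le> v"
  have "integrable M (\<lambda>\<omega>. B v \<omega> - B u \<omega>) \<and> (\<integral>\<omega>. B v \<omega> - B u \<omega> \<partial>M) = 0"
  proof (cases "u = v")
    case False
    then have d: "distributed M lborel (\<lambda>\<omega>. B v \<omega> - B u \<omega>) (normal_density 0 (sqrt (v - u)))" and s: "0 < sqrt (v - u)"
      using increment_distributed[of u v] uv by auto
    show ?thesis
      using distributed_integrable[OF d, of "\<lambda>x. x"] normal_distributed_expectation[OF s d]
        integrable_normal_moment_nz_1[OF s, of 0] by simp
  qed simp
  then show "integrable M (\<lambda>\<omega>. B v \<omega> - B u \<omega>)" "(\<integral>\<omega>. B v \<omega> - B u \<omega> \<partial>M) = 0" by auto
qed

lemma B_integrable: "0 \<le> t \<Longrightarrow> integrable M (B t)"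
  using increment_integrable[of 0 t] by (simp add: B_0)

lemma weighted_increment:
  assumes uv: "0 \<le> u" "u \<le> v" and f: "f \<in> borel_measurable (\<F> u)" "integrable M f"
  shows "integrable M (\<lambda>\<omega>. f \<omega> * (B v \<omega> - B u \<omega>))" "(\<integral>\<omega>. f \<omega> * (B v \<omega> - B u \<omega>) \<partial>M) = 0"
  using indep_var_integrable[OF increment_indep_var[OF uv f(1)] f(2) increment_integrable[OF uv]]
    indep_var_lebesgue_integral[OF increment_indep_var[OF uv f(1)] f(2) increment_integrable[OF uv]]
    increment_mean[OF uv] by auto

lemma increment_fourth:
  assumes uv: "0 \<le> u" "u < v"
  shows "integrable M (\<lambda>\<omega>. (B v \<omega> - B u \<omega>) ^ 4)" "(\<integral>\<omega>. (B v \<omega> - B u \<omega>) ^ 4 \<partial>M) = 3 * (v - u)\<^sup>2"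
proof -
  let ?s = "sqrt (v - u)"
  have s: "0 < ?s" using uv by simp
  have X: "std_normal (\<lambda>\<omega>. (B v \<omega> - B u \<omega>) / ?s)"
    using increment_distributed[OF uv] normal_standard_normal_convert[OF s, of "\<lambda>\<omega>. B v \<omega> - B u \<omega>" 0] by simp
  have "?s ^ 4 = (?s ^ 2) ^ 2" by simp
  then have s4: "?s ^ 4 = (v - u)\<^sup>2" using uv by simp
  have eq: "(B v \<omega> - B u \<omega>) ^ 4 = (v - u)\<^sup>2 * ((B v \<omega> - B u \<omega>) / ?s) ^ 4" for \<omega>
    using uv by (simp add: power_divide s4)
  show "integrable M (\<lambda>\<omega>. (B v \<omega> - B u \<omega>) ^ 4)"
    unfolding eq using std_normal_fourth_integrable[OF X] by simp
  show "(\<integral>\<omega>. (B v \<omega> - B u \<omega>) ^ 4 \<partial>M) = 3 * (v - u)\<^sup>2"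
    unfolding eq using std_normal_fourth_moment[OF X] by simp
qed

end

section \<open>Sharpness of the constant\<close>

text \<open>By \<open>tail_diff_le_powr_diff\<close> with weight 1, differences of
  \<open>tail p\<close> are at most those of the power y^p, divided by p.\<close>

lemma tail_continuous:
  assumes p: "0 < p" "p < 1" and r: "0 < r"
  shows "isCont (tail p) r"
proof -
  have *: "\<bar>tail p y - tail p r\<bar> \<le> \<bar>y powr p - r powr p\<bar> / p" if "0 < y" for y
  proof (cases "y \<le> r")
    case True
    then show ?thesis
      using tail_diff_le_powr_diff[OF p that True, of 1] tail_antimono[OF p(2) that True] p that
      by (simp add: field_simps)
  next
    case False
    then show ?thesis
      using tail_diff_le_powr_diff[OF p r, of y 1] tail_antimono[OF p(2) r, of y] p r
      by (simp add: field_simps)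
  qed
  have "((\<lambda>y. \<bar>y powr p - r powr p\<bar> / p) \<longlongrightarrow> \<bar>r powr p - r powr p\<bar> / p) (at r)"
    using r p by (intro tendsto_intros) auto
  then have "((\<lambda>y. \<bar>y powr p - r powr p\<bar> / p) \<longlongrightarrow> 0) (at r)" by simp
  moreover have "\<forall>\<^sub>F y in at r. norm (tail p y - tail p r) \<le> \<bar>y powr p - r powr p\<bar> / p"
    using order_tendstoD(1)[OF tendsto_ident_at r] by eventually_elim (use * in simp)
  ultimately have "((\<lambda>y. tail p y - tail p r) \<longlongrightarrow> 0) (at r)"
    by (rule Lim_null_comparison[rotated])
  then show ?thesis by (simp add: isCont_def LIM_zero_iff)
qed

text \<open>A near-optimal strategy: as long as \<open>M < \<theta> m\<close> the process runs freely; once \<open>M \<ge> \<theta> m\<close> it is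
  stopped when it comes back close to its minimum \<open>-m\<close>. The cut-offs \<open>\<rho>\<close> and \<open>N\<close> bound the
  running process, and \<open>\<delta>\<close> is an upper bound for the increments that cause no error.\<close>

locale strategy =
  fixes p \<kappa> \<theta> \<rho> \<delta> N d :: real
  assumes p: "0 < p" "p < 1" and \<kappa>: "0 \<le> \<kappa>" and \<theta>: "0 < \<theta>" "p < 1 / (1 + \<theta>)"
    and \<delta>: "0 < \<delta>" "\<delta> < 1" and \<rho>: "\<theta> + 1 < \<rho>" and N: "1 < N" and d: "0 < d"
    and exit_large: "d + \<kappa> \<le> d * N powr (1 / (1 + \<theta>) - p)"
    and switch: "d + \<delta> * d * N powr (1 / (1 + \<theta>) - p)
      \<le> \<theta> powr p - \<kappa> + (\<theta> + 1 - \<delta>) * (p * (tail p (\<theta> + \<delta>) - tail p \<rho>))"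

text \<open>The order of choice matters: \<theta> close below \<open>cutoff p\<close> makes the
  payoff of a switch positive, \<rho> truncates the second phase without losing this, d is half of
  the payoff, N is large enough for \<open>exit_large\<close>, and \<delta>, which
  \<open>switch\<close> multiplies by a power of N, comes last.\<close>

lemma strategy_exists:
  assumes p: "0 < p" "p < 1" and \<kappa>: "0 \<le> \<kappa>" "\<kappa> < ratio_const p"
  shows "\<exists>\<theta> \<rho> \<delta> N d. strategy p \<kappa> \<theta> \<rho> \<delta> N d"
proof -
  let ?c = "cutoff p"
  have c: "0 < ?c" by (rule cutoff_pos[OF p])
  have c1: "(1 + ?c) * p = 1" using p by (simp add: cutoff_def)
  have "((\<lambda>\<theta>. \<theta> powr p - \<kappa> + (1 + \<theta>) * (p * tail p \<theta>)) \<longlongrightarrow> ?c powr p - \<kappa> + (1 + ?c) * (p * tail p ?c)) (at_left ?c)"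
    using c p tail_continuous[OF p c, unfolded isCont_def]
    by (intro tendsto_intros) (auto intro: filterlim_mono[OF _ order_refl at_le] simp: tendsto_mono[OF at_le[OF subset_UNIV]])
  \<comment> \<open>As (1 + \<open>cutoff p\<close>) * p = 1, the payoff of switching at the cutoff
    is exactly the gap between C and \<kappa>.\<close>
  moreover have "?c powr p - \<kappa> + (1 + ?c) * (p * tail p ?c) = ratio_const p - \<kappa>"
    using c1 by (simp add: ratio_const_def mult.assoc[symmetric])
  ultimately have "\<forall>\<^sub>F \<theta> in at_left ?c. 0 < \<theta> powr p - \<kappa> + (1 + \<theta>) * (p * tail p \<theta>)"
    using \<kappa> by (intro order_tendstoD(1)) auto
  moreover have "\<forall>\<^sub>F \<theta> in at_left ?c. 0 < \<theta>"
    using c by (intro order_tendstoD(1)[OF tendsto_ident_at]) auto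
  moreover have "\<forall>\<^sub>F \<theta> in at_left ?c. \<theta> < ?c"
    by (simp add: eventually_at_filter)
  ultimately have "\<forall>\<^sub>F \<theta> in at_left ?c. 0 < \<theta> powr p - \<kappa> + (1 + \<theta>) * (p * tail p \<theta>) \<and> 0 < \<theta> \<and> \<theta> < ?c"
    by eventually_elim simp
  from eventually_happens[OF this] obtain \<theta> where
    th: "0 < \<theta> powr p - \<kappa> + (1 + \<theta>) * (p * tail p \<theta>)" "0 < \<theta>" "\<theta> < ?c"
    by auto
  \<comment> \<open>This restates \<theta> < \<open>cutoff p\<close>; it makes the exponent of N in
    \<open>exit_large\<close> positive.\<close>
  have al: "p < 1 / (1 + \<theta>)"
    using th p by (simp add: cutoff_def field_simps)
  have "((\<lambda>\<rho>. \<theta> powr p - \<kappa> + (1 + \<theta>) * (p * (tail p \<theta> - tail p \<rho>))) \<longlongrightarrow>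
      \<theta> powr p - \<kappa> + (1 + \<theta>) * (p * (tail p \<theta> - 0))) at_top"
    by (intro tendsto_intros tail_tendsto_0 p)
  then have "\<forall>\<^sub>F \<rho> in at_top. 0 < \<theta> powr p - \<kappa> + (1 + \<theta>) * (p * (tail p \<theta> - tail p \<rho>))"
    using th by (intro order_tendstoD(1)) auto
  then have "\<forall>\<^sub>F \<rho> in at_top. 0 < \<theta> powr p - \<kappa> + (1 + \<theta>) * (p * (tail p \<theta> - tail p \<rho>)) \<and> \<theta> + 1 < \<rho>"
    using eventually_gt_at_top[of "\<theta> + 1"] by eventually_elim simp
  from eventually_happens[OF this] obtain \<rho> where
    rh: "0 < \<theta> powr p - \<kappa> + (1 + \<theta>) * (p * (tail p \<theta> - tail p \<rho>))" "\<theta> + 1 < \<rho>" by auto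
  \<comment> \<open>One half of the payoff is spent on d, the other half absorbs the terms with
    \<delta>.\<close>
  define d where "d = (\<theta> powr p - \<kappa> + (1 + \<theta>) * (p * (tail p \<theta> - tail p \<rho>))) / 2"
  have d: "0 < d" using rh by (simp add: d_def)
  have "filterlim (\<lambda>N. N powr (1 / (1 + \<theta>) - p)) at_top at_top"
    using al by (intro real_powr_at_top) simp
  then have "\<forall>\<^sub>F N in at_top. (d + \<kappa>) / d \<le> N powr (1 / (1 + \<theta>) - p)"
    by (simp add: filterlim_at_top)
  then have "\<forall>\<^sub>F N in at_top. (d + \<kappa>) / d \<le> N powr (1 / (1 + \<theta>) - p) \<and> 1 < N"
    using eventually_gt_at_top[of "1 :: real"] by eventually_elim simp
  from eventually_happens[OF this] obtain N where
    N: "(d + \<kappa>) / d \<le> N powr (1 / (1 + \<theta>) - p)" "1 < N" by auto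
  define E where "E = N powr (1 / (1 + \<theta>) - p)"
  have tc: "((\<lambda>\<delta>. tail p (\<theta> + \<delta>)) \<longlongrightarrow> tail p (\<theta> + 0)) (at_right 0)"
    using tail_continuous[OF p th(2)] by (intro isCont_tendsto_compose[of _ "tail p"] tendsto_intros) auto
  have lim: "((\<lambda>\<delta>. \<theta> powr p - \<kappa> + (\<theta> + 1 - \<delta>) * (p * (tail p (\<theta> + \<delta>) - tail p \<rho>)) - (d + \<delta> * d * E)) \<longlongrightarrow>
     \<theta> powr p - \<kappa> + (\<theta> + 1 - 0) * (p * (tail p (\<theta> + 0) - tail p \<rho>)) - (d + 0 * d * E)) (at_right 0)"
    by (intro tendsto_intros tc)
  have eq: "\<theta> powr p - \<kappa> + (\<theta> + 1 - 0) * (p * (tail p (\<theta> + 0) - tail p \<rho>)) - (d + 0 * d * E) = d"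
  proof -
    have "\<theta> powr p - \<kappa> + (1 + \<theta>) * (p * (tail p \<theta> - tail p \<rho>)) = 2 * d" by (simp add: d_def)
    then show ?thesis by (simp add: add.commute)
  qed
  have "\<forall>\<^sub>F \<delta> in at_right 0. 0 < \<theta> powr p - \<kappa> + (\<theta> + 1 - \<delta>) * (p * (tail p (\<theta> + \<delta>) - tail p \<rho>)) - (d + \<delta> * d * E)"
    by (rule order_tendstoD(1)[OF lim[unfolded eq] d])
  moreover have "\<forall>\<^sub>F \<delta> in at_right (0 :: real). \<delta> < 1"
    by (intro order_tendstoD(2)[OF tendsto_ident_at]) auto
  moreover have "\<forall>\<^sub>F \<delta> in at_right (0 :: real). 0 < \<delta>"
    by (simp add: eventually_at_filter)
  ultimately have "\<forall>\<^sub>F \<delta> in at_right 0. 0 < \<theta> powr p - \<kappa> + (\<theta> + 1 - \<delta>) * (p * (tail p (\<theta> + \<delta>) - tail p \<rho>)) - (d + \<delta> * d * E) \<and> \<delta> < 1 \<and> 0 < \<delta>"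
    by eventually_elim simp
  from eventually_happens[OF this] obtain \<delta> where
    de: "0 < \<theta> powr p - \<kappa> + (\<theta> + 1 - \<delta>) * (p * (tail p (\<theta> + \<delta>) - tail p \<rho>)) - (d + \<delta> * d * E)" "\<delta> < 1" "0 < \<delta>"
    by auto
  have "strategy p \<kappa> \<theta> \<rho> \<delta> N d"
  proof
    show "d + \<kappa> \<le> d * N powr (1 / (1 + \<theta>) - p)"
      using N(1) d by (simp add: pos_divide_le_eq mult.commute)
    show "d + \<delta> * d * N powr (1 / (1 + \<theta>) - p)
      \<le> \<theta> powr p - \<kappa> + (\<theta> + 1 - \<delta>) * (p * (tail p (\<theta> + \<delta>) - tail p \<rho>))"
      using de(1) by (simp add: E_def)
  qed (use p \<kappa> th al de rh N d in auto)
  then show ?thesis by blast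
qed

section \<open>The value function of the strategy and its one-step estimate\<close>

context strategy
begin

text \<open>With this exponent the terms in m^\<alpha> of \<open>V1\<close> cancel at x = \<theta> *
  m and leave d * m^p, the amount that the switch has to cover.\<close>

definition "\<alpha> = 1 / (1 + \<theta>)"

lemma \<alpha>: "p < \<alpha>" "\<alpha> < 1" "0 < \<alpha>" "\<alpha> * (1 + \<theta>) = 1"
  using \<theta> p by (auto simp: \<alpha>_def field_simps)

text \<open>A return in the second phase is registered already \<delta> above -m, so that a step of
  size at most \<delta> from a state of that phase that is not halted cannot set a new
  minimum.\<close>

definition halted :: "real \<Rightarrow> real \<Rightarrow> real \<Rightarrow> bool" where
  "halted x m M \<longleftrightarrow> N \<le> m \<or> (\<theta> * m \<le> M \<and> x \<le> - m + \<delta>) \<or> \<rho> * m \<le> M"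

definition gain :: "real \<Rightarrow> real \<Rightarrow> real" where
  "gain m M = M powr p - \<kappa> * m powr p"

text \<open>The function \<open>V\<close> below is the value of the strategy, except that in the second phase \<open>x + m\<close> is
  lowered to \<open>x + m - \<delta>\<close>; the strict inequality \<open>switch\<close> pays for this when the phase begins, and
  it absorbs the overshoots of steps of size at most \<open>\<delta>\<close>.\<close>

definition rate :: "real \<Rightarrow> real \<Rightarrow> real" where
  "rate m M = (if M < \<theta> * m then \<alpha> * d * m powr (\<alpha> - 1) else p * m powr (p - 1) * (tail p (M / m) - tail p \<rho>))"

definition base :: "real \<Rightarrow> real \<Rightarrow> real" where
  "base m M = (if M < \<theta> * m then d * m powr p - d * m powr \<alpha> + \<alpha> * d * m powr (\<alpha> - 1) * m
     else gain m M + p * m powr (p - 1) * (tail p (M / m) - tail p \<rho>) * (m - \<delta>))"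

definition V :: "real \<Rightarrow> real \<Rightarrow> real \<Rightarrow> real" where
  "V x m M = base m M + rate m M * x"

definition \<Phi> :: "real \<Rightarrow> real \<Rightarrow> real \<Rightarrow> real" where
  "\<Phi> x m M = (if halted x m M then gain m M else V x m M)"

lemma V1: "M < \<theta> * m \<Longrightarrow> V x m M = d * m powr p - d * m powr \<alpha> + \<alpha> * d * m powr (\<alpha> - 1) * (x + m)"
  by (simp add: V_def base_def rate_def algebra_simps)

lemma V2: "\<theta> * m \<le> M \<Longrightarrow> V x m M = gain m M + p * m powr (p - 1) * (tail p (M / m) - tail p \<rho>) * (x + m - \<delta>)"
  by (simp add: V_def base_def rate_def algebra_simps)

lemma rate2_nonneg:
  assumes "1 \<le> m" "\<theta> * m \<le> M" "M \<le> \<rho> * m"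
  shows "0 \<le> p * m powr (p - 1) * (tail p (M / m) - tail p \<rho>)"
proof -
  have "0 < \<theta> * m" using \<theta> assms by simp
  then have "0 < M / m" "M / m \<le> \<rho>" using assms by (auto simp: pos_divide_le_eq)
  then show ?thesis using p tail_antimono[of p "M / m" \<rho>] by simp
qed

text \<open>While the process runs freely and \<open>m\<close> increases, concavity of \<open>m \<mapsto> m\<^sup>\<alpha>\<close> is used.\<close>

lemma phase1_step:
  assumes m: "1 \<le> m" and M: "0 \<le> M" "M < \<theta> * m" and x: "- m \<le> x" and mN: "m < N" and dx: "\<bar>x' - x\<bar> \<le> \<delta>" "x \<le> M"
  shows "V x m M + rate m M * (x' - x) \<le> \<Phi> x' (max m (- x')) (max M x')"
proof -
  let ?r = "\<alpha> * d * m powr (\<alpha> - 1)"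
  have lin: "V x m M + rate m M * (x' - x) = d * m powr p - d * m powr \<alpha> + ?r * (x' + m)"
    using V1[OF M(2), of x] M(2) by (simp add: rate_def algebra_simps)
  show ?thesis
  proof (cases "x' < - m")
    case True
    define m' where "m' = - x'"
    have m': "m < m'" "max m (- x') = m'" "max M x' = M"
      using True M(1) m by (auto simp: m'_def)
    have Mm': "M < \<theta> * m'" using M(2) m'(1) \<theta> by (smt (verit) mult_strict_left_mono)
    have conc: "m' powr \<alpha> - m powr \<alpha> \<le> \<alpha> * m powr (\<alpha> - 1) * (m' - m)"
      using powr_diff_upper[of \<alpha> m m'] \<alpha> m m'(1) by simp
    have "m powr p \<le> m' powr p" using m m'(1) p by (intro powr_mono2) auto
    then have "d * m powr p \<le> d * m' powr p" using d by simp
    moreover have "d * (m' powr \<alpha> - m powr \<alpha>) \<le> d * (\<alpha> * m powr (\<alpha> - 1) * (m' - m))"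
      using conc d by (intro mult_left_mono) auto
    ultimately have 1: "d * m powr p - d * m powr \<alpha> + ?r * (x' + m) \<le> d * m' powr p - d * m' powr \<alpha>"
      by (simp add: m'_def algebra_simps)
    show ?thesis
    proof (cases "N \<le> m'")
      case False
      have mm: "0 < m'" "0 < \<theta> * m'" using m m'(1) \<theta> by auto
      moreover have "\<theta> * m' < \<rho> * m'" using \<rho> mm by simp
      ultimately have "\<not> \<rho> * m' \<le> M" "\<not> \<theta> * m' \<le> M" using Mm' by linarith+
      then have "\<not> halted x' m' M" using False unfolding halted_def by blast
      then have "\<Phi> x' m' M = d * m' powr p - d * m' powr \<alpha>"
        using V1[OF Mm', of x'] by (simp add: \<Phi>_def m'_def)
      then show ?thesis using 1 lin m' by simp
    next
      case True
      then have "\<Phi> x' m' M = gain m' M" by (simp add: \<Phi>_def halted_def)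
      moreover have "- (\<kappa> * m' powr p) \<le> gain m' M" by (simp add: gain_def)
      \<comment> \<open>For a forced exit: from N on, d * m^\<alpha> exceeds (d + \<kappa>) * m^p by
        \<open>exit_large\<close>, which covers the loss \<kappa> * m^p.\<close>
      moreover have "(d + \<kappa>) * m' powr p \<le> d * m' powr \<alpha>"
      proof -
        have "N powr (\<alpha> - p) \<le> m' powr (\<alpha> - p)" using True N \<alpha> by (intro powr_mono2) auto
        then have "d + \<kappa> \<le> d * m' powr (\<alpha> - p)"
          using exit_large d unfolding \<alpha>_def[symmetric] by (smt (verit) mult_left_mono)
        then have "(d + \<kappa>) * m' powr p \<le> d * m' powr (\<alpha> - p) * m' powr p"
          by (intro mult_right_mono) auto
        then show ?thesis by (simp add: powr_add[symmetric] mult.assoc)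
      qed
      ultimately show ?thesis using 1 lin m' by (simp add: distrib_right)
    qed
  next
    case False
    then have m': "max m (- x') = m" by simp
    define M' where "M' = max M x'"
    \<comment> \<open>The switching level is overshot by at most \<delta> * m, as m \<ge> 1; since
      \<theta> + \<delta> < \<rho>, the ratio \<rho> is not reached in the same step.\<close>
    have "x' < \<theta> * m + \<delta>" using dx M(2) by linarith
    also have "\<theta> * m + \<delta> \<le> (\<theta> + \<delta>) * m" using m \<delta> by (simp add: distrib_right)
    finally have x'2: "x' < (\<theta> + \<delta>) * m" .
    also have "\<dots> \<le> \<rho> * m" using m \<rho> \<delta> by (intro mult_right_mono) auto
    finally have x'\<rho>: "x' < \<rho> * m" .
    moreover have "\<theta> * m < \<rho> * m" using m \<rho> by simp
    ultimately have M'\<rho>: "M' < \<rho> * m" using M by (auto simp: M'_def)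
    show ?thesis
    proof (cases "M' < \<theta> * m")
      case True
      then have "\<not> halted x' m M'" using M'\<rho> mN by (auto simp: halted_def)
      then have "\<Phi> x' m M' = d * m powr p - d * m powr \<alpha> + ?r * (x' + m)"
        using V1[OF True, of x'] by (simp add: \<Phi>_def)
      then show ?thesis using lin m' by (simp add: M'_def)
    next
      case False
      then have M': "M' = x'" "\<theta> * m \<le> x'" using M by (auto simp: M'_def)
      have "- m + \<delta> < x'" using M'(2) m \<theta> \<delta> by (smt (verit) mult_nonneg_nonneg)
      then have "\<not> halted x' m M'" using M'\<rho> mN M'(1) by (auto simp: halted_def)
      define r where "r = x' / m"
      have m0: "0 < m" using m by simp
      have r: "\<theta> \<le> r" "r < \<theta> + \<delta>" "x' = r * m"
        using M'(2) x'2 m0 by (auto simp: r_def pos_le_divide_eq pos_divide_less_eq)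
      have mp: "m powr (p - 1) * m = m powr p" "m powr (\<alpha> - 1) * m = m powr \<alpha>"
        using m0 by (simp_all add: powr_diff)
      have ma: "m powr \<alpha> \<le> N powr (\<alpha> - p) * m powr p"
      proof -
        have "m powr (\<alpha> - p) * m powr p \<le> N powr (\<alpha> - p) * m powr p"
          using mN m \<alpha> by (intro mult_right_mono powr_mono2) auto
        then show ?thesis by (simp add: powr_add[symmetric])
      qed
      \<comment> \<open>The effect of the overshoot is \<alpha> * (r - \<theta>). With m^\<alpha>
        \<le> N^(\<alpha> - p) * m^p it becomes the term \<delta> * d * N^(\<alpha> - p) of
        \<open>switch\<close>.\<close>
      have "\<alpha> * (r + 1) - 1 \<le> \<delta>"
      proof -
        have "\<alpha> * (r + 1) - 1 = \<alpha> * (r - \<theta>)" using \<alpha>(4) by (simp add: algebra_simps)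
        also have "\<dots> \<le> 1 * \<delta>" using \<alpha> r by (intro mult_mono) auto
        finally show ?thesis by simp
      qed
      then have "(\<alpha> * (r + 1) - 1) * m powr \<alpha> \<le> \<delta> * m powr \<alpha>" by (intro mult_right_mono) auto
      also have "\<dots> \<le> \<delta> * (N powr (\<alpha> - p) * m powr p)" using ma \<delta> by (intro mult_left_mono) auto
      finally have a1: "d * ((\<alpha> * (r + 1) - 1) * m powr \<alpha>) \<le> d * (\<delta> * (N powr (\<alpha> - p) * m powr p))"
        using d by (intro mult_left_mono) auto
      have "?r * (x' + m) = \<alpha> * d * (m powr (\<alpha> - 1) * m) * (r + 1)"
        unfolding r(3) by (simp add: algebra_simps)
      then have "d * m powr p - d * m powr \<alpha> + ?r * (x' + m) = d * m powr p + d * ((\<alpha> * (r + 1) - 1) * m powr \<alpha>)"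
        unfolding mp by (simp add: algebra_simps)
      also have "\<dots> \<le> m powr p * (d + \<delta> * d * N powr (\<alpha> - p))"
        using a1 by (simp add: algebra_simps)
      \<comment> \<open>Here \<open>switch\<close> enters, transferred from \<theta> and \<theta> +
        \<delta> to the r between them by monotonicity of the power and of
        \<open>tail p\<close>.\<close>
      also have "\<dots> \<le> m powr p * (r powr p - \<kappa> + (r + 1 - \<delta> / m) * (p * (tail p r - tail p \<rho>)))"
      proof (intro mult_left_mono)
        have t1: "tail p (\<theta> + \<delta>) \<le> tail p r" using r \<theta> by (intro tail_antimono p) auto
        have t2: "tail p \<rho> \<le> tail p (\<theta> + \<delta>)" using \<rho> \<delta> \<theta> by (intro tail_antimono p) auto
        have "\<delta> / m \<le> \<delta>" using m \<delta> by (simp add: pos_divide_le_eq)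
        then have "(\<theta> + 1 - \<delta>) * (p * (tail p (\<theta> + \<delta>) - tail p \<rho>)) \<le> (r + 1 - \<delta> / m) * (p * (tail p r - tail p \<rho>))"
          using r \<theta> \<delta> p t1 t2 by (intro mult_mono mult_left_mono mult_nonneg_nonneg) auto
        moreover have "\<theta> powr p \<le> r powr p" using r \<theta> p by (intro powr_mono2) auto
        ultimately show "d + \<delta> * d * N powr (\<alpha> - p) \<le> r powr p - \<kappa> + (r + 1 - \<delta> / m) * (p * (tail p r - tail p \<rho>))"
          using switch unfolding \<alpha>_def by linarith
      qed simp
      also have "\<dots> = gain m M' + p * m powr (p - 1) * (tail p (M' / m) - tail p \<rho>) * (x' + m - \<delta>)"
      proof -
        have e1: "x' powr p = r powr p * m powr p" using r(3) m0 r(1) \<theta> by (simp add: powr_mult)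
        have e2: "x' + m - \<delta> = m * (r + 1 - \<delta> / m)" using r(3) m0 by (simp add: field_simps)
        show ?thesis
          unfolding gain_def M'(1) e1 e2 r_def[symmetric] mp(1)[symmetric] by (simp add: algebra_simps)
      qed
      also have "\<dots> = V x' m M'" using V2[of m M' x'] M' by simp
      finally show ?thesis using lin m' \<open>\<not> halted x' m M'\<close> by (simp add: \<Phi>_def M'_def)
    qed
  qed
qed

text \<open>Since x > -m + \<delta>, the step sets no new minimum and only M can move. A new maximum
  lowers the slope, and the growth of M^p pays for it by \<open>tail_diff_le_powr_diff\<close>:
  after the reduction by \<delta> the height x' + m - \<delta> is at most M + m, the weight at the
  old ratio.\<close>

lemma phase2_step:
  assumes m: "1 \<le> m" "m < N" and M: "\<theta> * m \<le> M" "M < \<rho> * m" and x: "- m + \<delta> < x" "x \<le> M" and dx: "\<bar>x' - x\<bar> \<le> \<delta>"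
  shows "V x m M + rate m M * (x' - x) \<le> \<Phi> x' (max m (- x')) (max M x')"
proof -
  define M' where "M' = max M x'"
  have m': "max m (- x') = m" using x dx by linarith
  have m0: "0 < m" using m by simp
  have M0: "0 < M" using M(1) \<theta> m0 by (smt (verit) mult_pos_pos)
  let ?q = "\<lambda>M. p * m powr (p - 1) * (tail p (M / m) - tail p \<rho>)"
  have lin: "V x m M + rate m M * (x' - x) = gain m M + ?q M * (x' + m - \<delta>)"
    using V2[OF M(1), of x] M(1) by (simp add: rate_def algebra_simps)
  have "gain m M + ?q M * (x' + m - \<delta>) \<le> gain m M' + ?q M' * (x' + m - \<delta>)"
  proof (cases "x' \<le> M")
    case False
    then have M': "M' = x'" "M < x'" "x' - M \<le> \<delta>" using x dx by (auto simp: M'_def)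
    define a where "a = M / m"
    define b where "b = x' / m"
    define w where "w = (x' + m - \<delta>) / m"
    have ab: "0 < a" "a \<le> b" using M0 m0 M' by (auto simp: a_def b_def divide_right_mono)
    have "0 \<le> x' + m - \<delta>" using M' M0 m \<delta> by linarith
    have "a + 1 = (M + m) / m" using m0 by (simp add: a_def add_divide_distrib)
    then have w: "0 \<le> w" "w \<le> a + 1"
      using m0 M' \<open>0 \<le> x' + m - \<delta>\<close> by (auto simp: w_def intro!: divide_right_mono)
    have "p * w * (tail p a - tail p b) \<le> b powr p - a powr p"
      by (rule tail_diff_le_powr_diff[OF p ab w])
    then have "m powr p * (p * w * (tail p a - tail p b)) \<le> m powr p * (b powr p - a powr p)"
      by (intro mult_left_mono) auto
    moreover have "m powr p * (b powr p - a powr p) = x' powr p - M powr p"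
      using m0 M0 M' by (simp add: a_def b_def powr_divide right_diff_distrib)
    moreover have "m powr p * (p * w * (tail p a - tail p b)) = p * m powr (p - 1) * (x' + m - \<delta>) * (tail p a - tail p b)"
      using m0 by (simp add: w_def powr_diff)
    ultimately show ?thesis
      by (simp add: gain_def M'(1) a_def b_def algebra_simps)
  qed (simp add: M'_def)
  also have "\<dots> \<le> \<Phi> x' m M'"
  proof (cases "halted x' m M'")
    case False
    moreover have "\<theta> * m \<le> M'" using M by (simp add: M'_def)
    ultimately show ?thesis using V2[of m M' x'] by (simp add: \<Phi>_def)
  next
    case True
    \<comment> \<open>Halting must not lose value: at ratio \<rho> the slope is nonpositive and the
      height nonnegative, while at a return to the minimum the signs are reversed.\<close>
    have "?q M' * (x' + m - \<delta>) \<le> 0"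
    proof (cases "\<rho> * m \<le> M'")
      case True
      then have "M' = x'" using M by (auto simp: M'_def)
      have "tail p (M' / m) \<le> tail p \<rho>"
        using True m0 \<rho> \<theta> by (intro tail_antimono p) (auto simp: pos_le_divide_eq)
      then have "?q M' \<le> 0" using p by (intro mult_nonneg_nonpos) auto
      moreover have "0 \<le> x' + m - \<delta>" using \<open>M' = x'\<close> M0 m \<delta> by (auto simp: M'_def)
      ultimately show ?thesis by (rule mult_nonpos_nonneg)
    next
      case False
      then have "x' \<le> - m + \<delta>" using True m by (auto simp: halted_def)
      moreover have "0 \<le> ?q M'" using rate2_nonneg[of m M'] m M False by (auto simp: M'_def)
      ultimately show ?thesis by (intro mult_nonneg_nonpos) auto
    qed
    then show ?thesis using True by (simp add: \<Phi>_def)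
  qed
  finally show ?thesis using lin m' by (simp add: M'_def)
qed

definition "rate_bound = d + p * tail p \<theta>"
definition "value_bound = 2 * (d * N) + 2 + 2 * (\<rho> * N) + \<kappa> * N + rate_bound * (2 * (\<rho> * N) + 2 * N + 2)"

lemma rate_bound_nonneg: "0 \<le> rate_bound"
  using d p tail_nonneg[OF \<theta>(1), of p] by (simp add: rate_bound_def)

lemma running_bounds:
  assumes h: "\<not> halted x m M" and m: "1 \<le> m" and M: "0 \<le> M" and x: "- m \<le> x" "x \<le> M"
  shows "0 \<le> rate m M" "rate m M \<le> rate_bound" "\<bar>V x m M\<bar> \<le> value_bound" "\<bar>gain m M\<bar> \<le> value_bound"
    "\<bar>x\<bar> \<le> \<rho> * N + N"
proof -
  have mN: "m < N" and M\<rho>: "M < \<rho> * m" using h by (auto simp: halted_def)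
  have \<rho>0: "0 < \<rho>" using \<rho> \<theta> by simp
  have MN: "M \<le> \<rho> * N" using M\<rho> mN \<rho>0 by (smt (verit) mult_left_mono)
  show x': "\<bar>x\<bar> \<le> \<rho> * N + N" using x m mN MN M N \<rho>0 by (smt (verit) mult_nonneg_nonneg)
  have mle: "m powr a \<le> 1" if "a \<le> 0" for a
    using powr_mono[OF that m] m by simp
  have mp: "m powr a \<le> N" "0 \<le> m powr a" if "a \<le> 1" for a
    using powr_mono[OF that m] m mN by auto
  show r0: "0 \<le> rate m M"
    using rate2_nonneg[OF m, of M] M\<rho> \<alpha> d by (auto simp: rate_def)
  show rb: "rate m M \<le> rate_bound"
  proof (cases "M < \<theta> * m")
    case True
    have "\<alpha> * d * m powr (\<alpha> - 1) \<le> 1 * d * 1"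
      using \<alpha> d mle[of "\<alpha> - 1"] by (intro mult_mono) auto
    moreover have "0 \<le> p * tail p \<theta>" using p tail_nonneg[OF \<theta>(1), of p] by simp
    ultimately show ?thesis using True by (simp add: rate_def rate_bound_def)
  next
    case False
    have "\<theta> \<le> M / m" using False m by (simp add: pos_le_divide_eq)
    then have "tail p (M / m) - tail p \<rho> \<le> tail p \<theta>"
      using tail_antimono[OF p(2) \<theta>(1)] tail_nonneg[OF \<rho>0, of p] by (smt (verit))
    then have "p * m powr (p - 1) * (tail p (M / m) - tail p \<rho>) \<le> p * m powr (p - 1) * tail p \<theta>"
      using p by (intro mult_left_mono) auto
    also have "\<dots> \<le> p * 1 * tail p \<theta>"
      using p mle[of "p - 1"] tail_nonneg[OF \<theta>(1), of p] by (intro mult_mono) auto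
    finally show ?thesis using False d by (simp add: rate_def rate_bound_def)
  qed
  define A where "A = d * N"
  define P where "P = \<rho> * N"
  define K where "K = \<kappa> * N"
  define E where "E = rate_bound * (2 * P + 2 * N + 2)"
  have Mp: "0 \<le> M powr p" "M powr p \<le> 1 + P" using powr_le_one_plus[OF M p] MN by (auto simp: P_def)
  have km: "0 \<le> \<kappa> * m powr p" "\<kappa> * m powr p \<le> K" using \<kappa> mp[of p] p by (auto simp: K_def intro: mult_left_mono)
  have g: "\<bar>gain m M\<bar> \<le> 1 + P + K" using Mp km unfolding gain_def by linarith
  have b0: "0 \<le> A" "0 \<le> P" "0 \<le> K" using d N \<rho>0 \<kappa> by (auto simp: A_def P_def K_def)
  then have E0: "0 \<le> E" using N rate_bound_nonneg by (simp add: E_def)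
  have vb: "value_bound = 2 * A + 2 + 2 * P + K + E"
    by (simp only: value_bound_def A_def P_def K_def E_def)
  have "1 + P + K \<le> value_bound" using b0 E0 unfolding vb by linarith
  with g show "\<bar>gain m M\<bar> \<le> value_bound" by (rule order_trans)
  have rx: "\<bar>rate m M * y\<bar> \<le> E" if "\<bar>y\<bar> \<le> 2 * P + 2 * N + 2" for y
    unfolding abs_mult E_def using that r0 rb by (intro mult_mono) auto
  show "\<bar>V x m M\<bar> \<le> value_bound"
  proof (cases "M < \<theta> * m")
    case True
    have y: "\<bar>x + m\<bar> \<le> 2 * P + 2 * N + 2" using x' m mN N b0(2) unfolding P_def[symmetric] by linarith
    have "V x m M = d * m powr p - d * m powr \<alpha> + rate m M * (x + m)"
      using V1[OF True] True by (simp add: rate_def)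
    moreover have "0 \<le> d * m powr p" "d * m powr p \<le> A" "0 \<le> d * m powr \<alpha>" "d * m powr \<alpha> \<le> A"
      using d mp[of p] mp[of \<alpha>] p \<alpha> by (auto simp: A_def intro: mult_left_mono)
    ultimately show ?thesis using rx[OF y] b0 E0 unfolding vb by linarith
  next
    case False
    have y: "\<bar>x + m - \<delta>\<bar> \<le> 2 * P + 2 * N + 2" using x' m mN N b0(2) \<delta> unfolding P_def[symmetric] by linarith
    have "V x m M = gain m M + rate m M * (x + m - \<delta>)"
      using V2[of m M x] False by (simp add: rate_def)
    then show ?thesis using rx[OF y] g b0 E0 unfolding vb by linarith
  qed
qed

text \<open>Chosen for steps of size y > \<delta>, where 1 \<le> y^4 / \<delta>^4 and y \<le> y^4 /
  \<delta>^3: the fourth power then pays for the bounded and for the linear part of any possible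
  loss.\<close>

definition "error_const = (2 * value_bound + \<kappa> * N) / \<delta> ^ 4 + (\<kappa> + rate_bound) / \<delta> ^ 3"

lemma error_const_nonneg: "0 \<le> error_const"
  and value_bound_nonneg: "0 \<le> value_bound"
proof -
  have "0 < \<rho>" using \<rho> \<theta> by simp
  then show "0 \<le> value_bound"
    using d N rate_bound_nonneg \<kappa> by (auto simp: value_bound_def intro!: add_nonneg_nonneg mult_nonneg_nonneg)
  then show "0 \<le> error_const"
    using \<kappa> N \<delta> rate_bound_nonneg by (auto simp: error_const_def)
qed

lemma one_step:
  assumes h: "\<not> halted x m M" and m: "1 \<le> m" and M: "0 \<le> M" and x: "- m \<le> x" "x \<le> M"
  shows "V x m M + rate m M * (x' - x) - error_const * (x' - x) ^ 4 \<le> \<Phi> x' (max m (- x')) (max M x')"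
proof (cases "\<bar>x' - x\<bar> \<le> \<delta>")
  case True
  have "0 \<le> error_const * (x' - x) ^ 4" using error_const_nonneg by simp
  moreover have "V x m M + rate m M * (x' - x) \<le> \<Phi> x' (max m (- x')) (max M x')"
  proof (cases "M < \<theta> * m")
    case True
    then show ?thesis using phase1_step[OF m M True x(1) _ \<open>\<bar>x' - x\<bar> \<le> \<delta>\<close> x(2)] h by (auto simp: halted_def)
  next
    case False
    then show ?thesis using phase2_step[OF m _ _ _ _ x(2) True] h by (auto simp: halted_def)
  qed
  ultimately show ?thesis by linarith
next
  case False
  define y where "y = \<bar>x' - x\<bar>"
  have y: "\<delta> < y" using False by (simp add: y_def)
  note b = running_bounds[OF h m M x]
  have mN: "m < N" using h by (auto simp: halted_def)
  let ?m' = "max m (- x')" and ?M' = "max M x'"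
  have m': "1 \<le> ?m'" "?m' \<le> N + y" using m mN x by (auto simp: y_def)
  \<comment> \<open>After a large step the bound m' \<le> N + y limits the loss \<kappa> * m'^p at
    halting to a linear function of y.\<close>
  have phi: "- value_bound - \<kappa> * (N + y) \<le> \<Phi> x' ?m' ?M'"
  proof (cases "halted x' ?m' ?M'")
    case True
    have "?m' powr p \<le> ?m' powr 1" using m' p by (intro powr_mono) auto
    also have "?m' powr 1 = ?m'" using m'(1) by simp
    also note m'(2)
    finally have "?m' powr p \<le> N + y" .
    then have "\<kappa> * ?m' powr p \<le> \<kappa> * (N + y)" using \<kappa> by (rule mult_left_mono)
    moreover have "- (\<kappa> * ?m' powr p) \<le> gain ?m' ?M'" by (simp add: gain_def)
    ultimately show ?thesis using True value_bound_nonneg by (simp add: \<Phi>_def)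
  next
    case False
    have "\<bar>V x' ?m' ?M'\<bar> \<le> value_bound"
      by (rule running_bounds(3)[OF False]) (use m' M in auto)
    moreover have "0 \<le> \<kappa> * (N + y)" using \<kappa> N y \<delta> by (intro mult_nonneg_nonneg) auto
    ultimately show ?thesis using False by (simp add: \<Phi>_def)
  qed
  have "rate m M * (x' - x) \<le> \<bar>rate m M * (x' - x)\<bar>" by simp
  also have "\<dots> \<le> rate_bound * y" unfolding abs_mult y_def using b by (intro mult_mono) auto
  finally have r: "rate m M * (x' - x) \<le> rate_bound * y" .
  have "(2 * value_bound + \<kappa> * N) * 1 \<le> (2 * value_bound + \<kappa> * N) * (y ^ 4 / \<delta> ^ 4)"
    using value_bound_nonneg \<kappa> N y \<delta> by (intro mult_left_mono) (auto intro!: power_mono)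
  moreover have "(\<kappa> + rate_bound) * y * 1 \<le> (\<kappa> + rate_bound) * y * (y ^ 3 / \<delta> ^ 3)"
    using rate_bound_nonneg \<kappa> y \<delta> by (intro mult_left_mono) (auto intro!: power_mono)
  moreover have "error_const * y ^ 4 = (2 * value_bound + \<kappa> * N) * (y ^ 4 / \<delta> ^ 4) + (\<kappa> + rate_bound) * y * (y ^ 3 / \<delta> ^ 3)"
    by (simp add: error_const_def distrib_right power3_eq_cube power4_eq_xxxx)
  moreover have "(x' - x) ^ 4 = y ^ 4" by (simp add: y_def power_even_abs)
  ultimately show ?thesis using phi r b(3) by (simp add: algebra_simps)
qed

section \<open>The strategy along a discrete path\<close>

definition running :: "(nat \<Rightarrow> real) \<Rightarrow> nat \<Rightarrow> bool" where
  "running x k \<longleftrightarrow> (\<forall>j\<le>k. \<not> halted (x j) (run_min 1 x j) (run_max x j))"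

text \<open>The first halted index, capped at the second argument: step k is taken iff no index up
  to and including k is halted.\<close>

primrec stop_index :: "(nat \<Rightarrow> real) \<Rightarrow> nat \<Rightarrow> nat" where
  "stop_index x 0 = 0"
| "stop_index x (Suc k) = (if running x k then Suc k else stop_index x k)"

lemma running_antimono: "i \<le> j \<Longrightarrow> running x j \<Longrightarrow> running x i"
  by (auto simp: running_def)

lemma stop_index_le: "stop_index x k \<le> k"
  by (induction k) auto

lemma less_stop_index_iff: "k < stop_index x J \<longleftrightarrow> running x k \<and> k < J"
proof (induction J)
  case (Suc J)
  then show ?case using running_antimono[of k J x] by (auto simp: less_Suc_eq)
qed simp

lemma stop_index_running: "running x J \<Longrightarrow> stop_index x J = J"
  using running_antimono[of "J - 1" J x] by (cases J) auto

text \<open>\<open>one_step\<close> is summed until halting, from the start value V 0 1 0 = \<alpha>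
  * d. On a path still running at J, \<open>V\<close> stands in place of \<open>gain\<close>; both
  are bounded by \<open>value_bound\<close>, whence the last term.\<close>

lemma gain_stopped:
  assumes x0: "x 0 = 0"
  shows "\<alpha> * d + (\<Sum>k<J. of_bool (running x k) *
        (rate (run_min 1 x k) (run_max x k) * (x (Suc k) - x k) - error_const * (x (Suc k) - x k) ^ 4))
      - 2 * value_bound * of_bool (running x J)
    \<le> gain (run_min 1 x (stop_index x J)) (run_max x (stop_index x J))"
proof -
  let ?m = "run_min 1 x" and ?M = "run_max x"
  define T where "T J = (\<Sum>k<J. of_bool (running x k) *
        (rate (?m k) (?M k) * (x (Suc k) - x k) - error_const * (x (Suc k) - x k) ^ 4))" for J
  have inv: "1 \<le> ?m k" "0 \<le> ?M k" "- ?m k \<le> x k" "x k \<le> ?M k" for k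
    using run_min_ge[of 1 x k] run_max_nonneg[of x k] run_min_bound[of x 1 k] run_max_bound[of x k] x0 by auto
  have "(running x J \<longrightarrow> \<alpha> * d + T J \<le> V (x J) (?m J) (?M J)) \<and>
    (\<not> running x J \<longrightarrow> \<alpha> * d + T J \<le> gain (?m (stop_index x J)) (?M (stop_index x J)))"
  proof (induction J)
    case 0
    have "\<rho> > 0" using \<rho> \<theta> by simp
    then have "running x 0" using N \<theta> by (simp add: running_def halted_def)
    then show ?case using V1[of 0 1 0] \<theta> x0 by (simp add: T_def)
  next
    case (Suc J)
    show ?case
    proof (cases "running x J")
      case False
      then have "\<not> running x (Suc J)" using running_antimono[of J "Suc J" x] by auto
      then show ?thesis using Suc False by (simp add: T_def)
    next
      case True
      then have nh: "\<not> halted (x J) (?m J) (?M J)" by (auto simp: running_def)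
      have "T (Suc J) = T J + (rate (?m J) (?M J) * (x (Suc J) - x J) - error_const * (x (Suc J) - x J) ^ 4)"
        using True by (simp add: T_def)
      then have le: "\<alpha> * d + T (Suc J) \<le> \<Phi> (x (Suc J)) (?m (Suc J)) (?M (Suc J))"
        using one_step[OF nh inv, of "x (Suc J)"] Suc True by simp
      have eq: "running x (Suc J) \<longleftrightarrow> \<not> halted (x (Suc J)) (?m (Suc J)) (?M (Suc J))"
        using True unfolding running_def by (auto simp: le_Suc_eq)
      show ?thesis
        using le True
        by (cases "halted (x (Suc J)) (?m (Suc J)) (?M (Suc J))")
          (simp_all add: eq \<Phi>_def del: run_min.simps run_max.simps)
    qed
  qed
  moreover have "V (x J) (?m J) (?M J) - 2 * value_bound \<le> gain (?m J) (?M J)" if "running x J"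
  proof -
    have "\<not> halted (x J) (?m J) (?M J)" using that by (auto simp: running_def)
    from running_bounds(3,4)[OF this inv] show ?thesis by linarith
  qed
  ultimately show ?thesis
    unfolding T_def[symmetric] using stop_index_running[of x J] by (cases "running x J") auto
qed

end

text \<open>The normal density of variance t is at most 1 / sqrt (2 * pi * t). A strategy still
  running at time L confines B to a fixed interval, so late running is unlikely.\<close>

lemma (in gaussian_family) brownian_confinement:
  assumes "0 < t" "0 \<le> R"
  shows "prob {\<omega> \<in> space M. \<bar>B t \<omega>\<bar> \<le> R} \<le> 2 * R / sqrt (2 * pi * t)"
proof -
  have D: "distributed M lborel (B t) (normal_density 0 (sqrt t))"
    using increment_distributed[of 0 t] assms by (simp add: B_0)
  have nd: "normal_density 0 (sqrt t) y \<le> 1 / sqrt (2 * pi * t)" for y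
    using assms by (simp add: normal_density_def divide_simps)
  have "{\<omega> \<in> space M. \<bar>B t \<omega>\<bar> \<le> R} = B t -` {- R..R} \<inter> space M" by auto
  then have "emeasure M {\<omega> \<in> space M. \<bar>B t \<omega>\<bar> \<le> R} = (\<integral>\<^sup>+y. ennreal (normal_density 0 (sqrt t) y) * indicator {- R..R} y \<partial>lborel)"
    using distributed_emeasure[OF D, of "{- R..R}"] by simp
  also have "\<dots> \<le> (\<integral>\<^sup>+y. ennreal (1 / sqrt (2 * pi * t)) * indicator {- R..R} y \<partial>lborel)"
    by (intro nn_integral_mono mult_right_mono ennreal_leI nd) auto
  also have "\<dots> = ennreal (1 / sqrt (2 * pi * t)) * ennreal (2 * R)"
    using assms by (simp add: nn_integral_cmult_indicator)
  also have "\<dots> = ennreal (2 * R / sqrt (2 * pi * t))"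
    using assms by (subst ennreal_mult[symmetric]) auto
  finally show ?thesis
    using assms by (simp add: emeasure_eq_measure)
qed

section \<open>The strategy applied to Brownian motion on a dyadic grid\<close>

locale stopped_strategy = gaussian_family M \<xi> + strategy p \<kappa> \<theta> \<rho> \<delta> N d
  for M :: "'a measure" and \<xi> and p \<kappa> \<theta> \<rho> \<delta> N d :: real +
  fixes n L :: nat
begin

definition x :: "nat \<Rightarrow> 'a \<Rightarrow> real" where "x k = B (real k / 2 ^ n)"

abbreviation "J \<equiv> L * 2 ^ n"
abbreviation "live k \<omega> \<equiv> running (\<lambda>k. x k \<omega>) k"
abbreviation "T \<omega> \<equiv> stop_index (\<lambda>k. x k \<omega>) J"
abbreviation "lo k \<omega> \<equiv> run_min 1 (\<lambda>k. x k \<omega>) k"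
abbreviation "hi k \<omega> \<equiv> run_max (\<lambda>k. x k \<omega>) k"

lemma x_0: "x 0 \<omega> = 0" by (simp add: x_def B_0)

lemma x_adapted: "j \<le> k \<Longrightarrow> x j \<in> borel_measurable (\<F> (real k / 2 ^ n))"
  unfolding x_def by (intro B_adapted) (auto simp: divide_right_mono)

lemma x_measurable [measurable]: "x k \<in> borel_measurable M"
  by (simp add: x_def)

lemma x_integrable: "integrable M (x k)"
  unfolding x_def by (intro B_integrable) simp

lemma halted_pred:
  assumes [measurable]: "f \<in> borel_measurable K" "g \<in> borel_measurable K" "h \<in> borel_measurable K"
  shows "Measurable.pred K (\<lambda>\<omega>. halted (f \<omega>) (g \<omega>) (h \<omega>))"
  unfolding halted_def by measurable

lemma live_pred:
  assumes "\<And>j. j \<le> k \<Longrightarrow> x j \<in> borel_measurable K"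
  shows "Measurable.pred K (live k)"
proof -
  have h: "Measurable.pred K (\<lambda>\<omega>. halted (x j \<omega>) (lo j \<omega>) (hi j \<omega>))" if "j \<le> k" for j
    by (rule halted_pred; (intro assms measurable_run)?) (use that in auto)
  have "Measurable.pred K (live i)" if "i \<le> k" for i
    using that
  proof (induction i)
    case 0
    then show ?case using h[of 0] by (simp add: running_def del: run_min.simps run_max.simps)
  next
    case (Suc i)
    have "live (Suc i) \<omega> \<longleftrightarrow> live i \<omega> \<and> \<not> halted (x (Suc i) \<omega>) (lo (Suc i) \<omega>) (hi (Suc i) \<omega>)" for \<omega>
      by (auto simp: running_def le_Suc_eq)
    moreover note [measurable] = Suc.IH[OF Suc_leD[OF Suc.prems]] h[OF Suc.prems]
    ultimately show ?case by (simp del: run_min.simps run_max.simps)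
  qed
  then show ?thesis by simp
qed

lemma live_measurable [measurable]: "Measurable.pred M (live k)"
  by (rule live_pred) simp

lemma live_adapted: "Measurable.pred (\<F> (real k / 2 ^ n)) (live k)"
  by (rule live_pred) (rule x_adapted)

lemma bounds: "1 \<le> lo k \<omega>" "0 \<le> hi k \<omega>" "- lo k \<omega> \<le> x k \<omega>" "x k \<omega> \<le> hi k \<omega>"
  using run_min_ge[of 1 "\<lambda>k. x k \<omega>" k] run_max_nonneg[of "\<lambda>k. x k \<omega>" k]
    run_min_bound[of "\<lambda>k. x k \<omega>" 1 k] run_max_bound[of "\<lambda>k. x k \<omega>" k] x_0 by auto

lemma live_bounds:
  assumes "live k \<omega>"
  shows "0 \<le> rate (lo k \<omega>) (hi k \<omega>)" "rate (lo k \<omega>) (hi k \<omega>) \<le> rate_bound" "\<bar>x k \<omega>\<bar> \<le> \<rho> * N + N"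
  using running_bounds[OF _ bounds, of k \<omega>] assms by (auto simp: running_def)

definition weight :: "nat \<Rightarrow> 'a \<Rightarrow> real" where
  "weight k \<omega> = of_bool (live k \<omega>) * rate (lo k \<omega>) (hi k \<omega>)"

lemma weight_adapted: "weight k \<in> borel_measurable (\<F> (real k / 2 ^ n))"
proof -
  note [measurable] = live_adapted[of k] measurable_run[of k x "\<F> (real k / 2 ^ n)", OF x_adapted]
    measurable_compose[OF _ measurable_tail_max[OF p(2) \<theta>(1)]]
  \<comment> \<open>In the second phase the ratio is at least \<theta>, so the maximum with \<theta>
    changes nothing and brings in \<open>measurable_tail_max\<close>.\<close>
  have "rate (lo k \<omega>) (hi k \<omega>) = (if hi k \<omega> < \<theta> * lo k \<omega> then \<alpha> * d * lo k \<omega> powr (\<alpha> - 1)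
      else p * lo k \<omega> powr (p - 1) * (tail p (max (hi k \<omega> / lo k \<omega>) \<theta>) - tail p \<rho>))" for \<omega>
    using bounds(1)[of \<omega> k] by (auto simp: rate_def max_def divide_le_eq)
  then show ?thesis unfolding weight_def by simp
qed

lemma weight_integrable: "integrable M (weight k)"
proof (rule integrable_const_bound)
  show "AE \<omega> in M. norm (weight k \<omega>) \<le> rate_bound"
    using live_bounds[of _ k] rate_bound_nonneg by (intro AE_I2) (auto simp: weight_def)
  show "weight k \<in> borel_measurable M"
    by (rule filtered.measurable_F_M[OF _ weight_adapted]) simp
qed

lemma
  shows weighted_step: "integrable M (\<lambda>\<omega>. weight k \<omega> * (x (Suc k) \<omega> - x k \<omega>))"
      "(\<integral>\<omega>. weight k \<omega> * (x (Suc k) \<omega> - x k \<omega>) \<partial>M) = 0"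
    and fourth_step: "integrable M (\<lambda>\<omega>. (x (Suc k) \<omega> - x k \<omega>) ^ 4)"
      "(\<integral>\<omega>. (x (Suc k) \<omega> - x k \<omega>) ^ 4 \<partial>M) = 3 / 4 ^ n"
proof -
  have u: "0 \<le> real k / 2 ^ n" "real k / 2 ^ n < real (Suc k) / 2 ^ n" by (auto simp: divide_strict_right_mono)
  show "integrable M (\<lambda>\<omega>. weight k \<omega> * (x (Suc k) \<omega> - x k \<omega>))"
    "(\<integral>\<omega>. weight k \<omega> * (x (Suc k) \<omega> - x k \<omega>) \<partial>M) = 0"
    using weighted_increment[OF u(1) less_imp_le[OF u(2)] weight_adapted weight_integrable] by (auto simp: x_def)
  have "real (Suc k) / 2 ^ n - real k / 2 ^ n = 1 / 2 ^ n"
    by (simp add: diff_divide_distrib[symmetric])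
  moreover have "(1 / 2 ^ n)\<^sup>2 = (1 / 4 ^ n :: real)"
    by (simp add: power_divide power2_eq_square power_mult_distrib[symmetric])
  ultimately show "integrable M (\<lambda>\<omega>. (x (Suc k) \<omega> - x k \<omega>) ^ 4)"
      "(\<integral>\<omega>. (x (Suc k) \<omega> - x k \<omega>) ^ 4 \<partial>M) = 3 / 4 ^ n"
    using increment_fourth[OF u] by (simp_all add: x_def)
qed

lemma stopped_integrable:
  fixes f :: "nat \<Rightarrow> 'a \<Rightarrow> real"
  assumes "\<And>k. integrable M (f k)"
  shows "integrable M (\<lambda>\<omega>. f (stop_index (\<lambda>k. x k \<omega>) j) \<omega>)"
proof (induction j)
  case (Suc j)
  have [measurable]: "f k \<in> borel_measurable M" for k using assms[of k] by simp
  note [measurable] = borel_measurable_integrable[OF Suc]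
  have "f (stop_index (\<lambda>k. x k \<omega>) (Suc j)) \<omega> = (if live j \<omega> then f (Suc j) \<omega> else f (stop_index (\<lambda>k. x k \<omega>) j) \<omega>)" for \<omega>
    by simp
  moreover have "integrable M (\<lambda>\<omega>. if live j \<omega> then f (Suc j) \<omega> else f (stop_index (\<lambda>k. x k \<omega>) j) \<omega>)"
  proof (rule Bochner_Integration.integrable_bound)
    show "integrable M (\<lambda>\<omega>. \<bar>f (Suc j) \<omega>\<bar> + \<bar>f (stop_index (\<lambda>k. x k \<omega>) j) \<omega>\<bar>)"
      using assms Suc by simp
  qed auto
  ultimately show ?case by simp
qed (use assms in simp)

lemma
  shows lo_integrable: "integrable M (\<lambda>\<omega>. lo (T \<omega>) \<omega> powr p)"
    and hi_integrable: "integrable M (\<lambda>\<omega>. hi (T \<omega>) \<omega> powr p)"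
proof -
  have "integrable M (\<lambda>\<omega>. lo k \<omega> powr p)" for k
    by (rule integrable_powr_less_one[OF finite_measure_axioms p integrable_run(1)[OF finite_measure_axioms x_integrable]])
      (use bounds(1) in \<open>meson order_trans zero_le_one\<close>)
  then show "integrable M (\<lambda>\<omega>. lo (T \<omega>) \<omega> powr p)"
    by (rule stopped_integrable[of "\<lambda>k \<omega>. lo k \<omega> powr p"])
  have "integrable M (\<lambda>\<omega>. hi k \<omega> powr p)" for k
    by (rule integrable_powr_less_one[OF finite_measure_axioms p integrable_run(2)[OF finite_measure_axioms x_integrable] bounds(2)])
  then show "integrable M (\<lambda>\<omega>. hi (T \<omega>) \<omega> powr p)"
    by (rule stopped_integrable[of "\<lambda>k \<omega>. hi k \<omega> powr p"])
qed

text \<open>The L * 2^n steps have fourth moment 3 / 4^n each, which gives the error of order L /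
  2^n; the weighted increments have mean zero; the last error is the chance of still running at time
  L.\<close>

lemma expected_gain:
  assumes "0 < L"
  shows "\<alpha> * d - 3 * error_const * real L / 2 ^ n - 2 * value_bound * (2 * (\<rho> * N + N) / sqrt (2 * pi * real L))
    \<le> (\<integral>\<omega>. hi (T \<omega>) \<omega> powr p \<partial>M) - \<kappa> * (\<integral>\<omega>. lo (T \<omega>) \<omega> powr p \<partial>M)"
proof -
  let ?dx = "\<lambda>k \<omega>. x (Suc k) \<omega> - x k \<omega>"
  have lim: "integrable M (\<lambda>\<omega>. of_bool (live J \<omega>) :: real)"
    by (rule integrable_const_bound[of _ 1]) auto
  have ci: "integrable M (\<lambda>\<omega>. weight k \<omega> * ?dx k \<omega> - error_const * ?dx k \<omega> ^ 4)" for k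
    using weighted_step(1) fourth_step(1) by (intro Bochner_Integration.integrable_diff integrable_mult_right)
  have ce: "(\<integral>\<omega>. weight k \<omega> * ?dx k \<omega> - error_const * ?dx k \<omega> ^ 4 \<partial>M) = - (error_const * (3 / 4 ^ n))" for k
    using weighted_step[of k] fourth_step[of k] by simp
  have si: "integrable M (\<lambda>\<omega>. \<Sum>k<J. weight k \<omega> * ?dx k \<omega> - error_const * ?dx k \<omega> ^ 4)"
    by (intro Bochner_Integration.integrable_sum ci)
  have "(\<integral>\<omega>. \<alpha> * d + (\<Sum>k<J. weight k \<omega> * ?dx k \<omega> - error_const * ?dx k \<omega> ^ 4) - 2 * value_bound * of_bool (live J \<omega>) \<partial>M)
      \<le> (\<integral>\<omega>. hi (T \<omega>) \<omega> powr p - \<kappa> * lo (T \<omega>) \<omega> powr p \<partial>M)"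
  proof (rule integral_mono)
    fix \<omega>
    \<comment> \<open>Dropping the indicator before the fourth powers only lowers the sum, and makes
      their means explicit.\<close>
    have "(\<Sum>k<J. weight k \<omega> * ?dx k \<omega> - error_const * ?dx k \<omega> ^ 4)
        \<le> (\<Sum>k<J. of_bool (live k \<omega>) * (rate (lo k \<omega>) (hi k \<omega>) * ?dx k \<omega> - error_const * ?dx k \<omega> ^ 4))"
      using error_const_nonneg by (intro sum_mono) (auto simp: weight_def)
    then show "\<alpha> * d + (\<Sum>k<J. weight k \<omega> * ?dx k \<omega> - error_const * ?dx k \<omega> ^ 4) - 2 * value_bound * of_bool (live J \<omega>)
        \<le> hi (T \<omega>) \<omega> powr p - \<kappa> * lo (T \<omega>) \<omega> powr p"
      using gain_stopped[of "\<lambda>k. x k \<omega>" J] x_0 unfolding gain_def by simp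
  qed (intro Bochner_Integration.integrable_add Bochner_Integration.integrable_diff integrable_mult_right
      integrable_const si lim lo_integrable hi_integrable)+
  moreover have "(\<integral>\<omega>. \<alpha> * d + (\<Sum>k<J. weight k \<omega> * ?dx k \<omega> - error_const * ?dx k \<omega> ^ 4) - 2 * value_bound * of_bool (live J \<omega>) \<partial>M)
      = \<alpha> * d + (\<Sum>k<J. - (error_const * (3 / 4 ^ n))) - 2 * value_bound * (\<integral>\<omega>. of_bool (live J \<omega>) \<partial>M)"
  proof -
    note ii = integrable_const[of "\<alpha> * d"]
    show ?thesis
      by (simp only: Bochner_Integration.integral_diff[OF Bochner_Integration.integrable_add[OF ii si] integrable_mult_right[OF lim]]
          Bochner_Integration.integral_add[OF ii si] integral_mult_right_zero Bochner_Integration.integral_sum[OF ci, of "\<lambda>k. k"] ce lebesgue_integral_const prob_space)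
        simp
  qed
  moreover have "(\<Sum>k<J. - (error_const * (3 / 4 ^ n))) = - (3 * error_const * real L / 2 ^ n)"
  proof -
    have "(4 :: real) ^ n = 2 ^ n * 2 ^ n" by (simp add: power_mult_distrib[symmetric])
    then show ?thesis by simp
  qed
  moreover have "(\<integral>\<omega>. hi (T \<omega>) \<omega> powr p - \<kappa> * lo (T \<omega>) \<omega> powr p \<partial>M)
      = (\<integral>\<omega>. hi (T \<omega>) \<omega> powr p \<partial>M) - \<kappa> * (\<integral>\<omega>. lo (T \<omega>) \<omega> powr p \<partial>M)"
    by (simp only: Bochner_Integration.integral_diff[OF hi_integrable integrable_mult_right[OF lo_integrable]] integral_mult_right_zero)
  moreover have "(\<integral>\<omega>. of_bool (live J \<omega>) \<partial>M) \<le> 2 * (\<rho> * N + N) / sqrt (2 * pi * real L)"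
  proof -
    have R: "0 \<le> \<rho> * N + N" using \<rho> \<theta> N by simp
    have "(\<integral>\<omega>. of_bool (live J \<omega>) \<partial>M) = (\<integral>\<omega>. indicator {\<omega> \<in> space M. live J \<omega>} \<omega> \<partial>M)"
      by (intro Bochner_Integration.integral_cong) (auto simp: indicator_def)
    also have "\<dots> = prob {\<omega> \<in> space M. live J \<omega>}" by simp
    also have "\<dots> \<le> prob {\<omega> \<in> space M. \<bar>B (real L) \<omega>\<bar> \<le> \<rho> * N + N}"
      using live_bounds(3)[of _ J] by (intro finite_measure_mono) (auto simp: x_def)
    also have "\<dots> \<le> 2 * (\<rho> * N + N) / sqrt (2 * pi * real L)"
      using assms R by (intro brownian_confinement) auto
    finally show ?thesis .
  qed
  then have "2 * value_bound * (\<integral>\<omega>. of_bool (live J \<omega>) \<partial>M) \<le> 2 * value_bound * (2 * (\<rho> * N + N) / sqrt (2 * pi * real L))"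
    using value_bound_nonneg by (intro mult_left_mono) auto
  ultimately show ?thesis by linarith
qed

end

section \<open>The stopped Brownian motion in continuous time\<close>

context stopped_strategy
begin

definition eta :: "'a \<Rightarrow> ennreal" where "eta \<omega> = ennreal (real (T \<omega>) / 2 ^ n)"

abbreviation "X \<equiv> stopped B eta"

lemma X_eq: "0 \<le> t \<Longrightarrow> X t \<omega> = B (min (real (T \<omega>) / 2 ^ n) t) \<omega>"
  by (auto simp: stopped_def eta_def min_def)

lemma X_continuous: "continuous_on {0..} (\<lambda>t. X t \<omega>)"
proof -
  have "continuous_on {0..} (\<lambda>t. B (min (real (T \<omega>) / 2 ^ n) t) \<omega>)"
    by (rule continuous_on_compose2[OF B_continuous[of \<omega>]]) (auto intro!: continuous_intros)
  then show ?thesis by (rule continuous_on_eq) (simp add: X_eq)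
qed

lemma live_pred_at: "real k / 2 ^ n \<le> t \<Longrightarrow> Measurable.pred (\<F> t) (live k)"
  by (rule live_pred) (auto simp: x_def divide_right_mono intro!: B_adapted order_trans[of _ "real k / 2 ^ n" t])

text \<open>The stopped process becomes a discrete stochastic integral whose indicators are known at
  the left ends of the grid intervals; adaptedness, integrability and the martingale property then
  follow summand by summand.\<close>

lemma X_sum:
  assumes "0 \<le> t"
  shows "X t \<omega> = (\<Sum>k<J. of_bool (live k \<omega>) * (B (min t (real (Suc k) / 2 ^ n)) \<omega> - B (min t (real k / 2 ^ n)) \<omega>))"
proof -
  have "B (min t (real (stop_index (\<lambda>k. x k \<omega>) j) / 2 ^ n)) \<omega>
    = (\<Sum>k<j. of_bool (live k \<omega>) * (B (min t (real (Suc k) / 2 ^ n)) \<omega> - B (min t (real k / 2 ^ n)) \<omega>))" for j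
  proof (induction j)
    case 0
    then show ?case using assms by (simp add: B_0)
  next
    case (Suc j)
    then show ?case using stop_index_running[of "\<lambda>k. x k \<omega>" j] by (cases "live j \<omega>") auto
  qed
  from this[of J] show ?thesis using assms by (simp add: X_eq min.commute)
qed

lemma X_adapted: "adapted \<F> X"
  unfolding adapted_def
proof (intro allI impI)
  fix t :: real assume t: "0 \<le> t"
  have "(\<lambda>\<omega>. of_bool (live k \<omega>) * (B (min t (real (Suc k) / 2 ^ n)) \<omega> - B (min t (real k / 2 ^ n)) \<omega>))
      \<in> borel_measurable (\<F> t)" for k
  proof (cases "real k / 2 ^ n \<le> t")
    case True
    note [measurable] = live_pred_at[OF True]
    have [measurable]: "B (min t (real j / 2 ^ n)) \<in> borel_measurable (\<F> t)" for j
      using t by (intro B_adapted) auto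
    show ?thesis by measurable
  next
    case False
    \<comment> \<open>For an interval beginning after t the indicator looks into the future, but the
      increment cut off at t is zero.\<close>
    then have "min t (real k / 2 ^ n) = t" "min t (real (Suc k) / 2 ^ n) = t"
      by (auto simp: min_def add_divide_distrib) (smt (verit) divide_nonneg_nonneg zero_le_power)
    then show ?thesis by simp
  qed
  then have "(\<lambda>\<omega>. \<Sum>k<J. of_bool (live k \<omega>) * (B (min t (real (Suc k) / 2 ^ n)) \<omega> - B (min t (real k / 2 ^ n)) \<omega>))
      \<in> borel_measurable (\<F> t)"
    by (rule borel_measurable_sum)
  then show "X t \<in> borel_measurable (\<F> t)"
    by (subst measurable_cong[OF X_sum[OF t]])
qed

lemma X_integrable:
  assumes "0 \<le> t"
  shows "integrable M (X t)"
proof -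
  have [measurable]: "X t \<in> borel_measurable M"
    using X_adapted assms filtered.measurable_F_M[OF assms] by (auto simp: adapted_def)
  have "integrable M (\<lambda>\<omega>. of_bool (live k \<omega>) * (B (min t (real (Suc k) / 2 ^ n)) \<omega> - B (min t (real k / 2 ^ n)) \<omega>))" for k
  proof (rule Bochner_Integration.integrable_bound)
    show "integrable M (\<lambda>\<omega>. B (min t (real (Suc k) / 2 ^ n)) \<omega> - B (min t (real k / 2 ^ n)) \<omega>)"
      using assms by (intro Bochner_Integration.integrable_diff B_integrable) auto
  qed auto
  then have "integrable M (\<lambda>\<omega>. \<Sum>k<J. of_bool (live k \<omega>) * (B (min t (real (Suc k) / 2 ^ n)) \<omega> - B (min t (real k / 2 ^ n)) \<omega>))"
    by (rule Bochner_Integration.integrable_sum)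
  then show ?thesis by (simp only: X_sum[OF assms, symmetric])
qed

text \<open>The difference is a sum over grid intervals clipped to [s, t], with end points
  \<open>u k\<close>. The indicator of A and of being live at k is known at \<open>u k\<close> as
  long as k / 2^n \<le> t; later intervals are clipped to a point.\<close>

lemma X_increment_mean:
  assumes st: "0 \<le> s" "s \<le> t" and A: "A \<in> sets (\<F> s)"
  shows "(\<integral>\<omega>. indicator A \<omega> * (X t \<omega> - X s \<omega>) \<partial>M) = 0"
proof -
  define u where "u k = max s (min t (real k / 2 ^ n))" for k
  have u0: "0 \<le> u k" "u k \<le> u (Suc k)" "s \<le> u k" for k
  proof -
    show "u k \<le> u (Suc k)"
      unfolding u_def by (intro max.mono min.mono order_refl divide_right_mono) auto
  qed (use st in \<open>auto simp: u_def max.coboundedI1\<close>)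
  have diff: "X t \<omega> - X s \<omega> = (\<Sum>k<J. of_bool (live k \<omega>) * (B (u (Suc k)) \<omega> - B (u k) \<omega>))" for \<omega>
  proof -
    have "B (min t c) \<omega> - B (min s c) \<omega> = B (max s (min t c)) \<omega> - B s \<omega>" for c
      using st by (auto simp: min_def max_def)
    then have "of_bool (live k \<omega>) * (B (min t (real (Suc k) / 2 ^ n)) \<omega> - B (min t (real k / 2 ^ n)) \<omega>)
        - of_bool (live k \<omega>) * (B (min s (real (Suc k) / 2 ^ n)) \<omega> - B (min s (real k / 2 ^ n)) \<omega>)
        = of_bool (live k \<omega>) * (B (u (Suc k)) \<omega> - B (u k) \<omega>)" for k
      unfolding u_def right_diff_distrib[symmetric] by (intro arg_cong2[where f="(*)"]) (smt (verit))+
    then show ?thesis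
      using st by (simp only: X_sum order_trans[OF st] sum_subtractf[symmetric])
  qed
  have summand: "integrable M (\<lambda>\<omega>. (indicator A \<omega> * of_bool (live k \<omega>)) * (B (u (Suc k)) \<omega> - B (u k) \<omega>)) \<and>
      (\<integral>\<omega>. (indicator A \<omega> * of_bool (live k \<omega>)) * (B (u (Suc k)) \<omega> - B (u k) \<omega>) \<partial>M) = 0" for k
  proof (cases "real k / 2 ^ n \<le> t")
    case True
    then have "real k / 2 ^ n \<le> u k" by (simp add: u_def)
    note [measurable] = live_pred_at[OF this]
    have [measurable]: "A \<in> sets (\<F> (u k))" using A filtered.mono[OF st(1) u0(3)] by auto
    have f: "(\<lambda>\<omega>. indicator A \<omega> * of_bool (live k \<omega>) :: real) \<in> borel_measurable (\<F> (u k))"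
      by measurable
    moreover have "integrable M (\<lambda>\<omega>. indicator A \<omega> * of_bool (live k \<omega>) :: real)"
      by (rule integrable_const_bound[of _ 1]) (use filtered.measurable_F_M[OF u0(1) f] in \<open>auto simp: indicator_def\<close>)
    ultimately show ?thesis using weighted_increment[OF u0(1,2)] by blast
  next
    case False
    then have "t < real k / 2 ^ n" "t < real (Suc k) / 2 ^ n"
      using divide_right_mono[of "real k" "real (Suc k)" "2 ^ n"] by auto
    then have "u k = u (Suc k)" by (simp add: u_def)
    then show ?thesis by simp
  qed
  have "(\<integral>\<omega>. indicator A \<omega> * (X t \<omega> - X s \<omega>) \<partial>M)
      = (\<integral>\<omega>. (\<Sum>k<J. (indicator A \<omega> * of_bool (live k \<omega>)) * (B (u (Suc k)) \<omega> - B (u k) \<omega>)) \<partial>M)"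
    unfolding diff sum_distrib_left by (simp only: mult.assoc)
  also have "\<dots> = (\<Sum>k<J. \<integral>\<omega>. (indicator A \<omega> * of_bool (live k \<omega>)) * (B (u (Suc k)) \<omega> - B (u k) \<omega>) \<partial>M)"
    by (rule Bochner_Integration.integral_sum) (use summand in blast)
  also have "\<dots> = 0" by (rule sum.neutral) (use summand in blast)
  finally show ?thesis .
qed

lemma X_supermartingale: "supermartingale M \<F> X"
  unfolding supermartingale_def
proof (intro conjI allI impI X_adapted X_integrable)
  fix s t :: real assume st: "0 \<le> s" "s \<le> t"
  interpret finite_measure_subalgebra M "\<F> s"
    by unfold_locales (rule filtered.subalg[OF st(1)])
  have t: "0 \<le> t" using st by simp
  have "AE \<omega> in M. real_cond_exp M (\<F> s) (X t) \<omega> = X s \<omega>"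
  proof (rule real_cond_exp_charact)
    fix A assume A: "A \<in> sets (\<F> s)"
    then have Aev: "A \<in> events" using augmented_events by auto
    have i: "integrable M (\<lambda>\<omega>. indicator A \<omega> * X r \<omega>)" if "0 \<le> r" for r
      using integrable_mult_indicator[OF Aev X_integrable[OF that]] by simp
    have "(\<integral>\<omega>. indicator A \<omega> * X t \<omega> \<partial>M) - (\<integral>\<omega>. indicator A \<omega> * X s \<omega> \<partial>M) = (\<integral>\<omega>. indicator A \<omega> * (X t \<omega> - X s \<omega>) \<partial>M)"
      unfolding right_diff_distrib by (rule Bochner_Integration.integral_diff[symmetric, OF i[OF t] i[OF st(1)]])
    then show "(\<integral>\<omega>\<in>A. X t \<omega> \<partial>M) = (\<integral>\<omega>\<in>A. X s \<omega> \<partial>M)"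
      unfolding X_increment_mean[OF st A] set_lebesgue_integral_def by simp
  next
    show "X s \<in> borel_measurable (\<F> s)" using X_adapted st by (simp add: adapted_def)
  qed (use X_integrable st t in auto)
  then show "AE \<omega> in M. real_cond_exp M (\<F> s) (X t) \<omega> \<le> X s \<omega>"
    by eventually_elim simp
qed

lemma X_0: "X 0 \<omega> = 0" by (simp add: X_eq B_0)

lemma X_left_limit:
  assumes "0 < t"
  shows "((\<lambda>s. X s \<omega>) \<longlongrightarrow> X t \<omega>) (at_left t)"
proof -
  have "((\<lambda>s. X s \<omega>) \<longlongrightarrow> X t \<omega>) (at t within {0..})"
    using X_continuous[of \<omega>] assms by (simp add: continuous_on_def)
  moreover have "at t within {0..} = at t"
    by (rule at_within_interior) (use assms in simp)
  ultimately show ?thesis by (simp add: tendsto_mono[OF at_le[OF subset_UNIV]])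
qed

lemma X_nonneg_jump_supermartingale: "nonneg_jump_supermartingale M \<F> X"
  unfolding nonneg_jump_supermartingale_def
proof (intro conjI X_supermartingale)
  show "cadlag M X"
    unfolding cadlag_def
  proof (intro ballI conjI allI impI)
    fix \<omega> and t :: real assume "0 \<le> t"
    then have "((\<lambda>s. X s \<omega>) \<longlongrightarrow> X t \<omega>) (at t within {0..})"
      using X_continuous[of \<omega>] by (simp add: continuous_on_def)
    then have "((\<lambda>s. X s \<omega>) \<longlongrightarrow> X t \<omega>) (at_right t)"
      by (rule tendsto_within_subset) (use \<open>0 \<le> t\<close> in auto)
    then show "continuous (at_right t) (\<lambda>s. X s \<omega>)"
      by (simp add: continuous_within)
  qed (use X_left_limit in blast)
  have "jump X t \<omega> = 0" if "0 \<le> t" for t \<omega>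
  proof (cases "t = 0")
    case False
    then have "Lim (at_left t) (\<lambda>s. X s \<omega>) = X t \<omega>"
      using that by (intro tendsto_Lim X_left_limit) auto
    then show ?thesis using False by (simp add: jump_def left_lim_def)
  qed (simp add: jump_def left_lim_def X_0)
  then show "AE \<omega> in M. \<forall>t\<ge>0. 0 \<le> jump X t \<omega>" by simp
  show "AE \<omega> in M. X 0 \<omega> = 0" by (simp add: X_0)
qed

text \<open>\<open>eta\<close> takes grid values, so having stopped by a finite t is decided at the
  last grid index k not after t: it fails iff k is live and below \<open>J\<close>.\<close>

lemma eta_stopping_time: "stopping_time_ext \<F> eta"
  unfolding stopping_time_ext_def
proof (rule stopping_timeI)
  fix t :: ennreal
  show "Measurable.pred (\<F> (enn2real t)) (\<lambda>\<omega>. eta \<omega> \<le> t)"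
  proof (cases t)
    case (real r)
    let ?k = "dyadic_floor n r"
    have k: "real ?k / 2 ^ n \<le> r"
      using dyadic_floor_bounds(1)[OF real(1), of n] by (simp add: pos_divide_le_eq mult.commute)
    note [measurable] = live_pred_at[OF k]
    have "eta \<omega> \<le> t \<longleftrightarrow> \<not> (live ?k \<omega> \<and> ?k < J)" for \<omega>
    proof -
      have "eta \<omega> \<le> t \<longleftrightarrow> real (T \<omega>) \<le> 2 ^ n * r"
        using real by (simp add: eta_def pos_divide_le_eq mult.commute)
      also have "\<dots> \<longleftrightarrow> T \<omega> \<le> ?k"
      proof
        assume "real (T \<omega>) \<le> 2 ^ n * r"
        then have "real (T \<omega>) < real (Suc ?k)" using dyadic_floor_bounds(2)[OF real(1), of n] by simp
        then show "T \<omega> \<le> ?k" unfolding of_nat_less_iff by simp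
      next
        assume "T \<omega> \<le> ?k"
        then have "real (T \<omega>) \<le> real ?k" by simp
        then show "real (T \<omega>) \<le> 2 ^ n * r" using dyadic_floor_bounds(1)[OF real(1), of n] by linarith
      qed
      finally show ?thesis using less_stop_index_iff[of ?k "\<lambda>k. x k \<omega>" J] by (simp add: not_less[symmetric])
    qed
    then show ?thesis using real(1) by (simp add: real(2))
  qed simp
qed

text \<open>Grid points are among the times of the supremum, so discretisation errs in the
  favourable direction here.\<close>

lemma sup_ge: "hi (T \<omega>) \<omega> \<le> sup_process X (real L) \<omega>"
proof (rule run_max_le)
  fix k assume k: "k < T \<omega>"
  have TL: "real (T \<omega>) / 2 ^ n \<le> real L"
  proof -
    have "real (T \<omega>) \<le> real J" unfolding of_nat_le_iff by (rule stop_index_le)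
    then show ?thesis by (simp add: pos_divide_le_eq)
  qed
  have kT: "real (Suc k) / 2 ^ n \<le> real (T \<omega>) / 2 ^ n" using k by (intro divide_right_mono) auto
  have "compact ((\<lambda>t. X t \<omega>) ` {0..real L})"
    by (intro compact_continuous_image continuous_on_subset[OF X_continuous]) auto
  then have bdd: "bdd_above ((\<lambda>t. X t \<omega>) ` {0..real L})"
    by (intro bounded_imp_bdd_above compact_imp_bounded)
  have "x (Suc k) \<omega> = X (real (Suc k) / 2 ^ n) \<omega>" using kT by (subst X_eq) (simp_all add: x_def min_absorb2)
  also have "\<dots> \<le> (SUP s\<in>{0..real L}. X s \<omega>)"
    using kT TL by (intro cSUP_upper bdd) auto
  finally show "x (Suc k) \<omega> \<le> sup_process X (real L) \<omega>" by (simp add: sup_process_def)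
qed (simp add: sup_process_def)

text \<open>Between grid points the path can fall below the grid minimum, by at most the oscillation
  in \<open>osc_tail\<close>. As the floor is 1 and p < 1, the power has slope at most 1 there, so
  this error enters linearly and its mean is controlled by \<open>osc_tail_integral\<close>.\<close>

lemma inf_le:
  assumes \<omega>: "\<omega> \<in> Good" and t: "0 \<le> t"
  shows "ennreal (\<bar>inf_process X t \<omega>\<bar> powr p) \<le> ennreal (lo (T \<omega>) \<omega> powr p) + osc_tail (Suc L) (Suc n) \<omega>"
proof (cases "osc_tail (Suc L) (Suc n) \<omega>")
  case (real z)
  have TL: "real (T \<omega>) / 2 ^ n \<le> real L"
  proof -
    have "real (T \<omega>) \<le> real J" unfolding of_nat_le_iff by (rule stop_index_le)
    then show ?thesis by (simp add: pos_divide_le_eq)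
  qed
  have "- (lo (T \<omega>) \<omega> + z) \<le> X s \<omega>" if s: "s \<in> {0..t}" for s
  proof -
    define r where "r = min (real (T \<omega>) / 2 ^ n) s"
    \<comment> \<open>r may equal L, and \<open>B_approx\<close> asks for a strict bound; hence Suc
      L.\<close>
    have r: "0 \<le> r" "r < real (Suc L)" "r \<le> real (T \<omega>) / 2 ^ n" using s TL by (auto simp: r_def)
    have "real (dyadic_floor n r) \<le> real (T \<omega>)"
      using dyadic_floor_bounds(1)[OF r(1), of n] r(3) by (simp add: pos_le_divide_eq mult.commute)
    then have fT: "dyadic_floor n r \<le> T \<omega>" by simp
    have "ennreal \<bar>B r \<omega> - S n (dyadic_floor n r) \<omega>\<bar> \<le> ennreal z"
      using B_approx[OF \<omega> r(1,2), of n] real(2) by simp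
    then have "\<bar>B r \<omega> - S n (dyadic_floor n r) \<omega>\<bar> \<le> z" using real(1) by simp
    moreover have "S n (dyadic_floor n r) \<omega> = x (dyadic_floor n r) \<omega>"
      by (simp add: x_def B_dyadic[OF \<omega>])
    moreover have "- lo (T \<omega>) \<omega> \<le> x (dyadic_floor n r) \<omega>"
      using bounds(3)[of \<omega> "dyadic_floor n r"] run_min_mono[OF fT, of 1 "\<lambda>k. x k \<omega>"] by linarith
    moreover have "X s \<omega> = B r \<omega>" using s by (simp add: X_eq r_def)
    ultimately show ?thesis by linarith
  qed
  then have "- (lo (T \<omega>) \<omega> + z) \<le> (INF s\<in>{0..t}. X s \<omega>)"
    using t by (intro cINF_greatest) auto
  then have "\<bar>inf_process X t \<omega>\<bar> \<le> lo (T \<omega>) \<omega> + z"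
    using bounds(1)[of \<omega> "T \<omega>"] real(1) by (auto simp: inf_process_def min_def)
  then have "\<bar>inf_process X t \<omega>\<bar> powr p \<le> (lo (T \<omega>) \<omega> + z) powr p"
    using p by (intro powr_mono2) auto
  also have "\<dots> \<le> lo (T \<omega>) \<omega> powr p + z"
  proof -
    have "(lo (T \<omega>) \<omega> + z) powr p - lo (T \<omega>) \<omega> powr p \<le> p * lo (T \<omega>) \<omega> powr (p - 1) * z"
      using powr_diff_upper[OF p, of "lo (T \<omega>) \<omega>" "lo (T \<omega>) \<omega> + z"] bounds(1)[of \<omega> "T \<omega>"] real(1) by simp
    also have "\<dots> \<le> (1 * 1) * z"
      using p real(1) bounds(1)[of \<omega> "T \<omega>"] powr_mono[of "p - 1" 0 "lo (T \<omega>) \<omega>"]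
      by (intro mult_right_mono mult_mono) auto
    finally show ?thesis by simp
  qed
  finally have "ennreal (\<bar>inf_process X t \<omega>\<bar> powr p) \<le> ennreal (lo (T \<omega>) \<omega> powr p + z)"
    by (rule ennreal_leI)
  then show ?thesis using real by simp
qed simp

text \<open>e bounds the mean of \<open>osc_tail\<close>, so one number b bounds the p-th moment of
  the infimum at all times, while for the supremum the time L suffices. A negative c acts as 0 under
  \<open>ennreal\<close>, whence the maximum in \<kappa>.\<close>

lemma not_norm_le:
  fixes c e :: real
  defines "e \<equiv> (1 + 3 * real (Suc L)) * osc_rate ^ Suc n / (1 - osc_rate)"
  assumes L: "0 < L" and \<kappa>c: "\<kappa> = max c 0 powr p"
    and gap: "3 * error_const * real L / 2 ^ n + 2 * value_bound * (2 * (\<rho> * N + N) / sqrt (2 * pi * real L)) + \<kappa> * e < \<alpha> * d"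
  shows "\<not> process_norm M p (sup_process X) \<le> ennreal c * process_norm M p (inf_process X)"
proof -
  define a where "a = (\<integral>\<omega>. hi (T \<omega>) \<omega> powr p \<partial>M)"
  define b where "b = (\<integral>\<omega>. lo (T \<omega>) \<omega> powr p \<partial>M) + e"
  have e: "0 \<le> e" using osc_rate by (simp add: e_def)
  have b0: "0 \<le> b" unfolding b_def by (intro add_nonneg_nonneg e integral_nonneg_AE AE_I2) auto
  have a0: "0 \<le> a" unfolding a_def by (intro integral_nonneg_AE AE_I2) auto
  have ab: "\<kappa> * b < a"
    using expected_gain[OF L] gap by (simp add: a_def b_def distrib_left)
  have up: "ennreal a \<le> (\<integral>\<^sup>+\<omega>. ennreal (\<bar>sup_process X (real L) \<omega>\<bar> powr p) \<partial>M)"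
  proof -
    have "ennreal a = (\<integral>\<^sup>+\<omega>. ennreal (hi (T \<omega>) \<omega> powr p) \<partial>M)"
      unfolding a_def by (rule nn_integral_eq_integral[symmetric, OF hi_integrable]) simp
    also have "\<dots> \<le> (\<integral>\<^sup>+\<omega>. ennreal (\<bar>sup_process X (real L) \<omega>\<bar> powr p) \<partial>M)"
      by (intro nn_integral_mono ennreal_leI powr_mono2 order_trans[OF sup_ge abs_ge_self]) (use p bounds(2) in auto)
    finally show ?thesis .
  qed
  have down: "(\<integral>\<^sup>+\<omega>. ennreal (\<bar>inf_process X t \<omega>\<bar> powr p) \<partial>M) \<le> ennreal b" if t: "0 \<le> t" for t
  proof -
    have "(\<integral>\<^sup>+\<omega>. ennreal (\<bar>inf_process X t \<omega>\<bar> powr p) \<partial>M)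
        \<le> (\<integral>\<^sup>+\<omega>. ennreal (lo (T \<omega>) \<omega> powr p) + osc_tail (Suc L) (Suc n) \<omega> \<partial>M)"
      using AE_Good by (intro nn_integral_mono_AE, eventually_elim) (rule inf_le[OF _ t])
    also have "\<dots> = (\<integral>\<^sup>+\<omega>. ennreal (lo (T \<omega>) \<omega> powr p) \<partial>M) + (\<integral>\<^sup>+\<omega>. osc_tail (Suc L) (Suc n) \<omega> \<partial>M)"
      by (rule nn_integral_add) (use borel_measurable_integrable[OF lo_integrable] in measurable)
    also have "\<dots> \<le> ennreal (\<integral>\<omega>. lo (T \<omega>) \<omega> powr p \<partial>M) + ennreal e"
    proof (rule add_mono)
      show "(\<integral>\<^sup>+\<omega>. ennreal (lo (T \<omega>) \<omega> powr p) \<partial>M) \<le> ennreal (\<integral>\<omega>. lo (T \<omega>) \<omega> powr p \<partial>M)"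
        by (rule eq_refl, rule nn_integral_eq_integral[OF lo_integrable]) simp
    qed (unfold e_def, rule osc_tail_integral)
    also have "\<dots> = ennreal b"
      unfolding b_def by (rule ennreal_plus[symmetric]) (use e in \<open>auto intro!: integral_nonneg_AE\<close>)
    finally show ?thesis .
  qed
  have "ennreal c * process_norm M p (inf_process X) \<le> ennreal c * ennreal (b powr (1 / p))"
    unfolding process_norm_def
  proof (intro mult_left_mono SUP_least)
    fix t :: real assume "t \<in> {0..}"
    then show "ennreal_powr (\<integral>\<^sup>+\<omega>. ennreal (\<bar>inf_process X t \<omega>\<bar> powr p) \<partial>M) (1 / p) \<le> ennreal (b powr (1 / p))"
      using ennreal_powr_mono[OF down[of t], of "1 / p"] p b0 by (simp add: ennreal_powr_ennreal)
  qed simp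
  also have "ennreal c * ennreal (b powr (1 / p)) = ennreal (max c 0 * b powr (1 / p))"
    by (simp add: ennreal_mult max_def ennreal_neg)
  also have "max c 0 = \<kappa> powr (1 / p)" using p by (simp add: \<kappa>c powr_powr)
  also have "\<kappa> powr (1 / p) * b powr (1 / p) = (\<kappa> * b) powr (1 / p)"
    using \<kappa> b0 by (simp add: powr_mult)
  also have "ennreal ((\<kappa> * b) powr (1 / p)) < ennreal (a powr (1 / p))"
  proof (rule ennreal_lessI)
    have "0 \<le> \<kappa> * b" using \<kappa> b0 by simp
    then show "(\<kappa> * b) powr (1 / p) < a powr (1 / p)" "0 < a powr (1 / p)"
      using ab p by (auto intro!: powr_less_mono2)
  qed
  also have "\<dots> = ennreal_powr (ennreal a) (1 / p)" using a0 by (simp add: ennreal_powr_ennreal)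
  also have "\<dots> \<le> ennreal_powr (\<integral>\<^sup>+\<omega>. ennreal (\<bar>sup_process X (real L) \<omega>\<bar> powr p) \<partial>M) (1 / p)"
    using up p by (intro ennreal_powr_mono) auto
  also have "\<dots> \<le> process_norm M p (sup_process X)"
    unfolding process_norm_def by (rule SUP_upper) simp
  finally show ?thesis by (simp add: not_le)
qed

end

section \<open>The underlying probability space and the choice of the grid\<close>

lemma (in prob_space) indep_vars_completion:
  assumes "indep_vars K Y I"
  shows "prob_space.indep_vars (completion M) K Y I"
proof -
  interpret C: prob_space "completion M" by (rule prob_space_completion)
  have rv: "Y i \<in> M \<rightarrow>\<^sub>M K i" if "i \<in> I" for i using assms that by (auto simp: indep_vars_def)
  show ?thesis
    unfolding C.indep_vars_def2
  proof (intro conjI ballI C.indep_setsI)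
    fix i assume i: "i \<in> I"
    show "Y i \<in> completion M \<rightarrow>\<^sub>M K i" by (rule measurable_completion[OF rv[OF i]])
    then show "{Y i -` A \<inter> space (completion M) |A. A \<in> sets (K i)} \<subseteq> sets (completion M)"
      by (auto dest: measurable_sets)
  next
    fix A J assume J: "J \<noteq> {}" "J \<subseteq> I" "finite J"
      and "\<forall>j\<in>J. A j \<in> {Y j -` A \<inter> space (completion M) |A. A \<in> sets (K j)}"
    then have "\<forall>j\<in>J. \<exists>C. C \<in> sets (K j) \<and> A j = Y j -` C \<inter> space M" by auto
    from bchoice[OF this] obtain C where C: "\<forall>j\<in>J. C j \<in> sets (K j) \<and> A j = Y j -` C j \<inter> space M" ..
    have ev: "A j \<in> events" if "j \<in> J" for j
      using C measurable_sets[OF rv, of j "C j"] J(2) that by auto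
    have "prob (\<Inter>j\<in>J. Y j -` C j \<inter> space M) = (\<Prod>j\<in>J. prob (Y j -` C j \<inter> space M))"
      by (rule indep_varsD[OF assms J(1,3,2)]) (use C in simp)
    moreover have "(\<Inter>j\<in>J. A j) = (\<Inter>j\<in>J. Y j -` C j \<inter> space M)" using C by simp
    ultimately have "prob (\<Inter>j\<in>J. A j) = (\<Prod>j\<in>J. prob (A j))" using C by simp
    moreover have "(\<Inter>j\<in>J. A j) \<in> events" using ev J by (intro sets.finite_INT) auto
    ultimately show "C.prob (\<Inter>j\<in>J. A j) = (\<Prod>j\<in>J. C.prob (A j))" using ev by simp
  qed
qed

text \<open>Real indices give the sample points the type \<open>real \<Rightarrow> real\<close> of
  the statement; the normal family sits at the codes of pairs of naturals. The completion supplies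
  the completeness required of a filtered space.\<close>

definition gauss_space :: "(real \<Rightarrow> real) measure" where
  "gauss_space = completion (PiM UNIV (\<lambda>_. std_normal_distribution))"

lemma gauss_space_family: "gaussian_family gauss_space (\<lambda>m k \<omega>. \<omega> (real (prod_encode (m, k))))"
proof -
  let ?P = "PiM (UNIV :: real set) (\<lambda>_. std_normal_distribution)"
  have N: "prob_space std_normal_distribution" by (rule prob_space_normal_density) simp
  interpret P: prob_space ?P by (intro prob_space_PiM N)
  interpret C: prob_space gauss_space unfolding gauss_space_def by (rule P.prob_space_completion)
  interpret CM: complete_measure gauss_space unfolding gauss_space_def by (rule completion.complete_measure_axioms)
  have sets_P: "sets ?P = sets (PiM UNIV (\<lambda>_. borel))" by (intro sets_PiM_cong) auto
  have m [measurable]: "(\<lambda>\<omega>. \<omega> i) \<in> borel_measurable ?P" for i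
    using measurable_component_singleton[of i UNIV "\<lambda>_. std_normal_distribution"] by (simp cong: measurable_cong_sets)
  have comp: "distr ?P borel (\<lambda>\<omega>. \<omega> i) = std_normal_distribution" for i
    using distr_PiM_component[of UNIV "\<lambda>_. std_normal_distribution" i, OF N] by (simp cong: distr_cong)
  have ind: "P.indep_vars (\<lambda>_. borel) (\<lambda>i \<omega>. \<omega> i) UNIV"
  proof (subst P.indep_vars_iff_distr_eq_PiM')
    have "distr ?P (PiM UNIV (\<lambda>_. borel)) (\<lambda>\<omega>. \<omega>) = ?P"
      by (rule distr_id2[OF sets_P[symmetric]])
    then show "distr ?P (PiM UNIV (\<lambda>_. borel)) (\<lambda>\<omega>. \<lambda>i\<in>UNIV. \<omega> i) = (\<Pi>\<^sub>M i\<in>UNIV. distr ?P borel (\<lambda>\<omega>. \<omega> i))"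
      by (simp add: comp restrict_def)
  qed (auto simp: m)
  define g :: "nat \<times> nat \<Rightarrow> real" where "g = (\<lambda>j. real (prod_encode j))"
  have "inj g" by (auto simp: inj_on_def g_def)
  then have "P.indep_vars (\<lambda>_. borel) (\<lambda>i \<omega>. \<omega> (g i)) UNIV"
    by (intro P.indep_vars_reindex[OF ind]) simp_all
  moreover have "(\<lambda>i \<omega>. \<omega> (g i)) = (\<lambda>(m, k) \<omega>. \<omega> (real (prod_encode (m, k))) :: real)"
    by (auto simp: g_def fun_eq_iff)
  ultimately have "P.indep_vars (\<lambda>_. borel) (\<lambda>(m, k) \<omega>. \<omega> (real (prod_encode (m, k)))) UNIV"
    by simp
  then have "C.indep_vars (\<lambda>_. borel) (\<lambda>(m, k) \<omega>. \<omega> (real (prod_encode (m, k)))) UNIV"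
    unfolding gauss_space_def by (rule P.indep_vars_completion)
  moreover have "C.std_normal (\<lambda>\<omega>. \<omega> (real (prod_encode (m, k))))" for m k
  proof -
    have "(\<lambda>\<omega>. \<omega> (real (prod_encode (m, k)))) \<in> borel_measurable gauss_space"
      unfolding gauss_space_def by (rule measurable_completion) (rule m)
    then show ?thesis
      using comp by (simp add: C.std_normal_distr) (simp add: gauss_space_def distr_completion m)
  qed
  ultimately show ?thesis by unfold_locales auto
qed

lemma sharpness:
  assumes p: "0 < p" "p < 1" and c: "c < c_const p"
  shows "\<exists>(M :: (real \<Rightarrow> real) measure) F B \<eta> X.
        brownian_motion M B \<and> F = augmented_filtration M B \<and>
        stopping_time_ext F \<eta> \<and> X = stopped B \<eta> \<and>
        complete_filtered_prob_space M F \<and> nonneg_jump_supermartingale M F X \<and>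
        \<not> process_norm M p (sup_process X) \<le> ennreal c * process_norm M p (inf_process X)"
proof -
  define \<kappa> where "\<kappa> = max c 0 powr p"
  have \<kappa>: "0 \<le> \<kappa>" "\<kappa> < ratio_const p"
  proof -
    have "max c 0 < ratio_const p powr (1 / p)"
      using c ratio_const_pos[OF p] by (simp add: c_const_eq)
    then have "max c 0 powr p < (ratio_const p powr (1 / p)) powr p"
      using p by (intro powr_less_mono2) auto
    then show "\<kappa> < ratio_const p" using p ratio_const_pos[OF p] by (simp add: \<kappa>_def powr_powr)
  qed (simp add: \<kappa>_def)
  obtain \<theta> \<rho> \<delta> N d where st: "strategy p \<kappa> \<theta> \<rho> \<delta> N d"
    using strategy_exists[OF p \<kappa>] by auto
  interpret strategy p \<kappa> \<theta> \<rho> \<delta> N d by (rule st)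
  let ?\<xi> = "\<lambda>m k \<omega>. \<omega> (real (prod_encode (m, k))) :: real"
  interpret G: gaussian_family gauss_space ?\<xi> by (rule gauss_space_family)
  have \<alpha>d: "0 < \<alpha> * d" using \<alpha> d by simp
  \<comment> \<open>L is fixed before n: the discretisation errors grow with L, but vanish for fixed
    L as n grows.\<close>
  have "((\<lambda>L. 2 * value_bound * (2 * (\<rho> * N + N) / sqrt (2 * pi * real L))) \<longlongrightarrow> 0) sequentially"
    by (intro tendsto_mult_right_zero real_tendsto_divide_at_top[OF tendsto_const]
        filterlim_compose[OF sqrt_at_top] filterlim_tendsto_pos_mult_at_top[OF tendsto_const _ filterlim_real_sequentially])
      simp
  then have "\<forall>\<^sub>F L in sequentially. 2 * value_bound * (2 * (\<rho> * N + N) / sqrt (2 * pi * real L)) < \<alpha> * d / 3"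
    using \<alpha>d by (intro order_tendstoD(2)) auto
  then have "\<forall>\<^sub>F L in sequentially. 2 * value_bound * (2 * (\<rho> * N + N) / sqrt (2 * pi * real L)) < \<alpha> * d / 3 \<and> 0 < L"
    using eventually_gt_at_top[of 0] by eventually_elim simp
  from eventually_happens[OF this] obtain L where
    L: "2 * value_bound * (2 * (\<rho> * N + N) / sqrt (2 * pi * real L)) < \<alpha> * d / 3" "0 < L" by auto
  define e where "e n = (1 + 3 * real (Suc L)) * G.osc_rate ^ Suc n / (1 - G.osc_rate)" for n
  have "(\<lambda>n. 3 * error_const * real L * (1 / 2) ^ n + \<kappa> * e n) \<longlonglongrightarrow> 3 * error_const * real L * 0 + \<kappa> * ((1 + 3 * real (Suc L)) * 0 / (1 - G.osc_rate))"
    unfolding e_def using G.osc_rate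
    by (intro tendsto_add tendsto_mult tendsto_const tendsto_divide LIMSEQ_Suc LIMSEQ_realpow_zero) auto
  then have "\<forall>\<^sub>F n in sequentially. 3 * error_const * real L * (1 / 2) ^ n + \<kappa> * e n < \<alpha> * d / 3"
    using \<alpha>d by (intro order_tendstoD(2)) auto
  then obtain n where n: "3 * error_const * real L * (1 / 2) ^ n + \<kappa> * e n < \<alpha> * d / 3"
    by (auto simp: eventually_sequentially)
  interpret stopped_strategy gauss_space ?\<xi> p \<kappa> \<theta> \<rho> \<delta> N d n L ..
  have "3 * error_const * real L / 2 ^ n + 2 * value_bound * (2 * (\<rho> * N + N) / sqrt (2 * pi * real L)) + \<kappa> * e n < \<alpha> * d"
    using n L \<alpha>d by (simp add: power_divide)
  then have "\<not> process_norm gauss_space p (sup_process X) \<le> ennreal c * process_norm gauss_space p (inf_process X)"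
    unfolding e_def by (intro not_norm_le[OF L(2) \<kappa>_def])
  then show ?thesis
    by (intro exI conjI) (rule G.B_brownian refl eta_stopping_time G.augmented_complete_filtered X_nonneg_jump_supermartingale | assumption)+
qed

theorem theorem1p4:
  fixes p :: real
  assumes "0 < p" and "p < 1"
  shows
    "(\<forall>(M :: 'a measure) F X.
        complete_filtered_prob_space M F \<and> nonneg_jump_supermartingale M F X \<longrightarrow>
        process_norm M p (sup_process X)
          \<le> ennreal (c_const p) * process_norm M p (inf_process X))
   \<and> (\<forall>c < c_const p. \<exists>(M :: (real \<Rightarrow> real) measure) F X.
        complete_filtered_prob_space M F \<and> nonneg_jump_supermartingale M F X \<and>
        \<not> process_norm M p (sup_process X) \<le> ennreal c * process_norm M p (inf_process X))
   \<and> (\<forall>c < c_const p. \<exists>(M :: (real \<Rightarrow> real) measure) F B \<eta> X.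
        brownian_motion M B \<and> F = augmented_filtration M B \<and>
        stopping_time_ext F \<eta> \<and> X = stopped B \<eta> \<and>
        complete_filtered_prob_space M F \<and> nonneg_jump_supermartingale M F X \<and>
        \<not> process_norm M p (sup_process X) \<le> ennreal c * process_norm M p (inf_process X))"
proof (intro conjI allI impI)
  fix M :: "'a measure" and F X
  assume *: "complete_filtered_prob_space M F \<and> nonneg_jump_supermartingale M F X"
  then interpret complete_filtered_prob_space M F by simp
  show "process_norm M p (sup_process X) \<le> ennreal (c_const p) * process_norm M p (inf_process X)"
    using process_norm_sup_le[OF assms] * by simp
next
  fix c assume "c < c_const p"
  from sharpness[OF assms this]
  show "\<exists>(M :: (real \<Rightarrow> real) measure) F X.
        complete_filtered_prob_space M F \<and> nonneg_jump_supermartingale M F X \<and>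
        \<not> process_norm M p (sup_process X) \<le> ennreal c * process_norm M p (inf_process X)"
    by (elim exE conjE) (intro exI conjI)
next
  fix c assume "c < c_const p"
  then show "\<exists>(M :: (real \<Rightarrow> real) measure) F B \<eta> X.
        brownian_motion M B \<and> F = augmented_filtration M B \<and>
        stopping_time_ext F \<eta> \<and> X = stopped B \<eta> \<and>
        complete_filtered_prob_space M F \<and> nonneg_jump_supermartingale M F X \<and>
        \<not> process_norm M p (sup_process X) \<le> ennreal c * process_norm M p (inf_process X)"
    by (rule sharpness[OF assms])
qed

end
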